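(* Let $T=(T_1,\dots,T_k)\in\mathbf B_\Lambda(\mathcal H)$ be a completely non-coisometric $k$-tuple. Then $$\Psi_T(A):=\text{SOT-}\lim_{r\to1}K_{rT}^*(A\otimes I)K_{rT},\qquad A\in F^\infty(\mathbf B_\Lambda),$$ exists and defines a linear map $\Psi_T:F^\infty(\mathbf B_\Lambda)\to B(\mathcal H)$ with the following properties. (i) If $\varphi(\{S_{i,s}\})$ is the Fourier representation of $A\in F^\infty(\mathbf B_\Lambda)$, then $\Psi_T(A)=\text{SOT-}\lim_{r\to1}\varphi(\{rT_{i,s}\})$. (ii) $\Psi_T$ is WOT- (resp. SOT-, w*-) continuous on bounded sets. (iii) $\Psi_T$ is a unital completely contractive homomorphism.
   Context: Let $k,n_1,\dots,n_k$ be positive integers. For $i,j\in\{1,\dots,k\}$, $i\ne j$, let $\Lambda_{ij}=[\lambda_{i,j}(s,t)]$ be an $n_i\times n_j$ matrix with entries in $\mathbb T=\{z\in\mathbb C:|z|=1\}$, with $\Lambda_{ji}=\Lambda_{ij}^*$, i.e. $\lambda_{j,i}(t,s)=\overline{\lambda_{i,j}(s,t)}$. Words: $\mathbb F_{n_i}^+$ is the unital free semigroup with generators $g^i_1,\dots,g^i_{n_i}$ and neutral element $g^i_0$; $|\alpha|$ is the length of a word. If $X_{i,1},\dots,X_{i,n_i}$ are operators and $\alpha=g^i_{p_1}\cdots g^i_{p_m}$, put $X_{i,\alpha}=X_{i,p_1}\cdots X_{i,p_m}$, and $X_{i,g^i_0}=I$. Set $\mathbf F=\mathbb F_{n_1}^+\times\cdots\times\mathbb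 F_{n_k}^+$; for $\boldsymbol\beta=(\beta_1,\dots,\beta_k)\in\mathbf F$ put $X_{\boldsymbol\beta}=X_{1,\beta_1}\cdots X_{k,\beta_k}$ and $|\boldsymbol\beta|=|\beta_1|+\cdots+|\beta_k|$. Universal model: on $\ell^2(\mathbf F)$ with orthonormal basis $\{\chi_{(\alpha_1,\dots,\alpha_k)}\}$, $$S_{i,s}\chi_{(\alpha_1,\dots,\alpha_k)}=\boldsymbol\lambda_{i,1}(s,\alpha_1)\cdots\boldsymbol\lambda_{i,i-1}(s,\alpha_{i-1})\,\chi_{(\alpha_1,\dots,\alpha_{i-1},g^i_s\alpha_i,\alpha_{i+1},\dots,\alpha_k)}$$ (no scalar factor if $i=1$), where $\boldsymbol\lambda_{i,j}(s,\beta)=\prod_{b=1}^q\lambda_{i,j}(s,j_b)$ for $\beta=g^j_{j_1}\cdots g^j_{j_q}$ and $\boldsymbol\lambda_{i,j}(s,g^j_0)=1$. Regular $\Lambda$-polyball: $\mathbf B_\Lambda(\mathcal H)$ is the set of $k$-tuples $T=(T_1,\dots,T_k)$ of row contractions $T_i=[T_{i,1}\cdots T_{i,n_i}]$, $T_{i,s}\in B(\mathcal H)$, $\sum_sT_{i,s}T_{i,s}^*\le I$, such that $T_{i,s}T_{j,t}=\lambda_{i,j}(s,t)T_{j,t}T_{i,s}$ for all $i\ne j$ and all $s,t$, and $\Delta_{rT}(I)\ge0$ for all $r\in[0,1)$, where $\Phi_{T_i}(X)=\sum_{s}T_{i,s}XT_{i,s}^*$, $\Delta_T(I)=(\mathrm{id}-\Phi_{T_k})\circ\cdots\circ(\mathrm{id}-\Phi_{T_1})(I)$,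 and $rT$ is the tuple with entries $rT_{i,s}$ (so $\Phi_{rT_i}=r^2\Phi_{T_i}$). For $T\in\mathbf B_\Lambda(\mathcal H)$ one has $\Delta_T(I)\ge0$ and $rT\in\mathbf B_\Lambda(\mathcal H)$. $T$ is completely non-coisometric if there is no $h\in\mathcal H$, $h\ne0$, with $\langle(\mathrm{id}-\Phi_{T_k}^{p_k})\circ\cdots\circ(\mathrm{id}-\Phi_{T_1}^{p_1})(I)h,h\rangle=0$ for all $(p_1,\dots,p_k)\in\mathbb N^k$. Berezin kernel: for $T\in\mathbf B_\Lambda(\mathcal H)$, $\mathcal D(T)=\overline{\Delta_T(I)\mathcal H}$ and $K_T:\mathcal H\to\ell^2(\mathbf F)\otimes\mathcal D(T)$, $$K_Th=\sum_{(\beta_1,\dots,\beta_k)\in\mathbf F}\chi_{(\beta_1,\dots,\beta_k)}\otimes\Delta_T(I)^{1/2}T_{k,\beta_k}^*\cdots T_{1,\beta_1}^*h .$$ In $A\otimes I$, $I$ is the identity on the second tensor factor. Noncommutative Hardy space: let $\{c_{\boldsymbol\beta}\}\subset\mathbb C$ with $\sum|c_{\boldsymbol\beta}|^2<\infty$ and consider the formal series $\varphi(\{S_{i,s}\})=\sum_{\boldsymbol\beta}c_{\boldsymbol\beta}\mathbf S_{\boldsymbol\beta}$, $\mathbf S_{\boldsymbol\beta}=S_{1,\beta_1}\cdots S_{k,\beta_k}$. It acts on $\mathcal P=\mathrm{span}\{\chi_{\boldsymbol\gamma}\}$ by $\varphi(\{S_{i,s}\})\chi_{\boldsymbol\gamma}=\sum_{\boldsymbol\beta}c_{\boldsymbol\beta}\mathbf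 S_{\boldsymbol\beta}\chi_{\boldsymbol\gamma}\in\ell^2(\mathbf F)$. If $\sup_{p\in\mathcal P,\|p\|\le1}\|\varphi(\{S_{i,s}\})p\|<\infty$, there is a unique $A\in B(\ell^2(\mathbf F))$ extending it. $F^\infty(\mathbf B_\Lambda)$ is the set of all such $A$ (it is a unital algebra), and $\varphi(\{S_{i,s}\})$ is the Fourier representation of $A$. For $r\in[0,1)$, $\varphi(\{rT_{i,s}\})=\sum_{p=0}^\infty\sum_{|\boldsymbol\beta|=p}r^pc_{\boldsymbol\beta}T_{\boldsymbol\beta}$ (operator norm convergence of the outer series). SOT, WOT, w* denote the strong operator, weak operator and weak-* topologies. *)

theory Defs
  imports "HOL-Analysis.Analysis" "HOL-Library.Nonpos_Ints"
begin

section \<open>Complex Hilbert spaces\<close>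

text \<open>The inner product is linear in the first argument. The real inner product of the superclass is
  its real part, so norm, topology and completeness are those of the library.\<close>

class complex_hilbert = real_inner + complete_space +
  fixes scaleC :: "complex \<Rightarrow> 'a \<Rightarrow> 'a" (infixr "*\<^sub>C" 75)
    and cinner :: "'a \<Rightarrow> 'a \<Rightarrow> complex"
  assumes scaleC_add_right: "a *\<^sub>C (x + y) = a *\<^sub>C x + a *\<^sub>C y"
    and scaleC_add_left: "(a + b) *\<^sub>C x = a *\<^sub>C x + b *\<^sub>C x"
    and scaleC_scaleC: "a *\<^sub>C b *\<^sub>C x = (a * b) *\<^sub>C x"
    and scaleC_of_real: "complex_of_real r *\<^sub>C x = r *\<^sub>R x"
    and cinner_add_left: "cinner (x + y) z = cinner x z + cinner y z"
    and cinner_scaleC_left: "cinner (a *\<^sub>C x) y = a * cinner x y"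
    and cinner_commute: "cinner y x = cnj (cinner x y)"
    and Re_cinner: "Re (cinner x y) = inner x y"

subclass (in complex_hilbert) banach ..

instantiation complex :: complex_hilbert
begin
definition "scaleC_complex (a::complex) (x::complex) = a * x"
definition "cinner_complex (x::complex) (y::complex) = x * cnj y"
instance
  by standard (auto simp: scaleC_complex_def cinner_complex_def algebra_simps scaleR_conv_of_real
      inner_complex_def)
end

lemma cinner_self: "cinner x x = complex_of_real ((norm x)\<^sup>2)"
proof -
  have "Im (cinner x x) = 0"
    using cinner_commute[of x x] by (metis Im_complex_of_real Reals_cnj_iff complex_is_Real_iff)
  then show ?thesis
    by (simp add: complex_eq_iff Re_cinner power2_norm_eq_inner)
qed

lemma norm_scaleC: "norm (a *\<^sub>C (x::'a::complex_hilbert)) = cmod a * norm x"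
proof -
  have "complex_of_real ((norm (a *\<^sub>C x))\<^sup>2) = cinner (a *\<^sub>C x) (a *\<^sub>C x)"
    by (simp add: cinner_self)
  also have "\<dots> = a * cnj (a * cinner x x)"
    using cinner_commute[of "a *\<^sub>C x" x] by (simp add: cinner_scaleC_left)
  also have "\<dots> = complex_of_real ((cmod a * norm x)\<^sup>2)"
    by (simp add: cinner_self power_mult_distrib complex_norm_square del: of_real_power)
  finally have "(norm (a *\<^sub>C x))\<^sup>2 = (cmod a * norm x)\<^sup>2"
    using of_real_eq_iff by blast
  then show ?thesis
    by (simp add: power2_eq_iff_nonneg)
qed

lemma norm_cinner_le: "cmod (cinner x (y::'a::complex_hilbert)) \<le> 2 * (norm x * norm y)"
proof -
  have "Im (cinner x y) = Re (cinner ((-\<i>) *\<^sub>C x) y)"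
    by (simp add: cinner_scaleC_left)
  also have "\<bar>\<dots>\<bar> \<le> norm ((-\<i>) *\<^sub>C x) * norm y"
    by (simp add: Re_cinner Cauchy_Schwarz_ineq2)
  finally have "\<bar>Im (cinner x y)\<bar> \<le> norm x * norm y"
    by (simp add: norm_scaleC)
  moreover have "\<bar>Re (cinner x y)\<bar> \<le> norm x * norm y"
    by (simp add: Re_cinner Cauchy_Schwarz_ineq2)
  ultimately show ?thesis
    using cmod_le[of "cinner x y"] by linarith
qed


section \<open>Square-summable families\<close>

text \<open>The values may lie in an arbitrary Hilbert space: \<open>('i, complex) ell2\<close> is the scalar space and
  \<open>('i, 'h) ell2\<close> is its Hilbert tensor product with \<open>'h\<close>, elementary tensors being
  \<open>ell2_tensor u e\<close> below.\<close>

typedef (overloaded) ('i, 'h::complex_hilbert) ell2 =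
  "{f :: 'i \<Rightarrow> 'h. (\<lambda>i. (norm (f i))\<^sup>2) summable_on UNIV}"
  morphisms ell2_nth Abs_ell2
  by (rule exI[of _ "\<lambda>_. 0"]) auto

setup_lifting type_definition_ell2

lemma ell2_summable: "(\<lambda>i. (norm (ell2_nth f i))\<^sup>2) summable_on UNIV"
  using ell2_nth[of f] by simp

lemma ell2_add_summable:
  fixes f g :: "'i \<Rightarrow> 'h::complex_hilbert"
  assumes "(\<lambda>i. (norm (f i))\<^sup>2) summable_on UNIV" "(\<lambda>i. (norm (g i))\<^sup>2) summable_on UNIV"
  shows "(\<lambda>i. (norm (f i + g i))\<^sup>2) summable_on UNIV"
proof (rule summable_on_comparison_test)
  show "(\<lambda>i. 2 * (norm (f i))\<^sup>2 + 2 * (norm (g i))\<^sup>2) summable_on UNIV"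
    using assms by (intro summable_on_add summable_on_cmult_right)
  show "(norm (f i + g i))\<^sup>2 \<le> 2 * (norm (f i))\<^sup>2 + 2 * (norm (g i))\<^sup>2" for i
  proof -
    have "(norm (f i + g i))\<^sup>2 \<le> (norm (f i) + norm (g i))\<^sup>2"
      by (simp add: norm_triangle_ineq power_mono)
    also have "\<dots> \<le> 2 * (norm (f i))\<^sup>2 + 2 * (norm (g i))\<^sup>2"
      using zero_le_power2[of "norm (f i) - norm (g i)"]
      by (simp add: power2_sum power2_diff)
    finally show ?thesis .
  qed
qed simp

lemma ell2_product_summable:
  fixes f g :: "('i, 'h::complex_hilbert) ell2"
  shows "(\<lambda>i. norm (ell2_nth f i) * norm (ell2_nth g i)) summable_on UNIV"
proof (rule summable_on_comparison_test)
  show "(\<lambda>i. (norm (ell2_nth f i))\<^sup>2 + (norm (ell2_nth g i))\<^sup>2) summable_on UNIV"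
    by (intro summable_on_add ell2_summable)
  show "norm (ell2_nth f i) * norm (ell2_nth g i)
      \<le> (norm (ell2_nth f i))\<^sup>2 + (norm (ell2_nth g i))\<^sup>2" for i
  proof -
    have "0 \<le> norm (ell2_nth f i) * norm (ell2_nth g i)" by simp
    then show ?thesis
      using sum_squares_bound[of "norm (ell2_nth f i)" "norm (ell2_nth g i)"] by linarith
  qed
qed simp

lemma ell2_cinner_summable:
  fixes f g :: "('i, 'h::complex_hilbert) ell2"
  shows "(\<lambda>i. cinner (ell2_nth f i) (ell2_nth g i)) summable_on UNIV"
proof (rule abs_summable_summable)
  have "(\<lambda>i. 2 * (norm (ell2_nth f i) * norm (ell2_nth g i))) summable_on UNIV"
    by (intro summable_on_cmult_right ell2_product_summable)
  then show "(\<lambda>i. norm (cinner (ell2_nth f i) (ell2_nth g i))) summable_on UNIV"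
    by (rule summable_on_comparison_test) (auto simp: norm_cinner_le)
qed

lemma ell2_inner_summable:
  fixes f g :: "('i, 'h::complex_hilbert) ell2"
  shows "(\<lambda>i. inner (ell2_nth f i) (ell2_nth g i)) summable_on UNIV"
  using summable_on_bounded_linear[OF bounded_linear_Re ell2_cinner_summable[of f g]]
  by (simp add: o_def Re_cinner)

instantiation ell2 :: (type, complex_hilbert) real_inner
begin

lift_definition zero_ell2 :: "('a, 'b) ell2" is "\<lambda>_. 0" by simp
lift_definition plus_ell2 :: "('a, 'b) ell2 \<Rightarrow> ('a, 'b) ell2 \<Rightarrow> ('a, 'b) ell2"
  is "\<lambda>f g i. f i + g i" by (rule ell2_add_summable)
lift_definition scaleR_ell2 :: "real \<Rightarrow> ('a, 'b) ell2 \<Rightarrow> ('a, 'b) ell2"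
  is "\<lambda>a f i. a *\<^sub>R f i"
  by (simp add: power_mult_distrib summable_on_cmult_right)
lift_definition uminus_ell2 :: "('a, 'b) ell2 \<Rightarrow> ('a, 'b) ell2" is "\<lambda>f i. - f i" by simp
lift_definition minus_ell2 :: "('a, 'b) ell2 \<Rightarrow> ('a, 'b) ell2 \<Rightarrow> ('a, 'b) ell2"
  is "\<lambda>f g i. f i - g i"
  subgoal for f g using ell2_add_summable[of f "\<lambda>i. - g i"] by simp
  done

definition inner_ell2 :: "('a, 'b) ell2 \<Rightarrow> ('a, 'b) ell2 \<Rightarrow> real" where
  "inner_ell2 f g = (\<Sum>\<^sub>\<infinity>i. inner (ell2_nth f i) (ell2_nth g i))"
definition norm_ell2 :: "('a, 'b) ell2 \<Rightarrow> real" where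
  "norm_ell2 f = sqrt (\<Sum>\<^sub>\<infinity>i. (norm (ell2_nth f i))\<^sup>2)"
definition dist_ell2 :: "('a, 'b) ell2 \<Rightarrow> ('a, 'b) ell2 \<Rightarrow> real" where
  "dist_ell2 f g = norm (f - g)"
definition sgn_ell2 :: "('a, 'b) ell2 \<Rightarrow> ('a, 'b) ell2" where
  "sgn_ell2 f = inverse (norm f) *\<^sub>R f"
definition uniformity_ell2 :: "(('a, 'b) ell2 \<times> ('a, 'b) ell2) filter" where
  "uniformity_ell2 = (INF e\<in>{0<..}. principal {(x, y). dist x y < e})"
definition open_ell2 :: "('a, 'b) ell2 set \<Rightarrow> bool" where
  "open_ell2 U \<longleftrightarrow> (\<forall>x\<in>U. eventually (\<lambda>(x', y). x' = x \<longrightarrow> y \<in> U) uniformity)"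

instance
proof
  fix f g h :: "('a, 'b) ell2" and a b :: real
  show "f + g + h = f + (g + h)" "f + g = g + f" "0 + f = f" "- f + f = 0" "f - g = f + - g"
    "a *\<^sub>R (f + g) = a *\<^sub>R f + a *\<^sub>R g" "(a + b) *\<^sub>R f = a *\<^sub>R f + b *\<^sub>R f"
    "a *\<^sub>R b *\<^sub>R f = (a * b) *\<^sub>R f" "1 *\<^sub>R f = f"
    by (transfer; auto simp: algebra_simps)+
  show "dist f g = norm (f - g)" by (simp add: dist_ell2_def)
  show "sgn f = inverse (norm f) *\<^sub>R f" by (simp add: sgn_ell2_def)
  show "uniformity = (INF e\<in>{0<..}. principal {(x, y). dist (x::('a, 'b) ell2) y < e})"
    by (simp add: uniformity_ell2_def)
  show "open U = (\<forall>x\<in>U. eventually (\<lambda>(x', y). x' = x \<longrightarrow> y \<in> U) uniformity)"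
    for U :: "('a, 'b) ell2 set" by (simp add: open_ell2_def)
  show "inner f g = inner g f" by (simp add: inner_ell2_def inner_commute)
  show "inner (f + g) h = inner f h + inner g h"
    using infsum_add[OF ell2_inner_summable[of f h] ell2_inner_summable[of g h]]
    by (simp add: inner_ell2_def plus_ell2.rep_eq inner_add_left)
  show "inner (a *\<^sub>R f) g = a * inner f g"
    by (simp add: inner_ell2_def scaleR_ell2.rep_eq infsum_cmult_right')
  show "0 \<le> inner f f" by (simp add: inner_ell2_def infsum_nonneg)
  show "norm f = sqrt (inner f f)"
    by (simp add: norm_ell2_def inner_ell2_def power2_norm_eq_inner)
  show "inner f f = 0 \<longleftrightarrow> f = 0"
  proof
    assume 0: "inner f f = 0"
    have "inner (ell2_nth f i) (ell2_nth f i) = 0" for i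
      using 0 nonneg_infsum_le_0D[of "\<lambda>i. inner (ell2_nth f i) (ell2_nth f i)" UNIV i]
      by (simp add: inner_ell2_def ell2_inner_summable)
    then show "f = 0" by (simp add: ell2_nth_inject[symmetric] zero_ell2.rep_eq fun_eq_iff)
  qed (simp add: inner_ell2_def zero_ell2.rep_eq)
qed

end

lemma norm_ell2_sq: "(norm f)\<^sup>2 = (\<Sum>\<^sub>\<infinity>i. (norm (ell2_nth f i))\<^sup>2)"
  by (simp add: norm_ell2_def infsum_nonneg)

lemma sum_le_norm_ell2:
  assumes "finite F"
  shows "(\<Sum>i\<in>F. (norm (ell2_nth f i))\<^sup>2) \<le> (norm f)\<^sup>2"
  unfolding norm_ell2_sq by (rule finite_sum_le_infsum[OF ell2_summable assms]) auto

lemma norm_ell2_nth_le: "norm (ell2_nth f i) \<le> norm f"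
  using sum_le_norm_ell2[of "{i}" f] by (simp add: power2_le_iff_abs_le)

lemma ell2_Cauchy_convergent:
  fixes X :: "nat \<Rightarrow> ('i, 'h::complex_hilbert) ell2"
  assumes "Cauchy X"
  shows "convergent X"
proof -
  have "\<exists>l. (\<lambda>n. ell2_nth (X n) i) \<longlonglongrightarrow> l" for i
  proof -
    have "Cauchy (\<lambda>n. ell2_nth (X n) i)"
    proof (rule metric_CauchyI)
      fix e :: real assume "0 < e"
      with assms obtain M where "\<forall>m\<ge>M. \<forall>n\<ge>M. dist (X m) (X n) < e"
        using metric_CauchyD by blast
      moreover have "dist (ell2_nth (X m) i) (ell2_nth (X n) i) \<le> dist (X m) (X n)" for m n
        using norm_ell2_nth_le[of "X m - X n" i] by (simp add: dist_norm minus_ell2.rep_eq)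
      ultimately show "\<exists>M. \<forall>m\<ge>M. \<forall>n\<ge>M. dist (ell2_nth (X m) i) (ell2_nth (X n) i) < e"
        by (meson order_le_less_trans)
    qed
    then show ?thesis by (simp add: Cauchy_convergent_iff convergent_def)
  qed
  then obtain L where L: "\<And>i. (\<lambda>n. ell2_nth (X n) i) \<longlonglongrightarrow> L i" by metis
  have bound: "(\<Sum>i\<in>F. (norm (L i - ell2_nth (X n) i))\<^sup>2) \<le> e\<^sup>2"
    if "finite F" "\<forall>m\<ge>M. norm (X m - X n) \<le> e" for F M n e
  proof (rule LIMSEQ_le_const2)
    show "(\<lambda>m. \<Sum>i\<in>F. (norm (ell2_nth (X m) i - ell2_nth (X n) i))\<^sup>2)
        \<longlonglongrightarrow> (\<Sum>i\<in>F. (norm (L i - ell2_nth (X n) i))\<^sup>2)"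
      by (intro tendsto_intros L)
    show "\<exists>N. \<forall>m\<ge>N. (\<Sum>i\<in>F. (norm (ell2_nth (X m) i - ell2_nth (X n) i))\<^sup>2) \<le> e\<^sup>2"
    proof (intro exI allI impI)
      fix m assume "M \<le> m"
      then have "norm (X m - X n) \<le> e" using that by simp
      then have "(norm (X m - X n))\<^sup>2 \<le> e\<^sup>2" by (simp add: power_mono)
      then show "(\<Sum>i\<in>F. (norm (ell2_nth (X m) i - ell2_nth (X n) i))\<^sup>2) \<le> e\<^sup>2"
        using sum_le_norm_ell2[OF that(1), of "X m - X n"] by (simp add: minus_ell2.rep_eq)
    qed
  qed
  have summ: "(\<lambda>i. (norm (L i - ell2_nth (X n) i))\<^sup>2) summable_on UNIV"
    if "\<forall>m\<ge>M. norm (X m - X n) \<le> e" for M n e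
    by (rule nonneg_bdd_above_summable_on) (use bound[OF _ that] in \<open>auto intro!: bdd_aboveI2\<close>)
  obtain M where M: "\<forall>m\<ge>M. \<forall>n\<ge>M. norm (X m - X n) < 1"
    using metric_CauchyD[OF assms, of 1] by (auto simp: dist_norm)
  then have "(\<lambda>i. (norm ((L i - ell2_nth (X M) i) + ell2_nth (X M) i))\<^sup>2) summable_on UNIV"
    by (intro ell2_add_summable summ[of M M 1] ell2_summable) (simp add: less_imp_le)
  then have nth: "ell2_nth (Abs_ell2 L) = L"
    by (intro Abs_ell2_inverse) simp
  have "X \<longlonglongrightarrow> Abs_ell2 L"
  proof (rule metric_LIMSEQ_I)
    fix e :: real assume e: "0 < e"
    then obtain M where M: "\<forall>m\<ge>M. \<forall>n\<ge>M. norm (X m - X n) < e / 2"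
      using metric_CauchyD[OF assms, of "e / 2"] by (auto simp: dist_norm)
    have "dist (X n) (Abs_ell2 L) < e" if "M \<le> n" for n
    proof -
      have le: "\<forall>m\<ge>M. norm (X m - X n) \<le> e / 2" using M that by (simp add: less_imp_le)
      have "(norm (Abs_ell2 L - X n))\<^sup>2 \<le> (e / 2)\<^sup>2"
        unfolding norm_ell2_sq minus_ell2.rep_eq nth
        by (rule infsum_le_finite_sums[OF summ[OF le]]) (use bound[OF _ le] in auto)
      then have "norm (Abs_ell2 L - X n) \<le> e / 2"
        using e by (simp add: power2_le_iff_abs_le)
      then show ?thesis using e by (simp add: dist_norm norm_minus_commute)
    qed
    then show "\<exists>N. \<forall>n\<ge>N. dist (X n) (Abs_ell2 L) < e" by blast
  qed
  then show ?thesis by (rule convergentI)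
qed

instantiation ell2 :: (type, complex_hilbert) complex_hilbert
begin

lift_definition scaleC_ell2 :: "complex \<Rightarrow> ('a, 'b) ell2 \<Rightarrow> ('a, 'b) ell2"
  is "\<lambda>a f i. a *\<^sub>C f i"
  by (simp add: norm_scaleC power_mult_distrib summable_on_cmult_right)

definition cinner_ell2 :: "('a, 'b) ell2 \<Rightarrow> ('a, 'b) ell2 \<Rightarrow> complex" where
  "cinner_ell2 f g = (\<Sum>\<^sub>\<infinity>i. cinner (ell2_nth f i) (ell2_nth g i))"

instance
proof
  fix f g h :: "('a, 'b) ell2" and a b :: complex and r :: real
  show "convergent X" if "Cauchy X" for X :: "nat \<Rightarrow> ('a, 'b) ell2"
    using that by (rule ell2_Cauchy_convergent)
  show "a *\<^sub>C (f + g) = a *\<^sub>C f + a *\<^sub>C g" "(a + b) *\<^sub>C f = a *\<^sub>C f + b *\<^sub>C f"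
    "a *\<^sub>C b *\<^sub>C f = (a * b) *\<^sub>C f" "complex_of_real r *\<^sub>C f = r *\<^sub>R f"
    by (transfer; simp add: scaleC_add_right scaleC_add_left scaleC_scaleC scaleC_of_real)+
  show "cinner (f + g) h = cinner f h + cinner g h"
    using infsum_add[OF ell2_cinner_summable[of f h] ell2_cinner_summable[of g h]]
    by (simp add: cinner_ell2_def plus_ell2.rep_eq cinner_add_left)
  show "cinner (a *\<^sub>C f) g = a * cinner f g"
    by (simp add: cinner_ell2_def scaleC_ell2.rep_eq cinner_scaleC_left infsum_cmult_right')
  have "cinner g f = (\<Sum>\<^sub>\<infinity>i. cnj (cinner (ell2_nth f i) (ell2_nth g i)))"
    unfolding cinner_ell2_def by (rule infsum_cong) (rule cinner_commute)
  then show "cinner g f = cnj (cinner f g)"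
    by (simp only: cinner_ell2_def infsum_cnj)
  show "Re (cinner f g) = inner f g"
    unfolding cinner_ell2_def inner_ell2_def infsum_Re[OF ell2_cinner_summable, symmetric] Re_cinner
    by (rule refl)
qed

end

lift_definition ell2_basis :: "'i \<Rightarrow> ('i, complex) ell2" is "\<lambda>i j. if j = i then 1 else 0"
  by (rule finite_nonzero_values_imp_summable_on) simp

lift_definition ell2_tensor :: "('i, complex) ell2 \<Rightarrow> 'h::complex_hilbert \<Rightarrow> ('i, 'h) ell2"
  is "\<lambda>u e i. u i *\<^sub>C e"
  by (simp add: norm_scaleC power_mult_distrib summable_on_cmult_left)

text \<open>\<open>ell2_on F D\<close> is the tensor product of the scalar space over the index set \<open>F\<close> with the closed
  subspace \<open>D\<close>, inside the full space over the index type; \<open>ell2_on F UNIV\<close> with complex values is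
  the scalar space over \<open>F\<close> itself.\<close>

definition ell2_on :: "'i set \<Rightarrow> 'h::complex_hilbert set \<Rightarrow> ('i, 'h) ell2 set" where
  "ell2_on F D = {f. (\<forall>i\<in>F. ell2_nth f i \<in> D) \<and> (\<forall>i. i \<notin> F \<longrightarrow> ell2_nth f i = 0)}"


section \<open>Bounded operators\<close>

text \<open>Library operators are real-linear; complex linearity is required explicitly. For closed subspaces
  \<open>M\<close>, \<open>N\<close>, an operator from \<open>M\<close> to \<open>N\<close> is represented by its extension by zero to the orthogonal
  complement of \<open>M\<close>. This preserves norms, adjoints, products and the strong, weak and weak-*
  topologies; the identity of \<open>M\<close> becomes the orthogonal projection onto \<open>M\<close>.\<close>

definition clinear_op :: "('a::complex_hilbert \<Rightarrow>\<^sub>L 'b::complex_hilbert) \<Rightarrow> bool" where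
  "clinear_op A \<longleftrightarrow> (\<forall>c x. A (c *\<^sub>C x) = c *\<^sub>C A x)"

definition bops :: "'a::complex_hilbert set \<Rightarrow> 'b::complex_hilbert set \<Rightarrow> ('a \<Rightarrow>\<^sub>L 'b) set" where
  "bops M N = {A. clinear_op A \<and> (\<forall>x. A x \<in> N) \<and> (\<forall>x. (\<forall>m\<in>M. cinner x m = 0) \<longrightarrow> A x = 0)}"

definition subspace_id :: "'a::complex_hilbert set \<Rightarrow> 'a \<Rightarrow>\<^sub>L 'a" where
  "subspace_id M = (THE P. P \<in> bops M M \<and> (\<forall>x\<in>M. P x = x))"

definition scale_op :: "complex \<Rightarrow> ('a::complex_hilbert \<Rightarrow>\<^sub>L 'b::complex_hilbert) \<Rightarrow> 'a \<Rightarrow>\<^sub>L 'b" where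
  "scale_op c A = Blinfun (\<lambda>x. c *\<^sub>C A x)"

definition cadj :: "('a::complex_hilbert \<Rightarrow>\<^sub>L 'b::complex_hilbert) \<Rightarrow> 'b \<Rightarrow>\<^sub>L 'a" where
  "cadj A = (THE B :: 'b \<Rightarrow>\<^sub>L 'a. \<forall>x y. cinner (A x) y = cinner x (B y))"

definition nonneg_op :: "('a::complex_hilbert \<Rightarrow>\<^sub>L 'a) \<Rightarrow> bool" where
  "nonneg_op A \<longleftrightarrow> (\<forall>x. cinner (A x) x \<in> \<real>\<^sub>\<ge>\<^sub>0)"

definition op_sqrt :: "('a::complex_hilbert \<Rightarrow>\<^sub>L 'a) \<Rightarrow> 'a \<Rightarrow>\<^sub>L 'a" where
  "op_sqrt P = (THE R. clinear_op R \<and> nonneg_op R \<and> R o\<^sub>L R = P)"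

text \<open>The operator \<open>A \<otimes> I\<close> on \<open>ell2_on F D\<close>, where \<open>A\<close> acts on the scalar space over \<open>F\<close> and \<open>I\<close> is the
  identity of \<open>D\<close>.\<close>

definition tensor_id ::
  "'i set \<Rightarrow> 'h::complex_hilbert set \<Rightarrow> (('i, complex) ell2 \<Rightarrow>\<^sub>L ('i, complex) ell2)
    \<Rightarrow> ('i, 'h) ell2 \<Rightarrow>\<^sub>L ('i, 'h) ell2" where
  "tensor_id F D A = (THE X. X \<in> bops (ell2_on F D) (ell2_on F D) \<and>
     (\<forall>u\<in>ell2_on F UNIV. \<forall>e\<in>D. X (ell2_tensor u e) = ell2_tensor (A u) e))"

text \<open>The strong operator topology is \<^const>\<open>strong_operator_topology\<close> of the library. The weak-*
  topology is the one induced by the functionals \<open>A \<mapsto> tr (A K)\<close>, \<open>K\<close> trace class; writing \<open>K\<close> as a sum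
  of rank-one operators \<open>\<langle>\<cdot>, y m\<rangle> x m\<close> with square-summable \<open>x\<close> and \<open>y\<close> gives the series below.\<close>

definition weak_operator_topology ::
  "('a::complex_hilbert \<Rightarrow>\<^sub>L 'b::complex_hilbert) topology" where
  "weak_operator_topology =
     pullback_topology UNIV (\<lambda>A (x, y). cinner (blinfun_apply A x) y) euclidean"

definition weak_star_topology ::
  "('a::complex_hilbert \<Rightarrow>\<^sub>L 'b::complex_hilbert) topology" where
  "weak_star_topology =
     (let I = {(x :: nat \<Rightarrow> 'a, y :: nat \<Rightarrow> 'b).
                 summable (\<lambda>m. (norm (x m))\<^sup>2) \<and> summable (\<lambda>m. (norm (y m))\<^sup>2)}
      in pullback_topology UNIV
           (\<lambda>A. \<lambda>(x, y)\<in>I. \<Sum>m. cinner (blinfun_apply A (x m)) (y m))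
           (product_topology (\<lambda>_. euclidean) I))"

definition continuous_on_bounded_sets ::
  "'a::metric_space set \<Rightarrow> 'a topology \<Rightarrow> 'b topology \<Rightarrow> ('a \<Rightarrow> 'b) \<Rightarrow> bool" where
  "continuous_on_bounded_sets S X Y f \<longleftrightarrow>
     (\<forall>B\<subseteq>S. bounded B \<longrightarrow> continuous_map (subtopology X B) Y f)"

text \<open>Norm of the operator matrix \<open>[A i j]\<close>, \<open>i, j < m\<close>, acting on the \<open>m\<close>-fold direct sum.\<close>

definition op_matrix_norm ::
  "nat \<Rightarrow> (nat \<Rightarrow> nat \<Rightarrow> ('a::complex_hilbert \<Rightarrow>\<^sub>L 'b::complex_hilbert)) \<Rightarrow> real" where
  "op_matrix_norm m A =
     (SUP x\<in>{x :: nat \<Rightarrow> 'a. (\<Sum>j<m. (norm (x j))\<^sup>2) \<le> 1}.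
        sqrt (\<Sum>i<m. (norm (\<Sum>j<m. A i j (x j)))\<^sup>2))"

definition completely_contractive_on ::
  "('a::complex_hilbert \<Rightarrow>\<^sub>L 'a) set
    \<Rightarrow> (('a \<Rightarrow>\<^sub>L 'a) \<Rightarrow> ('b::complex_hilbert \<Rightarrow>\<^sub>L 'b)) \<Rightarrow> bool" where
  "completely_contractive_on S \<Psi> \<longleftrightarrow>
     (\<forall>m A. (\<forall>i<m. \<forall>j<m. A i j \<in> S) \<longrightarrow>
        op_matrix_norm m (\<lambda>i j. \<Psi> (A i j)) \<le> op_matrix_norm m A)"


section \<open>Words and tuples of operators\<close>

text \<open>All indices start at 0: \<open>i < k\<close> and \<open>s < n i\<close> stand for \<open>1 \<le> i \<le> k\<close> and \<open>1 \<le> s \<le> n i\<close>. A word over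
  the \<open>i\<close>-th alphabet is a list of letters \<open>< n i\<close>; \<open>multiwords k n\<close> is the product of the \<open>k\<close> free
  semigroups, normalised to empty words from coordinate \<open>k\<close> on.\<close>

type_synonym multiword = "nat \<Rightarrow> nat list"
type_synonym 'h op_tuple = "nat \<Rightarrow> nat \<Rightarrow> ('h \<Rightarrow>\<^sub>L 'h)"

definition multiwords :: "nat \<Rightarrow> (nat \<Rightarrow> nat) \<Rightarrow> multiword set" where
  "multiwords k n = {\<beta>. (\<forall>i<k. set (\<beta> i) \<subseteq> {..<n i}) \<and> (\<forall>i\<ge>k. \<beta> i = [])}"

definition multilength :: "nat \<Rightarrow> multiword \<Rightarrow> nat" where
  "multilength k \<beta> = (\<Sum>i<k. length (\<beta> i))"

definition word_op :: "(nat \<Rightarrow> ('h::complex_hilbert \<Rightarrow>\<^sub>L 'h)) \<Rightarrow> nat list \<Rightarrow> 'h \<Rightarrow>\<^sub>L 'h" where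
  "word_op X \<alpha> = foldr (\<lambda>s Y. X s o\<^sub>L Y) \<alpha> id_blinfun"

definition multiword_op :: "nat \<Rightarrow> 'h::complex_hilbert op_tuple \<Rightarrow> multiword \<Rightarrow> 'h \<Rightarrow>\<^sub>L 'h" where
  "multiword_op k X \<beta> = foldr (\<lambda>i Y. word_op (X i) (\<beta> i) o\<^sub>L Y) [0..<k] id_blinfun"

definition dilate :: "real \<Rightarrow> 'h::complex_hilbert op_tuple \<Rightarrow> 'h op_tuple" where
  "dilate r T = (\<lambda>i s. r *\<^sub>R T i s)"

definition cp_map :: "nat \<Rightarrow> (nat \<Rightarrow> ('h::complex_hilbert \<Rightarrow>\<^sub>L 'h)) \<Rightarrow> ('h \<Rightarrow>\<^sub>L 'h) \<Rightarrow> 'h \<Rightarrow>\<^sub>L 'h" where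
  "cp_map m X Y = (\<Sum>s<m. X s o\<^sub>L Y o\<^sub>L cadj (X s))"

text \<open>\<open>defect_pow\<close> is \<open>(id - \<Phi>\<^sub>k\<^bsup>p k\<^esup>) \<circ> \<dots> \<circ> (id - \<Phi>\<^sub>1\<^bsup>p 1\<^esup>)\<close> at the identity; note that
  \<^const>\<open>fold\<close> applies coordinate 0 first.\<close>

definition defect_pow ::
  "nat \<Rightarrow> (nat \<Rightarrow> nat) \<Rightarrow> (nat \<Rightarrow> nat) \<Rightarrow> 'h::complex_hilbert op_tuple \<Rightarrow> 'h \<Rightarrow>\<^sub>L 'h" where
  "defect_pow k n p T = fold (\<lambda>i Y. Y - (cp_map (n i) (T i) ^^ p i) Y) [0..<k] id_blinfun"

definition defect :: "nat \<Rightarrow> (nat \<Rightarrow> nat) \<Rightarrow> 'h::complex_hilbert op_tuple \<Rightarrow> 'h \<Rightarrow>\<^sub>L 'h" where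
  "defect k n T = fold (\<lambda>i Y. Y - cp_map (n i) (T i) Y) [0..<k] id_blinfun"

definition defect_space :: "nat \<Rightarrow> (nat \<Rightarrow> nat) \<Rightarrow> 'h::complex_hilbert op_tuple \<Rightarrow> 'h set" where
  "defect_space k n T = closure (range (defect k n T))"


section \<open>The regular polyball, its universal model and the Hardy algebra\<close>

definition twist_matrices ::
  "nat \<Rightarrow> (nat \<Rightarrow> nat) \<Rightarrow> (nat \<Rightarrow> nat \<Rightarrow> nat \<Rightarrow> nat \<Rightarrow> complex) \<Rightarrow> bool" where
  "twist_matrices k n lam \<longleftrightarrow>
     (\<forall>i<k. \<forall>j<k. i \<noteq> j \<longrightarrow> (\<forall>s<n i. \<forall>t<n j.
        cmod (lam i j s t) = 1 \<and> lam j i t s = cnj (lam i j s t)))"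

definition polyball ::
  "nat \<Rightarrow> (nat \<Rightarrow> nat) \<Rightarrow> (nat \<Rightarrow> nat \<Rightarrow> nat \<Rightarrow> nat \<Rightarrow> complex) \<Rightarrow> 'h::complex_hilbert op_tuple set" where
  "polyball k n lam = {T.
     (\<forall>i<k. \<forall>s<n i. clinear_op (T i s)) \<and>
     (\<forall>i<k. nonneg_op (id_blinfun - (\<Sum>s<n i. T i s o\<^sub>L cadj (T i s)))) \<and>
     (\<forall>i<k. \<forall>j<k. i \<noteq> j \<longrightarrow> (\<forall>s<n i. \<forall>t<n j.
        T i s o\<^sub>L T j t = scale_op (lam i j s t) (T j t o\<^sub>L T i s))) \<and>
     (\<forall>r\<in>{0..<1}. nonneg_op (defect k n (dilate r T)))}"

definition completely_non_coisometric ::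
  "nat \<Rightarrow> (nat \<Rightarrow> nat) \<Rightarrow> 'h::complex_hilbert op_tuple \<Rightarrow> bool" where
  "completely_non_coisometric k n T \<longleftrightarrow>
     \<not> (\<exists>h. h \<noteq> 0 \<and> (\<forall>p. cinner (defect_pow k n p T h) h = 0))"

definition model_space :: "nat \<Rightarrow> (nat \<Rightarrow> nat) \<Rightarrow> (multiword, complex) ell2 set" where
  "model_space k n = ell2_on (multiwords k n) UNIV"

definition universal_model ::
  "nat \<Rightarrow> (nat \<Rightarrow> nat) \<Rightarrow> (nat \<Rightarrow> nat \<Rightarrow> nat \<Rightarrow> nat \<Rightarrow> complex) \<Rightarrow> (multiword, complex) ell2 op_tuple" where
  "universal_model k n lam i s = (THE S. S \<in> bops (model_space k n) (model_space k n) \<and>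
     (\<forall>\<alpha>\<in>multiwords k n. S (ell2_basis \<alpha>) =
        (\<Prod>j<i. prod_list (map (lam i j s) (\<alpha> j))) *\<^sub>C ell2_basis (\<alpha>(i := s # \<alpha> i))))"

text \<open>\<open>A\<close> is the bounded extension of the formal series with square-summable coefficients \<open>c\<close>. It
  suffices to fix \<open>A\<close> on the basis vectors; such a bounded \<open>A\<close> exists exactly if the series is bounded
  on their span. Only the values of \<open>c\<close> on \<^term>\<open>multiwords k n\<close> matter.\<close>

definition fourier_rep ::
  "nat \<Rightarrow> (nat \<Rightarrow> nat) \<Rightarrow> (nat \<Rightarrow> nat \<Rightarrow> nat \<Rightarrow> nat \<Rightarrow> complex) \<Rightarrow> (multiword \<Rightarrow> complex)
    \<Rightarrow> ((multiword, complex) ell2 \<Rightarrow>\<^sub>L (multiword, complex) ell2) \<Rightarrow> bool" where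
  "fourier_rep k n lam c A \<longleftrightarrow>
     (\<lambda>\<beta>. (cmod (c \<beta>))\<^sup>2) summable_on multiwords k n \<and>
     A \<in> bops (model_space k n) (model_space k n) \<and>
     (\<forall>\<gamma>\<in>multiwords k n.
        ((\<lambda>\<beta>. c \<beta> *\<^sub>C multiword_op k (universal_model k n lam) \<beta> (ell2_basis \<gamma>))
           has_sum A (ell2_basis \<gamma>)) (multiwords k n))"

definition hardy_algebra ::
  "nat \<Rightarrow> (nat \<Rightarrow> nat) \<Rightarrow> (nat \<Rightarrow> nat \<Rightarrow> nat \<Rightarrow> nat \<Rightarrow> complex)
    \<Rightarrow> ((multiword, complex) ell2 \<Rightarrow>\<^sub>L (multiword, complex) ell2) set" where
  "hardy_algebra k n lam = {A. \<exists>c. fourier_rep k n lam c A}"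

definition series_at ::
  "nat \<Rightarrow> (nat \<Rightarrow> nat) \<Rightarrow> (multiword \<Rightarrow> complex) \<Rightarrow> real \<Rightarrow> 'h::complex_hilbert op_tuple \<Rightarrow> 'h \<Rightarrow>\<^sub>L 'h" where
  "series_at k n c r T =
     (\<Sum>p. \<Sum>\<beta> | \<beta> \<in> multiwords k n \<and> multilength k \<beta> = p.
        scale_op (of_real (r ^ p) * c \<beta>) (multiword_op k T \<beta>))"

definition berezin_kernel ::
  "nat \<Rightarrow> (nat \<Rightarrow> nat) \<Rightarrow> 'h::complex_hilbert op_tuple \<Rightarrow> 'h \<Rightarrow>\<^sub>L (multiword, 'h) ell2" where
  "berezin_kernel k n T = Blinfun (\<lambda>h. \<Sum>\<^sub>\<infinity>\<beta>\<in>multiwords k n.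
     ell2_tensor (ell2_basis \<beta>)
       (op_sqrt (defect k n T) (fold (\<lambda>i g. cadj (word_op (T i) (\<beta> i)) g) [0..<k] h)))"

definition berezin_transform ::
  "nat \<Rightarrow> (nat \<Rightarrow> nat) \<Rightarrow> 'h::complex_hilbert op_tuple
    \<Rightarrow> ((multiword, complex) ell2 \<Rightarrow>\<^sub>L (multiword, complex) ell2) \<Rightarrow> 'h \<Rightarrow>\<^sub>L 'h" where
  "berezin_transform k n T A =
     cadj (berezin_kernel k n T) o\<^sub>L tensor_id (multiwords k n) (defect_space k n T) A
       o\<^sub>L berezin_kernel k n T"

definition hardy_calculus ::
  "nat \<Rightarrow> (nat \<Rightarrow> nat) \<Rightarrow> 'h::complex_hilbert op_tuple
    \<Rightarrow> ((multiword, complex) ell2 \<Rightarrow>\<^sub>L (multiword, complex) ell2) \<Rightarrow> 'h \<Rightarrow>\<^sub>L 'h" where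
  "hardy_calculus k n T A = (THE L.
     limitin strong_operator_topology (\<lambda>r. berezin_transform k n (dilate r T) A) L (at_left 1))"

end

theory Submission
  imports Defs
begin

text \<open>Write \<open>K\<close> for the Berezin kernel of \<open>T\<close> and \<open>K\<^sub>r\<close> for that of \<open>rT\<close>. Its adjoint intertwines the model with the
  tuple: \<open>K\<^sup>* (\<chi>\<^sub>\<gamma> \<otimes> e) = T\<^sub>\<gamma> \<Delta>\<^bsup>1/2\<^esup> e\<close>, and since \<open>S\<^sub>\<beta> \<chi>\<^sub>\<gamma>\<close> and \<open>T\<^sub>\<beta> T\<^sub>\<gamma>\<close> differ from \<open>\<chi>\<^sub>\<beta>\<^sub>\<gamma>\<close> and \<open>T\<^sub>\<beta>\<^sub>\<gamma>\<close> by the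
  same scalar, \<open>\<phi>(rT) K\<^sub>r\<^sup>* = K\<^sub>r\<^sup>* (A \<otimes> I)\<close>. For \<open>r < 1\<close> the kernel \<open>K\<^sub>r\<close> is an isometry, so that
  \<open>K\<^sub>r\<^sup>* (A \<otimes> I) K\<^sub>r = \<phi>(rT)\<close>, bounded in norm by \<open>A\<close>. On the vectors \<open>K\<^sup>* (\<chi>\<^sub>\<gamma> \<otimes> e)\<close> the operators \<open>\<phi>(rT)\<close>
  converge to \<open>K\<^sup>* (A \<chi>\<^sub>\<gamma> \<otimes> e)\<close>, and these vectors span a dense subspace exactly because \<open>T\<close> is completely
  non-coisometric. Hence the limit \<open>\<Psi>\<close> exists and is characterised by \<open>\<Psi>(A) K\<^sup>* = K\<^sup>* (A \<otimes> I)\<close>, from which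
  the algebraic and the continuity properties follow by density.\<close>


section \<open>Hilbert space preliminaries\<close>

text \<open>The definitions rest on \<open>THE\<close>, \<open>Blinfun\<close> and infinite sums, so
  adjoints, square roots and A tensor I must first be shown to exist and to be unique. The bound for
  A tensor I is proved for operator matrices from the start; complete contractivity then needs only
  limits. One identity of quadratic forms, \<open>op_form_defect_pow_eq_sum\<close>, carries both
  uses of the defects: the form of the defect with powers p at h is the sum, over a finite box of
  words beta, of the squared norms of the coordinates of \<open>K\<close> h. For rT the powers of
  Phi_i decay geometrically, the boxes exhaust all words, and the kernel is an isometry; for T only
  a contraction survives, so the limit has to be found on the range of \<open>cadj K\<close>. A
  vector orthogonal to that range makes every box sum vanish, which is what complete
  non-coisometricity excludes. Convergence on that range comes from moving the factor r^|beta| of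
  the series into the model: there phi(rT) becomes A followed by the diagonal operator D_r with
  entries r^|delta|, up to a scalar, and D_r tends strongly to the identity.\<close>

lemma scaleC_zero_left [simp]: "0 *\<^sub>C (x::'a::complex_hilbert) = 0"
  using scaleC_of_real[of 0 x] by simp

lemma scaleC_zero_right [simp]: "a *\<^sub>C (0::'a::complex_hilbert) = 0"
  using scaleC_add_right[of a 0 "0::'a"] by simp

lemma scaleC_one [simp]: "1 *\<^sub>C (x::'a::complex_hilbert) = x"
  using scaleC_of_real[of 1 x] by simp

lemma scaleC_minus_right: "a *\<^sub>C (- x) = - (a *\<^sub>C (x::'a::complex_hilbert))"
  using scaleC_add_right[of a x "- x"] by (simp add: eq_neg_iff_add_eq_0 add.commute)

lemma scaleC_diff_right: "a *\<^sub>C (x - y) = a *\<^sub>C x - a *\<^sub>C (y::'a::complex_hilbert)"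
  using scaleC_add_right[of a x "- y"] by (simp add: scaleC_minus_right)

lemma scaleC_scaleR_commute: "a *\<^sub>C (r *\<^sub>R x) = r *\<^sub>R (a *\<^sub>C (x::'a::complex_hilbert))"
  by (simp flip: scaleC_of_real add: scaleC_scaleC mult.commute)

lemma bounded_linear_scaleC_right: "bounded_linear (\<lambda>x. a *\<^sub>C (x::'a::complex_hilbert))"
  by (rule bounded_linear_intro[where K = "cmod a"])
    (auto simp: scaleC_add_right scaleC_scaleR_commute norm_scaleC mult.commute)

lemma bounded_bilinear_scaleC:
  "bounded_bilinear (\<lambda>a x. a *\<^sub>C (x::'a::complex_hilbert))"
proof (unfold_locales)
  fix a b :: complex and x y :: 'a and r :: real
  show "(a + b) *\<^sub>C x = a *\<^sub>C x + b *\<^sub>C x" "a *\<^sub>C (x + y) = a *\<^sub>C x + a *\<^sub>C y"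
    by (rule scaleC_add_left scaleC_add_right)+
  show "(r *\<^sub>R a) *\<^sub>C x = r *\<^sub>R a *\<^sub>C x"
    by (metis scaleC_of_real scaleC_scaleC scaleR_conv_of_real)
  show "a *\<^sub>C r *\<^sub>R x = r *\<^sub>R a *\<^sub>C x" by (rule scaleC_scaleR_commute)
  show "\<exists>K. \<forall>a (x::'a). norm (a *\<^sub>C x) \<le> norm a * norm x * K"
    by (rule exI[of _ 1]) (simp add: norm_scaleC)
qed

lemmas bounded_linear_scaleC_left = bounded_bilinear.bounded_linear_left[OF bounded_bilinear_scaleC]

lemma cinner_add_right: "cinner x (y + z) = cinner x y + cinner x (z::'a::complex_hilbert)"
  by (metis cinner_add_left cinner_commute complex_cnj_add)

lemma cinner_scaleC_right: "cinner x (a *\<^sub>C y) = cnj a * cinner x (y::'a::complex_hilbert)"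
  by (metis cinner_commute cinner_scaleC_left complex_cnj_mult)

lemma cinner_zero_left [simp]: "cinner 0 (y::'a::complex_hilbert) = 0"
  using cinner_scaleC_left[of 0 0 y] by simp

lemma cinner_zero_right [simp]: "cinner (y::'a::complex_hilbert) 0 = 0"
  using cinner_scaleC_right[of y 0 0] by simp

lemma cinner_minus_left: "cinner (- x) y = - cinner x (y::'a::complex_hilbert)"
  using cinner_add_left[of x "- x" y] by (simp add: eq_neg_iff_add_eq_0 add.commute)

lemma cinner_minus_right: "cinner x (- y) = - cinner x (y::'a::complex_hilbert)"
  using cinner_add_right[of x y "- y"] by (simp add: eq_neg_iff_add_eq_0 add.commute)

lemma cinner_diff_left: "cinner (x - y) z = cinner x z - cinner y (z::'a::complex_hilbert)"
  using cinner_add_left[of x "- y" z] by (simp add: cinner_minus_left)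

lemma cinner_diff_right: "cinner z (x - y) = cinner z x - cinner z (y::'a::complex_hilbert)"
  using cinner_add_right[of z x "- y"] by (simp add: cinner_minus_right)

lemma cinner_scaleR_left: "cinner (r *\<^sub>R x) y = of_real r * cinner x (y::'a::complex_hilbert)"
  by (simp flip: scaleC_of_real add: cinner_scaleC_left)

lemma cinner_scaleR_right: "cinner x (r *\<^sub>R y) = of_real r * cinner x (y::'a::complex_hilbert)"
  by (simp flip: scaleC_of_real add: cinner_scaleC_right)

lemma bounded_bilinear_cinner:
  "bounded_bilinear (cinner :: 'a::complex_hilbert \<Rightarrow> 'a \<Rightarrow> complex)"
proof (unfold_locales)
  show "\<exists>K. \<forall>(x::'a) y. norm (cinner x y) \<le> norm x * norm y * K"
    by (rule exI[of _ 2]) (use norm_cinner_le in \<open>auto simp: mult.commute\<close>)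
qed (simp_all add: cinner_add_left cinner_add_right cinner_scaleR_left cinner_scaleR_right
    scaleR_conv_of_real)

lemmas bounded_linear_cinner_left = bounded_bilinear.bounded_linear_left[OF bounded_bilinear_cinner]
lemmas bounded_linear_cinner_right = bounded_bilinear.bounded_linear_right[OF bounded_bilinear_cinner]
lemmas cinner_sum_left = bounded_linear.linear[OF bounded_linear_cinner_left, THEN linear_sum]
lemmas cinner_sum_right = bounded_linear.linear[OF bounded_linear_cinner_right, THEN linear_sum]
lemmas tendsto_cinner = bounded_bilinear.tendsto[OF bounded_bilinear_cinner]
lemmas tendsto_scaleC = bounded_bilinear.tendsto[OF bounded_bilinear_scaleC]

text \<open>The imaginary part is a real inner product with the first argument rotated by -i. This
  transfers the real Riesz theorem below to \<open>cinner\<close>.\<close>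

lemma cinner_eq_iff: "cinner x y = Complex (inner x y) (inner (- \<i> *\<^sub>C x) (y::'a::complex_hilbert))"
proof (rule complex_eqI)
  show "Im (cinner x y) = Im (Complex (inner x y) (inner (- \<i> *\<^sub>C x) y))"
    by (simp flip: Re_cinner add: cinner_scaleC_left)
qed (simp add: Re_cinner)

lemma cinner_eqI_left:
  assumes "\<And>z. cinner x z = cinner y (z::'a::complex_hilbert)"
  shows "x = y"
proof -
  have "cinner (x - y) (x - y) = 0" using assms[of "x - y"] by (simp add: cinner_diff_left)
  then show ?thesis by (simp add: cinner_self)
qed

lemma norm_eq_cinner: "(norm x)\<^sup>2 = Re (cinner x (x::'a::complex_hilbert))"
  by (simp add: cinner_self)

lemma norm_add_orthogonal:
  assumes "cinner x (y::'a::complex_hilbert) = 0"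
  shows "(norm (x + y))\<^sup>2 = (norm x)\<^sup>2 + (norm y)\<^sup>2"
proof -
  have "cinner y x = 0" using assms cinner_commute[of x y] by simp
  then show ?thesis using assms by (simp add: norm_eq_cinner cinner_add_left cinner_add_right)
qed


subsection \<open>Riesz representation, projections and adjoints\<close>

text \<open>The representing vector minimises \<open>\<lambda>m. \<parallel>m\<parallel>\<^sup>2 - 2 f m\<close> over the subspace. With \<open>f\<close> the inner product
  with a vector it is the orthogonal projection of that vector.\<close>

lemma Riesz_on_closed_subspace:
  fixes f :: "'a::{real_inner, complete_space} \<Rightarrow> real"
  assumes M: "subspace M" "closed M" and f: "bounded_linear f"
  shows "\<exists>z\<in>M. \<forall>m\<in>M. inner z m = f m"
proof -
  interpret f: bounded_linear f by fact
  define J where "J x = (norm x)\<^sup>2 - 2 * f x" for x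
  obtain K where K: "\<And>x. norm (f x) \<le> norm x * K" using f.bounded by blast
  have "J x \<ge> - (K\<^sup>2)" for x
  proof -
    have "f x \<le> norm x * K" using K[of x] by simp
    then have "2 * f x \<le> (norm x)\<^sup>2 + K\<^sup>2"
      using sum_squares_bound[of "norm x" K] by (simp add: power2_eq_square)
    then show ?thesis by (simp add: J_def)
  qed
  then have bdd: "bdd_below (J ` M)" by (auto intro!: bdd_belowI2)
  have ne: "J ` M \<noteq> {}" using M(1) subspace_0 by blast
  define d where "d = Inf (J ` M)"
  have d: "d \<le> J x" if "x \<in> M" for x
    unfolding d_def using bdd that by (intro cInf_lower) auto
  have "\<exists>z\<in>M. J z < d + 1 / real (Suc n)" for n
    using cInf_lessD[OF ne, of "d + 1 / real (Suc n)"] by (auto simp: d_def)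
  then obtain z where zM: "\<And>n. z n \<in> M" and z: "\<And>n. J (z n) < d + 1 / real (Suc n)" by metis
  have diff: "(norm (z n - z m))\<^sup>2 \<le> 2 / real (Suc n) + 2 / real (Suc m)" for n m
  proof -
    \<comment> \<open>Parallelogram law at the midpoint: the linear terms cancel, and J at the
      midpoint is at least the infimum, so near-minimisers lie close together.\<close>
    define w where "w = (1/2) *\<^sub>R (z n + z m)"
    have "w \<in> M" unfolding w_def using M(1) zM by (intro subspace_mul subspace_add)
    then have "d \<le> J w" by (rule d)
    moreover have "(norm (z n - z m))\<^sup>2 = 2 * J (z n) + 2 * J (z m) - 4 * J w"
      by (simp add: J_def w_def f.scaleR f.add f.diff power2_norm_eq_inner inner_add_left inner_add_right
          inner_diff_left inner_diff_right inner_commute algebra_simps)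
    ultimately show ?thesis using z[of n] z[of m] by simp
  qed
  have "Cauchy z"
  proof (rule metric_CauchyI)
    fix e :: real assume e: "e > 0"
    then obtain N where N: "1 / real (Suc N) < e\<^sup>2 / 4"
      using nat_approx_posE[of "e\<^sup>2 / 4"] by auto
    have "dist (z m) (z n) < e" if "m \<ge> N" "n \<ge> N" for m n
    proof -
      have "1 / real (Suc m) \<le> 1 / real (Suc N)" "1 / real (Suc n) \<le> 1 / real (Suc N)"
        using that by (simp_all add: frac_le)
      then have "(norm (z m - z n))\<^sup>2 < e\<^sup>2" using diff[of m n] N by simp
      then show ?thesis using e by (simp add: dist_norm power_less_imp_less_base)
    qed
    then show "\<exists>N. \<forall>m\<ge>N. \<forall>n\<ge>N. dist (z m) (z n) < e" by blast
  qed
  then obtain y where y: "z \<longlonglongrightarrow> y" using Cauchy_convergent convergent_def by blast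
  have yM: "y \<in> M" using M(2) zM y closed_sequentially by blast
  have "(\<lambda>n. J (z n)) \<longlonglongrightarrow> J y"
    unfolding J_def by (intro tendsto_intros f.tendsto y)
  moreover have "(\<lambda>n. d + 1 / real (Suc n)) \<longlonglongrightarrow> d + 0"
    by (intro tendsto_intros LIMSEQ_Suc lim_1_over_n)
  ultimately have "J y \<le> d"
    using z by (intro LIMSEQ_le[of "\<lambda>n. J (z n)" "J y" "\<lambda>n. d + 1 / real (Suc n)" d]) (auto simp: less_imp_le)
  have "inner y m = f m" if m: "m \<in> M" for m
  proof (rule ccontr)
    assume "inner y m \<noteq> f m"
    define b where "b = inner y m - f m"
    have b: "b \<noteq> 0" using \<open>inner y m \<noteq> f m\<close> by (simp add: b_def)
    then have m0: "m \<noteq> 0" unfolding b_def by (auto simp: f.zero)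
    \<comment> \<open>The minimiser of 2 t b + t^2 (norm m)^2, the change of J along m.\<close>
    define t where "t = - b / (norm m)\<^sup>2"
    have "y + t *\<^sub>R m \<in> M" using M(1) yM m by (intro subspace_add subspace_mul)
    then have "J y \<le> J (y + t *\<^sub>R m)" using d \<open>J y \<le> d\<close> by fastforce
    also have "J (y + t *\<^sub>R m) = J y + 2 * t * b + t\<^sup>2 * (norm m)\<^sup>2"
      unfolding J_def b_def f.add f.scaleR power2_norm_eq_inner inner_add_left inner_add_right
        inner_scaleR_left inner_scaleR_right inner_commute[of m y]
      by (simp add: algebra_simps power2_eq_square)
    also have "\<dots> = J y - b\<^sup>2 / (norm m)\<^sup>2"
      using m0 by (simp add: t_def field_simps power2_eq_square)
    also have "\<dots> < J y" using b m0 by simp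
    finally show False by simp
  qed
  then show ?thesis using yM by blast
qed

text \<open>Riesz on the whole space for each y controls real parts only. Complex linearity of A
  allows -i x in place of x, which settles the imaginary parts.\<close>

lemma cadj_exists:
  fixes A :: "'a::complex_hilbert \<Rightarrow>\<^sub>L 'b::complex_hilbert"
  assumes A: "clinear_op A"
  shows "\<exists>B. clinear_op B \<and> (\<forall>x y. cinner (A x) y = cinner x (B y))"
proof -
  have "\<exists>z. \<forall>x. cinner (A x) y = cinner x z" for y
  proof -
    have "bounded_linear (\<lambda>x. inner (A x) y)"
      by (intro bounded_linear_inner_left_comp blinfun.bounded_linear_right)
    then obtain z where z: "\<And>x. inner z x = inner (A x) y"
      using Riesz_on_closed_subspace[of UNIV "\<lambda>x. inner (A x) y"] by auto
    have "cinner (A x) y = cinner x z" for x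
      using A by (simp add: cinner_eq_iff inner_commute[of _ z] z clinear_op_def)
    then show ?thesis by blast
  qed
  then obtain g where g: "\<And>x y. cinner (A x) y = cinner x (g y)" by metis
  have g': "cinner (g y) x = cinner y (A x)" for x y
    using g[of x y] by (metis cinner_commute)
  have scale: "g (c *\<^sub>C y) = c *\<^sub>C g y" for c y
    by (rule cinner_eqI_left) (simp add: g' cinner_scaleC_left)
  have "bounded_linear g"
  proof (rule bounded_linear_intro)
    show "g (x + y) = g x + g y" for x y
      by (rule cinner_eqI_left) (simp add: g' cinner_add_left)
    show "g (r *\<^sub>R y) = r *\<^sub>R g y" for r y
      using scale[of "of_real r" y] by (simp add: scaleC_of_real)
    show "norm (g y) \<le> norm y * norm A" for y
    proof (cases "g y = 0")
      case False
      have "(norm (g y))\<^sup>2 = inner (A (g y)) y"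
        using g[of "g y" y] by (simp add: norm_eq_cinner flip: Re_cinner)
      also have "\<dots> \<le> norm (A (g y)) * norm y" by (rule norm_cauchy_schwarz)
      also have "\<dots> \<le> norm A * norm (g y) * norm y"
        by (intro mult_right_mono norm_blinfun) simp
      finally show ?thesis using False by (simp add: power2_eq_square mult.assoc mult.left_commute)
          (simp add: mult.commute)
    qed simp
  qed
  then have "blinfun_apply (Blinfun g) = g" by (rule bounded_linear_Blinfun_apply)
  then show ?thesis using g scale by (intro exI[of _ "Blinfun g"]) (simp add: clinear_op_def)
qed

lemma
  fixes A :: "'a::complex_hilbert \<Rightarrow>\<^sub>L 'b::complex_hilbert"
  assumes "clinear_op A"
  shows cinner_cadj_right: "cinner x (cadj A y) = cinner (A x) y"
    and cinner_cadj_left: "cinner (cadj A y) x = cinner y (A x)"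
    and clinear_cadj: "clinear_op (cadj A)"
proof -
  obtain B where B: "clinear_op B" "\<And>x y. cinner (A x) y = cinner x (B y)"
    using cadj_exists[OF assms] by blast
  have "C = B" if "\<forall>x y. cinner (A x) y = cinner x (C y)" for C :: "'b \<Rightarrow>\<^sub>L 'a"
  proof (rule blinfun_eqI, rule cinner_eqI_left)
    show "cinner (C y) z = cinner (B y) z" for y z
      using that B(2)[of z y] by (metis cinner_commute)
  qed
  then have "cadj A = B" unfolding cadj_def using B(2) by (intro the_equality) auto
  then show "cinner x (cadj A y) = cinner (A x) y" "cinner (cadj A y) x = cinner y (A x)"
      "clinear_op (cadj A)"
    using B by (simp_all, metis cinner_commute)
qed

lemma cadj_eqI:
  assumes "clinear_op A" "\<And>x. cinner (blinfun_apply A x) y = cinner x z"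
  shows "cadj A y = z"
  by (rule cinner_eqI_left) (metis assms cinner_cadj_right cinner_commute)

section \<open>Calculus of complex-linear operators and their adjoints\<close>

lemma clinear_opD: "clinear_op A \<Longrightarrow> A (c *\<^sub>C x) = c *\<^sub>C A x"
  by (simp add: clinear_op_def)

lemma clinear_id [simp]: "clinear_op id_blinfun"
  by (simp add: clinear_op_def)

lemma clinear_comp: "clinear_op A \<Longrightarrow> clinear_op B \<Longrightarrow> clinear_op (A o\<^sub>L B)"
  by (simp add: clinear_op_def)

lemma clinear_add: "clinear_op A \<Longrightarrow> clinear_op B \<Longrightarrow> clinear_op (A + B)"
  by (simp add: clinear_op_def blinfun.add_left scaleC_add_right)

lemma clinear_diff: "clinear_op A \<Longrightarrow> clinear_op B \<Longrightarrow> clinear_op (A - B)"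
  by (simp add: clinear_op_def blinfun.diff_left scaleC_diff_right)

lemma clinear_scaleR: "clinear_op A \<Longrightarrow> clinear_op (r *\<^sub>R A)"
  by (simp add: clinear_op_def blinfun.scaleR_left scaleC_scaleR_commute)

lemma clinear_zero [simp]: "clinear_op 0"
  by (simp add: clinear_op_def)

lemma clinear_sum: "(\<And>i. i \<in> I \<Longrightarrow> clinear_op (A i)) \<Longrightarrow> clinear_op (sum A I)"
  by (induction I rule: infinite_finite_induct) (auto intro: clinear_add)

lemma scale_op_apply [simp]: "blinfun_apply (scale_op c A) x = c *\<^sub>C A x"
  unfolding scale_op_def
  by (subst bounded_linear_Blinfun_apply)
    (auto intro: bounded_linear_compose[OF bounded_linear_scaleC_right] blinfun.bounded_linear_right)

lemma clinear_scale_op: "clinear_op A \<Longrightarrow> clinear_op (scale_op c A)"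
  by (simp add: clinear_op_def scaleC_scaleC mult.commute)

lemma cadj_comp_apply:
  "clinear_op A \<Longrightarrow> clinear_op B \<Longrightarrow> cadj (A o\<^sub>L B) x = cadj B (cadj A x)"
  by (rule cadj_eqI) (auto intro: clinear_comp simp: cinner_cadj_right)

lemma cadj_scaleR_apply: "clinear_op A \<Longrightarrow> cadj (r *\<^sub>R A) x = r *\<^sub>R cadj A x"
  by (rule cadj_eqI)
    (auto intro: clinear_scaleR simp: cinner_cadj_right blinfun.scaleR_left cinner_scaleR_left cinner_scaleR_right)

lemma cadj_scale_op_apply: "clinear_op A \<Longrightarrow> cadj (scale_op c A) x = cnj c *\<^sub>C cadj A x"
  by (rule cadj_eqI)
    (auto intro: clinear_scale_op simp: cinner_cadj_right cinner_scaleC_left cinner_scaleC_right)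

lemma cadj_id [simp]: "cadj id_blinfun x = x"
  by (rule cadj_eqI) auto

lemma norm_cadj_le:
  assumes "clinear_op A" "\<And>x. norm (blinfun_apply A x) \<le> C * norm x" "0 \<le> C"
  shows "norm (cadj A y) \<le> C * norm y"
proof (cases "cadj A y = 0")
  case False
  have "(norm (cadj A y))\<^sup>2 = inner (A (cadj A y)) y"
    by (simp add: norm_eq_cinner cinner_cadj_right[OF assms(1)] flip: Re_cinner)
  also have "\<dots> \<le> norm (A (cadj A y)) * norm y" by (rule norm_cauchy_schwarz)
  also have "\<dots> \<le> (C * norm (cadj A y)) * norm y" by (intro mult_right_mono assms(2)) simp
  finally show ?thesis using False by (simp add: power2_eq_square)
qed (use assms in simp)

text \<open>The library notion \<open>subspace\<close> is real. Closure under multiplication by i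
  turns orthogonality for the real inner product into orthogonality for
  \<open>cinner\<close>.\<close>

definition csubspace :: "'a::complex_hilbert set \<Rightarrow> bool" where
  "csubspace M \<longleftrightarrow> 0 \<in> M \<and> (\<forall>x\<in>M. \<forall>y\<in>M. x + y \<in> M) \<and> (\<forall>c. \<forall>x\<in>M. c *\<^sub>C x \<in> M)"

lemma csubspace_imp_subspace: "csubspace M \<Longrightarrow> subspace M"
  unfolding csubspace_def subspace_def by (metis scaleC_of_real)

lemma csubspace_diff: "csubspace M \<Longrightarrow> x \<in> M \<Longrightarrow> y \<in> M \<Longrightarrow> x - y \<in> M"
  using csubspace_imp_subspace subspace_diff by blast

lemma subspace_closure:
  fixes M :: "'a::real_normed_vector set"
  assumes "subspace M" shows "subspace (closure M)"
proof (rule subspaceI)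
  show "0 \<in> closure M" using subspace_0[OF assms] closure_subset by blast
  show "x + y \<in> closure M" if "x \<in> closure M" "y \<in> closure M" for x y
  proof -
    obtain s t where "\<And>n. s n \<in> M" "s \<longlonglongrightarrow> x" "\<And>n. t n \<in> M" "t \<longlonglongrightarrow> y"
      using \<open>x \<in> closure M\<close> \<open>y \<in> closure M\<close> unfolding closure_sequential by blast
    then have "(\<lambda>n. s n + t n) \<longlonglongrightarrow> x + y" "\<forall>n. s n + t n \<in> M"
      using assms by (auto intro: tendsto_add subspace_add)
    then show ?thesis unfolding closure_sequential by (intro exI[of _ "\<lambda>n. s n + t n"]) simp
  qed
  show "c *\<^sub>R x \<in> closure M" if x: "x \<in> closure M" for c x
  proof -
    obtain s where "\<And>n. s n \<in> M" "s \<longlonglongrightarrow> x" using x unfolding closure_sequential by blast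
    then have "(\<lambda>n. c *\<^sub>R s n) \<longlonglongrightarrow> c *\<^sub>R x" "\<forall>n. c *\<^sub>R s n \<in> M"
      using assms by (auto intro: tendsto_intros subspace_mul)
    then show ?thesis unfolding closure_sequential by (intro exI[of _ "\<lambda>n. c *\<^sub>R s n"]) simp
  qed
qed

lemma csubspace_closure:
  assumes "csubspace M" shows "csubspace (closure M)"
proof -
  have "subspace (closure M)" by (rule subspace_closure[OF csubspace_imp_subspace[OF assms]])
  moreover have "c *\<^sub>C x \<in> closure M" if x: "x \<in> closure M" for c x
  proof -
    obtain s where s: "\<And>n. s n \<in> M" "s \<longlonglongrightarrow> x" using x closure_sequential by blast
    then have "(\<lambda>n. c *\<^sub>C s n) \<longlonglongrightarrow> c *\<^sub>C x"
      by (intro bounded_linear.tendsto[OF bounded_linear_scaleC_right])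
    moreover have "c *\<^sub>C s n \<in> M" for n using assms s(1) by (simp add: csubspace_def)
    ultimately show ?thesis unfolding closure_sequential by (intro exI[of _ "\<lambda>n. c *\<^sub>C s n"]) simp
  qed
  ultimately show ?thesis by (simp add: csubspace_def subspace_def)
qed

lemma orthogonal_projection_exists:
  assumes M: "csubspace M" "closed M"
  shows "\<exists>P. clinear_op P \<and> (\<forall>x. P x \<in> M) \<and> (\<forall>x. \<forall>m\<in>M. cinner (x - P x) m = 0)"
proof -
  have "\<exists>z\<in>M. \<forall>m\<in>M. cinner (x - z) m = 0" for x :: 'a
  proof -
    obtain z where z: "z \<in> M" "\<And>m. m \<in> M \<Longrightarrow> inner z m = inner x m"
      using Riesz_on_closed_subspace[OF csubspace_imp_subspace[OF M(1)] M(2) bounded_linear_inner_right[of x]]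
      by blast
    have "cinner (x - z) m = 0" if "m \<in> M" for m
    proof -
      have "Re (cinner (x - z) m) = 0"
        using z(2)[OF that] by (simp add: Re_cinner inner_diff_left)
      moreover have "\<i> *\<^sub>C m \<in> M" using M(1) that by (simp add: csubspace_def)
      then have "Re (cinner (x - z) (\<i> *\<^sub>C m)) = 0"
        using z(2) by (simp add: Re_cinner inner_diff_left)
      ultimately show ?thesis by (simp add: cinner_scaleC_right complex_eq_iff)
    qed
    then show ?thesis using z(1) by blast
  qed
  then obtain p where p: "\<And>x. p x \<in> M" "\<And>x m. m \<in> M \<Longrightarrow> cinner (x - p x) m = 0" by metis
  have uniq: "p x = y" if "y \<in> M" "\<And>m. m \<in> M \<Longrightarrow> cinner (x - y) m = 0" for x y
  proof -
    have m: "p x - y \<in> M" using csubspace_diff[OF M(1) p(1) that(1)] .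
    have "cinner (p x - y) (p x - y) = cinner (x - y) (p x - y) - cinner (x - p x) (p x - y)"
      by (simp flip: cinner_diff_left)
    also have "\<dots> = 0" using that(2)[OF m] p(2)[OF m] by simp
    finally show ?thesis by (simp add: cinner_self)
  qed
  have scale: "p (c *\<^sub>C x) = c *\<^sub>C p x" for c x
    using M(1) p by (intro uniq) (auto simp: csubspace_def cinner_scaleC_left simp flip: scaleC_diff_right)
  have "bounded_linear p"
  proof (rule bounded_linear_intro)
    show "p (x + y) = p x + p y" for x y
    proof (rule uniq)
      show "cinner (x + y - (p x + p y)) m = 0" if "m \<in> M" for m
        using p(2)[OF that, of x] p(2)[OF that, of y] by (simp add: cinner_diff_left cinner_add_left)
    qed (use M(1) p(1) in \<open>simp add: csubspace_def\<close>)
    show "p (r *\<^sub>R x) = r *\<^sub>R p x" for r x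
      using scale[of "of_real r" x] by (simp add: scaleC_of_real)
    show "norm (p x) \<le> norm x * 1" for x
    proof -
      have "cinner (x - p x) (p x) = 0" by (rule p(2)[OF p(1)])
      then have "(norm x)\<^sup>2 = (norm (x - p x))\<^sup>2 + (norm (p x))\<^sup>2"
        using norm_add_orthogonal[of "x - p x" "p x"] by simp
      then have "(norm (p x))\<^sup>2 \<le> (norm x)\<^sup>2" by simp
      then show ?thesis by simp
    qed
  qed
  then have "blinfun_apply (Blinfun p) = p" by (rule bounded_linear_Blinfun_apply)
  then show ?thesis using p scale by (intro exI[of _ "Blinfun p"]) (simp add: clinear_op_def)
qed

text \<open>Both operators vanish on x - P x, which is orthogonal to M, so the values on M decide.
  This gives uniqueness in the \<open>THE\<close> descriptions of operators on a closed
  subspace.\<close>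

lemma bops_eqI:
  assumes M: "csubspace M" "closed M" and A: "A \<in> bops M N" and B: "B \<in> bops M N'"
    and eq: "\<And>x. x \<in> M \<Longrightarrow> blinfun_apply A x = B x"
  shows "A = B"
proof (rule blinfun_eqI)
  fix x
  obtain P where P: "\<forall>x. blinfun_apply P x \<in> M" "\<forall>x. \<forall>m\<in>M. cinner (x - P x) m = 0"
    using orthogonal_projection_exists[OF M] by blast
  have "A (x - P x) = 0" "B (x - P x) = 0" using A B P(2) by (auto simp: bops_def)
  then show "A x = B x" using eq[of "P x"] P(1) by (simp add: blinfun.diff_right)
qed


subsection \<open>Square roots of nonnegative operators\<close>

lemma nonneg_opD:
  "nonneg_op A \<Longrightarrow> 0 \<le> Re (cinner (A x) x)" "nonneg_op A \<Longrightarrow> Im (cinner (A x) x) = 0"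
  by (auto simp: nonneg_op_def complex_nonneg_Reals_iff)

lemma nonneg_opI:
  "(\<And>x. 0 \<le> Re (cinner (blinfun_apply A x) x)) \<Longrightarrow> (\<And>x. Im (cinner (A x) x) = 0) \<Longrightarrow> nonneg_op A"
  by (auto simp: nonneg_op_def complex_nonneg_Reals_iff)

text \<open>Polarisation: reality of the form at x + y relates the imaginary parts, and the same
  relation with i x for x relates the real parts.\<close>

lemma self_adjointI:
  assumes A: "clinear_op A" and real: "\<And>x. Im (cinner (blinfun_apply A x) x) = 0"
  shows "cinner (A x) y = cinner x (A y)"
proof -
  have *: "Im (cinner (A x) y) + Im (cinner (A y) x) = 0" for x y
    using real[of "x + y"] real[of x] real[of y]
    by (simp add: blinfun.add_right cinner_add_left cinner_add_right)
  have "Re (cinner (A x) y) = Re (cinner (A y) x)"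
    using *[of "\<i> *\<^sub>C x" y] by (simp add: clinear_opD[OF A] cinner_scaleC_left cinner_scaleC_right)
  then show ?thesis
    using *[of x y] cinner_commute[of x "A y"] by (simp add: complex_eq_iff)
qed

lemma nonneg_self_adjoint:
  "clinear_op A \<Longrightarrow> nonneg_op A \<Longrightarrow> cinner (A x) y = cinner x (A y)"
  by (rule self_adjointI) (auto dest: nonneg_opD)

lemma self_adjoint_Im:
  assumes "\<And>x y. cinner (A x) y = cinner x (A y)"
  shows "Im (cinner (A x) x) = 0"
  using assms[of x x] cinner_commute[of x "A x"] by (simp add: complex_eq_iff)

text \<open>The form is nonnegative at x - t P x, and t = 1 / C minimises the resulting coefficient
  - 2 t + C t^2 of the squared norm of P x. This stands in for P^2 \<le> C P before square roots are
  available.\<close>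

lemma nonneg_norm_sq_le:
  assumes P: "clinear_op P" "nonneg_op P" and C: "norm P \<le> C" "0 < C"
  shows "(norm (P x))\<^sup>2 \<le> C * Re (cinner (P x) x)"
proof -
  define t where "t = 1 / C"
  define y where "y = x - t *\<^sub>R P x"
  note sa = nonneg_self_adjoint[OF P]
  have "Re (cinner (P (P x)) (P x)) \<le> norm (P (P x)) * norm (P x)"
    by (simp add: Re_cinner norm_cauchy_schwarz)
  also have "\<dots> \<le> (C * norm (P x)) * norm (P x)"
    by (intro mult_right_mono order_trans[OF norm_blinfun] C) auto
  finally have b: "Re (cinner (P (P x)) (P x)) \<le> C * (norm (P x))\<^sup>2"
    by (simp add: power2_eq_square)
  have "0 \<le> Re (cinner (P y) y)" by (rule nonneg_opD(1)[OF P(2)])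
  also have "Re (cinner (P y) y) = Re (cinner (P x) x) - 2 * t * (norm (P x))\<^sup>2
      + t\<^sup>2 * Re (cinner (P (P x)) (P x))"
    using sa[of "P x" x]
    by (simp add: y_def blinfun.diff_right blinfun.scaleR_right cinner_diff_left cinner_diff_right
        cinner_scaleR_left cinner_scaleR_right norm_eq_cinner power2_eq_square[of t] right_diff_distrib)
  also have "\<dots> \<le> Re (cinner (P x) x) - 2 * t * (norm (P x))\<^sup>2 + t\<^sup>2 * (C * (norm (P x))\<^sup>2)"
    by (intro add_left_mono mult_left_mono b) auto
  also have "\<dots> = Re (cinner (P x) x) - (norm (P x))\<^sup>2 / C"
    using C(2) by (simp add: t_def power2_eq_square)
  finally show ?thesis using C(2) by (simp add: field_simps)
qed

lemma nonneg_op_zeroD: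
  assumes P: "clinear_op P" "nonneg_op P" and "Re (cinner (P x) x) = 0"
  shows "P x = 0"
proof -
  have "(norm (P x))\<^sup>2 \<le> (norm P + 1) * Re (cinner (P x) x)"
    by (rule nonneg_norm_sq_le[OF P]) (auto intro: add_nonneg_pos)
  then show ?thesis using assms by simp
qed

text \<open>Solves \<open>Y = (B + Y\<^sup>2) / 2\<close>, so that \<open>(I - Y)\<^sup>2 = I - B\<close>, by iteration. The same iteration on the
  scalar 1 gives a majorant \<open>y\<close> for the norms of the iterates and of their differences.\<close>

primrec root_iter :: "('a::complex_hilbert \<Rightarrow>\<^sub>L 'a) \<Rightarrow> nat \<Rightarrow> 'a \<Rightarrow>\<^sub>L 'a" where
  "root_iter B 0 = 0"
| "root_iter B (Suc m) = (1/2) *\<^sub>R (B + (root_iter B m o\<^sub>L root_iter B m))"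

primrec root_major :: "nat \<Rightarrow> real" where
  "root_major 0 = 0"
| "root_major (Suc m) = (1 + (root_major m)\<^sup>2) / 2"

lemma root_major_bounds: "0 \<le> root_major m \<and> root_major m \<le> 1"
proof (induction m)
  case (Suc m)
  then have "(root_major m)\<^sup>2 \<le> 1" by (simp add: power_le_one)
  then show ?case by simp
qed simp

lemma root_major_mono: "root_major m \<le> root_major (Suc m)"
  using sum_squares_bound[of 1 "root_major m"] by simp

lemma norm_root_iter:
  assumes "norm B \<le> 1"
  shows "norm (root_iter B m) \<le> root_major m"
proof (induction m)
  case (Suc m)
  have "norm (root_iter B m o\<^sub>L root_iter B m) \<le> norm (root_iter B m) * norm (root_iter B m)"
    by (rule norm_blinfun_compose)
  also have "\<dots> \<le> (root_major m)\<^sup>2"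
    unfolding power2_eq_square by (intro mult_mono Suc) (auto simp: root_major_bounds)
  finally show ?case using assms norm_triangle_ineq[of B "root_iter B m o\<^sub>L root_iter B m"] by simp
qed simp

lemma norm_root_iter_diff:
  assumes "norm B \<le> 1"
  shows "norm (root_iter B (Suc m) - root_iter B m) \<le> root_major (Suc m) - root_major m"
proof (induction m)
  case (Suc m)
  define X Y where "X = root_iter B (Suc m)" and "Y = root_iter B m"
  define x y where "x = root_major (Suc m)" and "y = root_major m"
  have xy: "norm X \<le> x" "norm Y \<le> y" "norm (X - Y) \<le> x - y"
    using norm_root_iter[OF assms] Suc unfolding X_def Y_def x_def y_def by blast+
  \<comment> \<open>The splitting X^2 - Y^2 = X (X - Y) + (X - Y) Y holds for operators, and
    estimating its two terms by the majorant gives exactly x^2 - y^2.\<close>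
  have "root_iter B (Suc (Suc m)) - root_iter B (Suc m)
      = (1/2) *\<^sub>R ((X o\<^sub>L (X - Y)) + ((X - Y) o\<^sub>L Y))"
    unfolding X_def root_iter.simps(2)[of B "Suc m"] unfolding root_iter.simps(2)[of B m, folded Y_def] 
    by (rule blinfun_eqI)
      (simp add: Y_def blinfun.add_left blinfun.scaleR_left blinfun.diff_left blinfun.diff_right
        blinfun.add_right blinfun.scaleR_right algebra_simps)
  also have "norm \<dots> \<le> (1/2) * (norm X * norm (X - Y) + norm (X - Y) * norm Y)"
    using norm_triangle_ineq[of "X o\<^sub>L (X - Y)" "(X - Y) o\<^sub>L Y"]
      norm_blinfun_compose[of X "X - Y"] norm_blinfun_compose[of "X - Y" Y] by simp
  also have "\<dots> \<le> (1/2) * (x * (x - y) + (x - y) * y)"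
    using xy order_trans[OF norm_ge_zero xy(1)] order_trans[OF norm_ge_zero xy(2)] order_trans[OF norm_ge_zero xy(3)]
    by (intro mult_left_mono add_mono mult_mono) auto
  also have "\<dots> = root_major (Suc (Suc m)) - root_major (Suc m)"
    unfolding root_major.simps(2)[of "Suc m"] root_major.simps(2)[of m, folded x_def y_def] x_def[symmetric]
    using x_def by (simp add: y_def field_simps power2_eq_square)
  finally show ?case .
qed (use assms in simp)

text \<open>The majorant is increasing and bounded, so its increments are summable; they dominate
  the increments of the iteration.\<close>

lemma convergent_root_iter:
  assumes "norm B \<le> 1"
  shows "convergent (root_iter B)"
proof -
  have maj: "convergent root_major"
    by (rule Bseq_mono_convergent[OF BseqI'[where K = 1]])
      (use root_major_bounds root_major_mono in \<open>auto intro: lift_Suc_mono_le simp del: root_major.simps\<close>)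
  have "summable (\<lambda>m. root_major (Suc m) - root_major m)"
    using maj unfolding convergent_def summable_def by (blast intro: telescope_sums)
  then have "summable (\<lambda>m. root_iter B (Suc m) - root_iter B m)"
    by (rule summable_comparison_test'[where N = 0]) (rule norm_root_iter_diff[OF assms])
  then have "convergent (\<lambda>m. \<Sum>i<m. root_iter B (Suc i) - root_iter B i)"
    by (simp only: summable_iff_convergent)
  then show ?thesis unfolding sum_lessThan_telescope by simp
qed

text \<open>The iterates are polynomials in B, so whatever commutes with B commutes with their limit
  Y. This clause is carried along because uniqueness of the root depends on it. Nonnegativity of I -
  Y comes from norm Y \<le> 1 and the self-adjointness of Y.\<close>

lemma nonneg_sqrt_exists_unit:
  assumes B: "clinear_op B" "\<And>x y. cinner (blinfun_apply B x) y = cinner x (B y)" "norm B \<le> 1"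
  shows "\<exists>R. clinear_op R \<and> nonneg_op R \<and> R o\<^sub>L R = id_blinfun - B \<and>
    (\<forall>C. C o\<^sub>L B = B o\<^sub>L C \<longrightarrow> C o\<^sub>L R = R o\<^sub>L C)"
proof -
  obtain Y where Y: "root_iter B \<longlonglongrightarrow> Y"
    using convergent_root_iter[OF B(3)] convergent_def by blast
  have Yx: "(\<lambda>m. root_iter B m x) \<longlonglongrightarrow> Y x" for x
    by (intro blinfun.tendsto Y tendsto_const)
  have "(\<lambda>m. (1/2) *\<^sub>R (B + (root_iter B m o\<^sub>L root_iter B m))) \<longlonglongrightarrow> (1/2) *\<^sub>R (B + (Y o\<^sub>L Y))"
    by (intro tendsto_intros bounded_bilinear.tendsto[OF bounded_bilinear_blinfun_compose] Y)
  then have "root_iter B \<longlonglongrightarrow> (1/2) *\<^sub>R (B + (Y o\<^sub>L Y))"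
    by (subst filterlim_sequentially_Suc[symmetric]) simp
  then have Yeq: "Y = (1/2) *\<^sub>R (B + (Y o\<^sub>L Y))" using Y LIMSEQ_unique by blast
  have lin: "clinear_op (root_iter B m)" for m
    by (induction m) (auto intro: clinear_scaleR clinear_add clinear_comp B)
  have sa: "cinner (root_iter B m x) y = cinner x (root_iter B m y)" for m x y
    by (induction m arbitrary: x y) (simp_all add: blinfun.add_left blinfun.scaleR_left B cinner_add_left cinner_add_right
        cinner_scaleR_left cinner_scaleR_right)
  have Ylin: "clinear_op Y"
    unfolding clinear_op_def
  proof (intro allI)
    fix c x
    have "(\<lambda>m. root_iter B m (c *\<^sub>C x)) \<longlonglongrightarrow> c *\<^sub>C Y x"
      unfolding clinear_opD[OF lin] by (intro bounded_linear.tendsto[OF bounded_linear_scaleC_right] Yx)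
    then show "Y (c *\<^sub>C x) = c *\<^sub>C Y x" using Yx LIMSEQ_unique by blast
  qed
  have Ysa: "cinner (Y x) y = cinner x (Y y)" for x y
  proof (rule LIMSEQ_unique)
    show "(\<lambda>m. cinner (root_iter B m x) y) \<longlonglongrightarrow> cinner (Y x) y" by (intro tendsto_cinner Yx tendsto_const)
    show "(\<lambda>m. cinner (root_iter B m x) y) \<longlonglongrightarrow> cinner x (Y y)"
      unfolding sa by (intro tendsto_cinner Yx tendsto_const)
  qed
  have Ynorm: "norm Y \<le> 1"
    by (rule LIMSEQ_le_const2[OF tendsto_norm[OF Y]])
      (use norm_root_iter[OF B(3)] root_major_bounds order_trans in blast)
  have comm: "C o\<^sub>L Y = Y o\<^sub>L C" if C: "C o\<^sub>L B = B o\<^sub>L C" for C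
  proof -
    have CB: "C (B x) = B (C x)" for x using C by (metis blinfun_apply_blinfun_compose)
    have "C (root_iter B m x) = root_iter B m (C x)" for m x
      by (induction m arbitrary: x) (simp_all add: blinfun.add_left blinfun.scaleR_left blinfun.add_right blinfun.scaleR_right CB)
    then have "C (Y x) = Y (C x)" for x
      using blinfun.tendsto[OF tendsto_const[of C] Yx[of x]] Yx[of "C x"] LIMSEQ_unique by simp
    then show ?thesis by (simp add: blinfun_eqI)
  qed
  define R where "R = id_blinfun - Y"
  have "clinear_op R" unfolding R_def by (intro clinear_diff Ylin) simp
  moreover have "nonneg_op R"
  proof (rule nonneg_opI)
    fix x
    have "Re (cinner (Y x) x) \<le> norm (Y x) * norm x" by (simp add: Re_cinner norm_cauchy_schwarz)
    also have "\<dots> \<le> (1 * norm x) * norm x"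
      by (intro mult_right_mono order_trans[OF norm_blinfun] Ynorm) auto
    finally show "0 \<le> Re (cinner (R x) x)"
      by (simp add: R_def blinfun.diff_left cinner_diff_left cinner_self power2_eq_square)
    show "Im (cinner (R x) x) = 0"
      using self_adjoint_Im[of Y x] Ysa by (simp add: R_def blinfun.diff_left cinner_diff_left cinner_self)
  qed
  moreover have "R o\<^sub>L R = id_blinfun - B"
  proof (rule blinfun_eqI)
    fix x
    have "Y x = (1/2) *\<^sub>R (B x + Y (Y x))"
      using arg_cong[OF Yeq, of "\<lambda>Z. blinfun_apply Z x"] by (simp add: blinfun.add_left blinfun.scaleR_left)
    then have "2 *\<^sub>R Y x = 2 *\<^sub>R ((1/2) *\<^sub>R (B x + Y (Y x)))" by (rule arg_cong)
    then have "2 *\<^sub>R Y x = B x + Y (Y x)" by simp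
    then show "(R o\<^sub>L R) x = (id_blinfun - B) x"
      by (simp add: R_def blinfun.diff_left blinfun.diff_right algebra_simps scaleR_2)
  qed
  moreover have "C o\<^sub>L R = R o\<^sub>L C" if "C o\<^sub>L B = B o\<^sub>L C" for C
  proof (rule blinfun_eqI)
    fix x
    have "C (Y x) = Y (C x)" using comm[OF that] by (metis blinfun_apply_blinfun_compose)
    then show "(C o\<^sub>L R) x = (R o\<^sub>L C) x" by (simp add: R_def blinfun.diff_left blinfun.diff_right)
  qed
  ultimately show ?thesis by blast
qed

lemma nonneg_sqrt_exists:
  assumes P: "clinear_op P" "nonneg_op P"
  shows "\<exists>R. clinear_op R \<and> nonneg_op R \<and> R o\<^sub>L R = P \<and>
    (\<forall>C. C o\<^sub>L P = P o\<^sub>L C \<longrightarrow> C o\<^sub>L R = R o\<^sub>L C)"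
proof -
  \<comment> \<open>Dividing by c makes I - P / c a contraction; the summand 1 keeps c positive when
    P = 0.\<close>
  define c where "c = norm P + 1"
  have c: "c > 0" by (simp add: c_def add_nonneg_pos)
  define B where "B = id_blinfun - (1 / c) *\<^sub>R P"
  note sa = nonneg_self_adjoint[OF P]
  have "clinear_op B" unfolding B_def by (intro clinear_diff clinear_scaleR P) simp
  moreover have "cinner (B x) y = cinner x (B y)" for x y
    by (simp add: B_def blinfun.diff_left blinfun.scaleR_left cinner_diff_left cinner_diff_right
        cinner_scaleR_left cinner_scaleR_right sa)
  moreover have "norm B \<le> 1"
  proof (rule norm_blinfun_bound)
    fix x
    have "(norm (P x))\<^sup>2 \<le> c * Re (cinner (P x) x)"
      by (rule nonneg_norm_sq_le[OF P]) (auto simp: c_def add_nonneg_pos)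
    moreover have "0 \<le> Re (cinner (P x) x)" by (rule nonneg_opD(1)[OF P(2)])
    \<comment> \<open>The factor 2 is that of the cross term in the expansion of the squared norm of
      B x.\<close>
    ultimately have "(norm (P x))\<^sup>2 \<le> 2 * c * Re (cinner (P x) x)"
      using c mult_nonneg_nonneg[of c "Re (cinner (P x) x)"] by linarith
    then have le: "(norm (P x))\<^sup>2 / c\<^sup>2 \<le> 2 / c * Re (cinner (P x) x)"
      using c by (simp add: field_simps power2_eq_square)
    have "(norm (B x))\<^sup>2 = (norm x)\<^sup>2 - 2 / c * Re (cinner (P x) x) + (norm (P x))\<^sup>2 / c\<^sup>2"
      using sa[of x x]
      by (simp add: B_def blinfun.diff_left blinfun.scaleR_left norm_eq_cinner cinner_diff_left cinner_diff_right
        cinner_scaleR_left cinner_scaleR_right)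
        (simp add: power2_eq_square diff_divide_distrib)
    with le have "(norm (B x))\<^sup>2 \<le> (norm x)\<^sup>2" by simp
    then show "norm (B x) \<le> 1 * norm x" by simp
  qed simp
  ultimately obtain R where R: "clinear_op R" "nonneg_op R" "R o\<^sub>L R = id_blinfun - B"
    and comm: "\<And>C. C o\<^sub>L B = B o\<^sub>L C \<Longrightarrow> C o\<^sub>L R = R o\<^sub>L C"
    using nonneg_sqrt_exists_unit[of B] by blast
  define S where "S = sqrt c *\<^sub>R R"
  have RR: "R (R x) = (1 / c) *\<^sub>R P x" for x
    using arg_cong[OF R(3), of "\<lambda>Z. blinfun_apply Z x"] by (simp add: B_def blinfun.diff_left blinfun.scaleR_left)
  have "clinear_op S" unfolding S_def by (intro clinear_scaleR R)
  moreover have "nonneg_op S"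
    using R(2) c by (intro nonneg_opI) (auto simp: S_def blinfun.scaleR_left cinner_scaleR_left nonneg_opD)
  moreover have "S o\<^sub>L S = P"
    using c by (intro blinfun_eqI) (simp add: S_def blinfun.scaleR_left blinfun.scaleR_right RR)
  moreover have "C o\<^sub>L S = S o\<^sub>L C" if C: "C o\<^sub>L P = P o\<^sub>L C" for C
  proof -
    have CP: "C (P x) = P (C x)" for x using C by (metis blinfun_apply_blinfun_compose)
    have "C o\<^sub>L B = B o\<^sub>L C"
      by (rule blinfun_eqI) (simp add: B_def blinfun.diff_left blinfun.scaleR_left blinfun.diff_right blinfun.scaleR_right CP)
    then have "C o\<^sub>L R = R o\<^sub>L C" by (rule comm)
    then have "C (R x) = R (C x)" for x by (metis blinfun_apply_blinfun_compose)
    then show ?thesis by (intro blinfun_eqI) (simp add: S_def blinfun.scaleR_left blinfun.scaleR_right)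
  qed
  ultimately show ?thesis by blast
qed

text \<open>For y = S x - R x, equal squares and commutation give (S + R) y = 0. Both forms are
  nonnegative, so both vanish at y; hence S y = R y = 0, and self-adjointness makes y orthogonal to
  itself.\<close>

lemma nonneg_sqrt_unique:
  assumes R: "clinear_op R" "nonneg_op R" and S: "clinear_op S" "nonneg_op S"
    and sq: "S o\<^sub>L S = R o\<^sub>L R" and comm: "S o\<^sub>L R = R o\<^sub>L S"
  shows "S = R"
proof (rule blinfun_eqI)
  fix x
  have sq': "S (S x) = R (R x)" for x using sq by (metis blinfun_apply_blinfun_compose)
  have comm': "S (R x) = R (S x)" for x using comm by (metis blinfun_apply_blinfun_compose)
  define y where "y = S x - R x"
  have "S y + R y = 0" by (simp add: y_def blinfun.diff_right sq' comm')
  then have "cinner (S y) y + cinner (R y) y = 0" by (simp flip: cinner_add_left)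
  then have "Re (cinner (S y) y) + Re (cinner (R y) y) = 0" by (metis plus_complex.sel(1) zero_complex.sel(1))
  moreover have "0 \<le> Re (cinner (S y) y)" "0 \<le> Re (cinner (R y) y)"
    using R S by (auto dest: nonneg_opD)
  ultimately have "S y = 0" "R y = 0"
    by (auto intro!: nonneg_op_zeroD R S)
  moreover have "cinner y y = cinner x (S y) - cinner x (R y)"
    unfolding y_def
    by (simp add: cinner_diff_left nonneg_self_adjoint[OF R] nonneg_self_adjoint[OF S])
  ultimately show "S x = R x" by (simp add: cinner_self y_def)
qed

lemma
  assumes P: "clinear_op P" "nonneg_op P"
  shows clinear_op_sqrt: "clinear_op (op_sqrt P)"
    and nonneg_op_sqrt: "nonneg_op (op_sqrt P)"
    and op_sqrt_sq: "op_sqrt P (op_sqrt P x) = P x"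
proof -
  obtain R where R: "clinear_op R" "nonneg_op R" "R o\<^sub>L R = P"
    and comm: "\<And>C. C o\<^sub>L P = P o\<^sub>L C \<Longrightarrow> C o\<^sub>L R = R o\<^sub>L C"
    using nonneg_sqrt_exists[OF P] by blast
  have "op_sqrt P = R" unfolding op_sqrt_def
  proof (rule the_equality)
    show "clinear_op R \<and> nonneg_op R \<and> R o\<^sub>L R = P" using R by (intro conjI)
  next
    fix S assume S: "clinear_op S \<and> nonneg_op S \<and> S o\<^sub>L S = P"
    \<comment> \<open>A competing root commutes with its own square P, hence with R by the
      commutation clause.\<close>
    then have P_eq: "P = S o\<^sub>L S" by blast
    have "S o\<^sub>L P = P o\<^sub>L S" unfolding P_eq by (rule blinfun_eqI) simp
    then have "S o\<^sub>L R = R o\<^sub>L S" by (rule comm)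
    moreover have "S o\<^sub>L S = R o\<^sub>L R" using S by (simp only: R(3))
    ultimately show "S = R"
      by (rule nonneg_sqrt_unique[OF R(1,2) conjunct1[OF S] conjunct1[OF conjunct2[OF S]], rotated])
  qed
  then show "clinear_op (op_sqrt P)" "nonneg_op (op_sqrt P)" "op_sqrt P (op_sqrt P x) = P x"
    using R(1,2) arg_cong[OF R(3), of "\<lambda>Z. blinfun_apply Z x"] by simp_all
qed

lemma cinner_op_sqrt:
  assumes "clinear_op P" "nonneg_op P"
  shows "(norm (op_sqrt P x))\<^sup>2 = Re (cinner (P x) x)"
  using nonneg_self_adjoint[OF clinear_op_sqrt nonneg_op_sqrt, OF assms assms, of "op_sqrt P x" x]
  by (simp add: norm_eq_cinner op_sqrt_sq[OF assms])

lemma csubspace_range: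
  assumes "clinear_op A" shows "csubspace (range A)"
  by (auto simp: csubspace_def simp flip: blinfun.add_right clinear_opD[OF assms]
      intro: range_eqI[of _ _ 0])

text \<open>A nonnegative operator and its square root have the same kernel, hence the same closed range.\<close>

lemma op_sqrt_in_closure_range:
  assumes P: "clinear_op P" "nonneg_op P"
  shows "op_sqrt P x \<in> closure (range P)"
proof -
  let ?R = "op_sqrt P"
  have Rsa: "cinner (?R x) y = cinner x (?R y)" for x y
    by (rule nonneg_self_adjoint[OF clinear_op_sqrt nonneg_op_sqrt, OF P P])
  have "csubspace (closure (range P))" by (intro csubspace_closure csubspace_range P)
  then obtain Q where Q: "\<forall>x. blinfun_apply Q x \<in> closure (range P)"
      "\<forall>x. \<forall>m\<in>closure (range P). cinner (x - Q x) m = 0"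
    using orthogonal_projection_exists[of "closure (range P)"] by auto
  define y where "y = ?R x - Q (?R x)"
  have orth: "cinner y m = 0" if "m \<in> closure (range P)" for m using Q(2) that by (simp add: y_def)
  have "P y \<in> closure (range P)" using closure_subset[of "range P"] by (rule subsetD) (rule rangeI)
  then have "cinner y (P y) = 0" by (rule orth)
  then have "cinner (?R y) (?R y) = 0" by (simp add: Rsa op_sqrt_sq[OF P])
  then have "?R y = 0" by (simp add: cinner_self)
  then have "cinner (?R x) y = 0" by (simp add: Rsa)
  then have "cinner y (?R x) = 0" by (metis cinner_commute complex_cnj_zero)
  moreover have "cinner y (Q (?R x)) = 0" using orth Q(1) by blast
  ultimately have "cinner y y = 0" by (simp add: y_def cinner_diff_right)
  then have "?R x = Q (?R x)" by (simp add: cinner_self y_def)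
  then show ?thesis using Q(1) by metis
qed


section \<open>Square-summable families and ampliations\<close>

lemma ell2_eqI: "(\<And>i. ell2_nth f i = ell2_nth g i) \<Longrightarrow> f = g"
  by (simp add: ell2_nth_inject[symmetric] fun_eq_iff)

lemmas ell2_nth_simps [simp] = zero_ell2.rep_eq plus_ell2.rep_eq minus_ell2.rep_eq uminus_ell2.rep_eq
  scaleR_ell2.rep_eq scaleC_ell2.rep_eq ell2_tensor.rep_eq ell2_basis.rep_eq

lemma bounded_linear_ell2_nth: "bounded_linear (\<lambda>f. ell2_nth f i)"
  by (rule bounded_linear_intro[where K = 1]) (auto simp: norm_ell2_nth_le)

lemma ell2_nth_sum [simp]: "ell2_nth (sum f A) i = (\<Sum>a\<in>A. ell2_nth (f a) i)"
  by (rule linear_sum[OF bounded_linear.linear[OF bounded_linear_ell2_nth]])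

text \<open>Bounded finite partial sums certify membership in the type and bound the norm at once.
  Every operator defined by its coordinates below passes through this.\<close>

lemma ell2_nth_Abs_bounded:
  assumes "\<And>F. finite F \<Longrightarrow> (\<Sum>i\<in>F. (norm (f i))\<^sup>2) \<le> C"
  shows "ell2_nth (Abs_ell2 f) = f" and "(norm (Abs_ell2 f))\<^sup>2 \<le> C"
proof -
  have "(\<lambda>i. (norm (f i))\<^sup>2) summable_on UNIV"
    by (rule nonneg_bdd_above_summable_on) (use assms in \<open>auto intro!: bdd_aboveI2\<close>)
  then show nth: "ell2_nth (Abs_ell2 f) = f" by (intro Abs_ell2_inverse) simp
  show "(norm (Abs_ell2 f))\<^sup>2 \<le> C"
    unfolding norm_ell2_sq nth
    by (rule infsum_le_finite_sums) (use assms \<open>(\<lambda>i. (norm (f i))\<^sup>2) summable_on UNIV\<close> in auto)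
qed

lemma ell2_tensor_add_left: "ell2_tensor (u + v) e = ell2_tensor u e + ell2_tensor v e"
  by (rule ell2_eqI) (simp add: scaleC_add_left)

lemma ell2_tensor_add_right: "ell2_tensor u (e + g) = ell2_tensor u e + ell2_tensor u g"
  by (rule ell2_eqI) (simp add: scaleC_add_right)

lemma ell2_tensor_scaleC_left: "ell2_tensor (c *\<^sub>C u) e = c *\<^sub>C ell2_tensor u e"
  by (rule ell2_eqI) (simp add: scaleC_scaleC scaleC_complex_def)

lemma ell2_tensor_scaleC_right: "ell2_tensor u (c *\<^sub>C e) = c *\<^sub>C ell2_tensor u e"
  by (rule ell2_eqI) (simp add: scaleC_scaleC mult.commute)

lemma cinner_ell2_tensor: "cinner (ell2_tensor u e) (ell2_tensor v g) = cinner u v * cinner e g"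
  unfolding cinner_ell2_def infsum_cmult_left'[symmetric]
  by (rule infsum_cong) (simp add: cinner_scaleC_left cinner_scaleC_right cinner_complex_def)

lemma norm_ell2_tensor: "norm (ell2_tensor u e) = norm u * norm e"
proof -
  have "complex_of_real ((norm (ell2_tensor u e))\<^sup>2) = of_real ((norm u * norm e)\<^sup>2)"
    unfolding cinner_self[symmetric] cinner_ell2_tensor by (simp add: cinner_self power_mult_distrib)
  then have "(norm (ell2_tensor u e))\<^sup>2 = (norm u * norm e)\<^sup>2" using of_real_eq_iff by blast
  then show ?thesis by (simp add: power2_eq_iff_nonneg)
qed

lemma bounded_bilinear_ell2_tensor:
  "bounded_bilinear (ell2_tensor :: ('i, complex) ell2 \<Rightarrow> 'h::complex_hilbert \<Rightarrow> ('i, 'h) ell2)"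
proof (unfold_locales)
  fix u v :: "('i, complex) ell2" and e g :: 'h and r :: real
  show "ell2_tensor (u + v) e = ell2_tensor u e + ell2_tensor v e"
    "ell2_tensor u (e + g) = ell2_tensor u e + ell2_tensor u g"
    by (rule ell2_tensor_add_left ell2_tensor_add_right)+
  show "ell2_tensor (r *\<^sub>R u) e = r *\<^sub>R ell2_tensor u e" "ell2_tensor u (r *\<^sub>R e) = r *\<^sub>R ell2_tensor u e"
    by (simp_all flip: scaleC_of_real add: ell2_tensor_scaleC_left ell2_tensor_scaleC_right)
  show "\<exists>K. \<forall>u (e::'h). norm (ell2_tensor u e :: ('i, 'h) ell2) \<le> norm u * norm e * K"
    by (rule exI[of _ 1]) (simp add: norm_ell2_tensor)
qed

lemmas bounded_linear_tensor_left = bounded_bilinear.bounded_linear_left[OF bounded_bilinear_ell2_tensor]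
lemmas ell2_tensor_sum_left = bounded_linear.linear[OF bounded_linear_tensor_left, THEN linear_sum]

lemma sum_if_eq_nth:
  "finite F \<Longrightarrow> (\<Sum>a\<in>F. (if i = a then 1 else 0) *\<^sub>C (f a :: 'h::complex_hilbert)) = (if i \<in> F then f i else 0)"
proof -
  assume "finite F"
  have "(\<Sum>a\<in>F. (if i = a then 1 else 0) *\<^sub>C f a) = (\<Sum>a\<in>F. if i = a then f a else 0)"
    by (rule sum.cong) auto
  then show ?thesis using \<open>finite F\<close> by simp
qed

lemma norm_sum_basis_tensor:
  assumes "finite F"
  shows "(norm (\<Sum>a\<in>F. ell2_tensor (ell2_basis a) (f a)))\<^sup>2 = (\<Sum>a\<in>F. (norm (f a))\<^sup>2)"
  unfolding norm_ell2_sq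
  by (simp add: sum_if_eq_nth[OF assms] if_distrib[of norm] if_distrib[of "\<lambda>x. x\<^sup>2"] cong: if_cong)
    (subst infsum_cong_neutral[where T = F and g = "\<lambda>a. (norm (f a))\<^sup>2"], use assms in auto)

text \<open>The squared error of the partial sum over F is the squared norm of f minus the squared
  entries over F, which tends to 0 along finite sets.\<close>

lemma ell2_has_sum_UNIV:
  "((\<lambda>i. ell2_tensor (ell2_basis i) (ell2_nth f i)) has_sum f) UNIV"
  unfolding has_sum_def
proof (rule Lim_null[THEN iffD2], rule tendsto_norm_zero_cancel, rule tendsto_0_le[where K = 1])
  let ?s = "\<lambda>F. \<Sum>i\<in>F. ell2_tensor (ell2_basis i) (ell2_nth f i)"
  let ?g = "\<lambda>F. sqrt ((norm f)\<^sup>2 - (\<Sum>i\<in>F. (norm (ell2_nth f i))\<^sup>2))"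
  have "((\<lambda>F. \<Sum>i\<in>F. (norm (ell2_nth f i))\<^sup>2) \<longlongrightarrow> (norm f)\<^sup>2) (finite_subsets_at_top UNIV)"
    using has_sum_infsum[OF ell2_summable[of f]] unfolding has_sum_def norm_ell2_sq .
  then have "(?g \<longlongrightarrow> sqrt ((norm f)\<^sup>2 - (norm f)\<^sup>2)) (finite_subsets_at_top UNIV)"
    by (intro tendsto_intros)
  then show "(?g \<longlongrightarrow> 0) (finite_subsets_at_top UNIV)" by simp
  have "norm (norm (?s F - f)) \<le> norm (?g F) * 1" if F: "finite F" for F
  proof -
    have nth: "ell2_nth (?s F) i = (if i \<in> F then ell2_nth f i else 0)" for i
      by (simp add: sum_if_eq_nth[OF F])
    have "inner (?s F) f = (\<Sum>\<^sub>\<infinity>i. if i \<in> F then (norm (ell2_nth f i))\<^sup>2 else 0)"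
      unfolding inner_ell2_def nth by (intro infsum_cong) (simp add: power2_norm_eq_inner)
    also have "\<dots> = (\<Sum>i\<in>F. (norm (ell2_nth f i))\<^sup>2)"
      by (subst infsum_cong_neutral[where T = F and g = "\<lambda>i. (norm (ell2_nth f i))\<^sup>2"]) (use F in auto)
    finally have "(norm (?s F - f))\<^sup>2 = (norm f)\<^sup>2 - (\<Sum>i\<in>F. (norm (ell2_nth f i))\<^sup>2)"
      using norm_sum_basis_tensor[OF F, of "ell2_nth f"]
      by (simp add: power2_norm_eq_inner inner_diff_left inner_diff_right inner_commute)
    then have "sqrt ((norm (?s F - f))\<^sup>2) = ?g F" by simp
    then show ?thesis by simp
  qed
  then show "\<forall>\<^sub>F F in finite_subsets_at_top UNIV. norm (norm (?s F - f)) \<le> norm (?g F) * 1"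
    by (simp add: eventually_finite_subsets_at_top_weakI)
qed

lemma ell2_has_sum:
  assumes "\<And>i. i \<notin> F \<Longrightarrow> ell2_nth f i = 0"
  shows "((\<lambda>i. ell2_tensor (ell2_basis i) (ell2_nth f i)) has_sum f) F"
  using ell2_has_sum_UNIV[of f]
  by (rule iffD2[OF has_sum_cong_neutral, rotated -1]) (use assms in \<open>auto intro!: ell2_eqI\<close>)

lemma scalar_tensor: "ell2_tensor u (c::complex) = c *\<^sub>C u"
  by (rule ell2_eqI) (simp add: scaleC_complex_def)

lemma ell2_scalar_has_sum:
  assumes "\<And>i. i \<notin> F \<Longrightarrow> ell2_nth f i = 0"
  shows "((\<lambda>i. ell2_nth f i *\<^sub>C ell2_basis i) has_sum f) F"
  using ell2_has_sum[OF assms] by (simp add: scalar_tensor)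

lemma cinner_ell2_basis_right: "cinner f (ell2_basis i) = ell2_nth f i"
  unfolding cinner_ell2_def
  by (subst infsum_cong_neutral[where T = "{i}" and g = "ell2_nth f"]) (auto simp: cinner_complex_def)

lemma cinner_ell2_basis_left: "cinner (ell2_basis i) f = cnj (ell2_nth f i)"
  by (metis cinner_commute cinner_ell2_basis_right)

lemma norm_ell2_basis [simp]: "norm (ell2_basis i) = 1"
proof -
  have "(norm (ell2_basis i))\<^sup>2 = 1"
    unfolding norm_eq_cinner cinner_ell2_basis_right by simp
  then show ?thesis by (simp add: power2_eq_1_iff) (smt (verit) norm_ge_zero)
qed

lemma csubspace_ell2_on: "csubspace D \<Longrightarrow> csubspace (ell2_on F D)"
  by (simp add: csubspace_def ell2_on_def)

lemma closed_ell2_on: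
  assumes "closed D" shows "closed (ell2_on F D)"
proof -
  have "ell2_on F D = (\<Inter>i. (\<lambda>f. ell2_nth f i) -` (if i \<in> F then D else {0}))"
    by (auto simp: ell2_on_def split: if_splits)
  also have "closed \<dots>"
    by (intro closed_INT ballI continuous_closed_vimage)
      (use assms in \<open>auto intro: linear_continuous_at bounded_linear_ell2_nth\<close>)
  finally show ?thesis .
qed

lemma csubspace_UNIV [simp]: "csubspace UNIV" by (simp add: csubspace_def)

lemma tensor_in_ell2_on:
  "u \<in> ell2_on F UNIV \<Longrightarrow> csubspace D \<Longrightarrow> e \<in> D \<Longrightarrow> ell2_tensor u e \<in> ell2_on F D"
  by (auto simp: ell2_on_def csubspace_def)

lemma basis_in_ell2_on: "i \<in> F \<Longrightarrow> ell2_basis i \<in> ell2_on F UNIV"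
  by (auto simp: ell2_on_def)

lemma blinfun_ell2_has_sum:
  fixes A :: "('i, complex) ell2 \<Rightarrow>\<^sub>L 'b::complex_hilbert"
  assumes "clinear_op A"
  shows "((\<lambda>i. ell2_nth f i *\<^sub>C A (ell2_basis i)) has_sum A f) UNIV"
  using has_sum_bounded_linear[OF blinfun.bounded_linear_right ell2_scalar_has_sum[of UNIV f], of A]
  by (simp add: o_def clinear_opD[OF assms])

lemma blinfun_ell2_eqI:
  assumes "clinear_op A" "clinear_op B" "\<And>i. blinfun_apply A (ell2_basis i) = B (ell2_basis i)"
  shows "A = B"
proof (rule blinfun_eqI, rule has_sum_unique)
  show "((\<lambda>i. ell2_nth f i *\<^sub>C B (ell2_basis i)) has_sum A f) UNIV" for f
    using blinfun_ell2_has_sum[OF assms(1), of f] by (simp add: assms(3))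
qed (rule blinfun_ell2_has_sum[OF assms(2)])

lemma bops_ell2_basis_zero:
  assumes "A \<in> bops (ell2_on F UNIV) N" "i \<notin> F"
  shows "A (ell2_basis i) = 0"
  using assms by (auto simp: bops_def cinner_ell2_basis_left ell2_on_def)

text \<open>Basis vectors outside F are orthogonal to the subspace, so both operators kill
  them.\<close>

lemma bops_ell2_eqI:
  assumes "A \<in> bops (ell2_on F UNIV) N" "B \<in> bops (ell2_on F UNIV) N'"
    and "\<And>i. i \<in> F \<Longrightarrow> blinfun_apply A (ell2_basis i) = B (ell2_basis i)"
  shows "A = B"
  using assms by (intro blinfun_ell2_eqI) (auto simp: bops_ell2_basis_zero bops_def, metis assms bops_ell2_basis_zero)

lemma bops_ell2I:
  assumes "clinear_op A" "\<And>i. i \<notin> F \<Longrightarrow> A (ell2_basis i) = 0" "\<And>x. blinfun_apply A x \<in> N"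
  shows "A \<in> bops (ell2_on F UNIV) N"
proof -
  have "A x = 0" if "\<forall>m\<in>ell2_on F UNIV. cinner x m = 0" for x
  proof -
    have "ell2_nth x i = 0" if "i \<in> F" for i
      using \<open>\<forall>m\<in>ell2_on F UNIV. cinner x m = 0\<close> basis_in_ell2_on[OF that]
      by (metis cinner_ell2_basis_right)
    then have "ell2_nth x i *\<^sub>C A (ell2_basis i) = 0" for i using assms(2)[of i] by (cases "i \<in> F") auto
    then show ?thesis using infsumI[OF blinfun_ell2_has_sum[OF assms(1), of x]] by simp
  qed
  then show ?thesis using assms by (auto simp: bops_def)
qed

text \<open>Weighted shifts along an injective map cover the universal model, the number-operator multipliers and
  the projection onto the model space.\<close>

lemma weighted_shift_exists:
  fixes w :: "'i \<Rightarrow> complex" and \<pi> :: "'i \<Rightarrow> 'i"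
  assumes inj: "inj_on \<pi> F" and w: "\<And>i. i \<in> F \<Longrightarrow> cmod (w i) \<le> 1" and \<pi>: "\<pi> ` F \<subseteq> G"
  shows "\<exists>S. S \<in> bops (ell2_on F UNIV) (ell2_on G UNIV) \<and> (\<forall>x. norm (S x) \<le> norm x) \<and>
    (\<forall>i\<in>F. S (ell2_basis i) = w i *\<^sub>C ell2_basis (\<pi> i))"
proof -
  \<comment> \<open>Entry j is read at its preimage, so a finite set of output entries reindexes
    injectively to a finite set of input entries.\<close>
  define g where "g f j = (if j \<in> \<pi> ` F then w (the_inv_into F \<pi> j) * ell2_nth f (the_inv_into F \<pi> j) else 0)"
    for f :: "('i, complex) ell2" and j
  have bd: "(\<Sum>j\<in>H. (norm (g f j))\<^sup>2) \<le> (norm f)\<^sup>2" if H: "finite H" for f H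
  proof -
    define H' where "H' = the_inv_into F \<pi> ` (H \<inter> \<pi> ` F)"
    have H': "finite H'" unfolding H'_def using H by simp
    have "(\<Sum>j\<in>H. (norm (g f j))\<^sup>2) = (\<Sum>j\<in>H \<inter> \<pi> ` F. (norm (g f j))\<^sup>2)"
      by (rule sum.mono_neutral_right) (use H in \<open>auto simp: g_def\<close>)
    also have "\<dots> \<le> (\<Sum>j\<in>H \<inter> \<pi> ` F. (norm (ell2_nth f (the_inv_into F \<pi> j)))\<^sup>2)"
    proof (rule sum_mono)
      fix j assume j: "j \<in> H \<inter> \<pi> ` F"
      then have "cmod (w (the_inv_into F \<pi> j)) \<le> 1"
        using the_inv_into_into[OF inj, of j F] by (intro w) auto
      then have "norm (g f j) \<le> norm (ell2_nth f (the_inv_into F \<pi> j))"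
        using j by (auto simp: g_def norm_mult mult_left_le_one_le)
      then show "(norm (g f j))\<^sup>2 \<le> (norm (ell2_nth f (the_inv_into F \<pi> j)))\<^sup>2" by (simp add: power_mono)
    qed
    also have "\<dots> = (\<Sum>i\<in>H'. (norm (ell2_nth f i))\<^sup>2)"
      unfolding H'_def
      by (subst sum.reindex) (use inj_on_the_inv_into[OF inj] in \<open>auto intro: inj_on_subset\<close>)
    also have "\<dots> \<le> (norm f)\<^sup>2" by (rule sum_le_norm_ell2[OF H'])
    finally show ?thesis .
  qed
  have nth: "ell2_nth (Abs_ell2 (g f)) = g f" for f by (rule ell2_nth_Abs_bounded(1)[OF bd])
  have nrm: "norm (Abs_ell2 (g f)) \<le> norm f" for f
    using ell2_nth_Abs_bounded(2)[OF bd, of f] by (simp add: power2_le_iff_abs_le)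
  have scale: "Abs_ell2 (g (c *\<^sub>C f)) = c *\<^sub>C Abs_ell2 (g f)" for c f
    by (rule ell2_eqI) (simp add: nth g_def scaleC_complex_def)
  have "bounded_linear (\<lambda>f. Abs_ell2 (g f))"
  proof (rule bounded_linear_intro[where K = 1])
    show "Abs_ell2 (g (x + y)) = Abs_ell2 (g x) + Abs_ell2 (g y)" for x y
      by (rule ell2_eqI) (simp add: nth, simp add: g_def algebra_simps)
    show "Abs_ell2 (g (r *\<^sub>R x)) = r *\<^sub>R Abs_ell2 (g x)" for r x
      using scale[of "of_real r" x] by (simp add: scaleC_of_real)
  qed (use nrm in auto)
  then have S: "blinfun_apply (Blinfun (\<lambda>f. Abs_ell2 (g f))) = (\<lambda>f. Abs_ell2 (g f))"
    by (rule bounded_linear_Blinfun_apply)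
  let ?S = "Blinfun (\<lambda>f. Abs_ell2 (g f))"
  have basis: "?S (ell2_basis i) = (if i \<in> F then w i *\<^sub>C ell2_basis (\<pi> i) else 0)" for i
  proof (rule ell2_eqI)
    fix j
    show "ell2_nth (?S (ell2_basis i)) j = ell2_nth (if i \<in> F then w i *\<^sub>C ell2_basis (\<pi> i) else 0) j"
    proof (cases "j \<in> \<pi> ` F")
      case True
      then obtain i' where i': "i' \<in> F" "j = \<pi> i'" by blast
      then show ?thesis
        by (auto simp: S nth g_def the_inv_into_f_f[OF inj] scaleC_complex_def inj_on_eq_iff[OF inj])
    qed (auto simp: S nth g_def scaleC_complex_def)
  qed
  have "?S \<in> bops (ell2_on F UNIV) (ell2_on G UNIV)"
  proof (rule bops_ell2I)
    show "clinear_op ?S" by (simp add: clinear_op_def S scale)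
    show "?S x \<in> ell2_on G UNIV" for x using \<pi> by (auto simp: S nth g_def ell2_on_def)
  qed (simp add: basis)
  then show ?thesis using nrm basis by (intro exI[of _ ?S]) (simp add: S)
qed


subsection \<open>The ampliation \<open>A \<otimes> I\<close>\<close>

text \<open>Induction on the number of nonzero entries of the argument: split off the direction \<open>e\<close> of one of
  them. The part along \<open>e\<close> is a scalar problem, the part orthogonal to \<open>e\<close> has fewer nonzero entries,
  and the two are orthogonal before and after the operator is applied.\<close>

lemma ampliation_finite_bound:
  fixes A :: "nat \<Rightarrow> nat \<Rightarrow> ('i, complex) ell2 \<Rightarrow>\<^sub>L ('k, complex) ell2"
    and f :: "nat \<Rightarrow> 'i \<Rightarrow> 'h::complex_hilbert"
  assumes lin: "\<And>i j. i < m \<Longrightarrow> j < m \<Longrightarrow> clinear_op (A i j)"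
    and A: "\<And>x. (\<Sum>i<m. (norm (\<Sum>j<m. A i j (x j)))\<^sup>2) \<le> C * (\<Sum>j<m. (norm (x j))\<^sup>2)"
    and F: "finite F"
  shows "(\<Sum>i<m. (norm (\<Sum>j<m. \<Sum>\<gamma>\<in>F. ell2_tensor (A i j (ell2_basis \<gamma>)) (f j \<gamma>)))\<^sup>2)
     \<le> C * (\<Sum>j<m. \<Sum>\<gamma>\<in>F. (norm (f j \<gamma>))\<^sup>2)"
proof (induction "card {(j, \<gamma>). j < m \<and> \<gamma> \<in> F \<and> f j \<gamma> \<noteq> 0}" arbitrary: f rule: less_induct)
  case less
  show ?case
  proof (cases "\<forall>j<m. \<forall>\<gamma>\<in>F. f j \<gamma> = 0")
    case True
    have "ell2_tensor u (0::'h) = 0" for u :: "('k, complex) ell2"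
      using norm_ell2_tensor[of u "0::'h"] by simp
    with True show ?thesis by simp
  next
    case False
    then obtain j0 \<gamma>0 where 0: "j0 < m" "\<gamma>0 \<in> F" "f j0 \<gamma>0 \<noteq> 0" by blast
    define e where "e = (1 / norm (f j0 \<gamma>0)) *\<^sub>R f j0 \<gamma>0"
    define a where "a j \<gamma> = cinner (f j \<gamma>) e" for j \<gamma>
    define g where "g j \<gamma> = f j \<gamma> - a j \<gamma> *\<^sub>C e" for j \<gamma>
    have e: "norm e = 1" using 0 by (simp add: e_def)
    then have ee: "cinner e e = 1" by (simp add: cinner_self)
    have f: "f j \<gamma> = a j \<gamma> *\<^sub>C e + g j \<gamma>" for j \<gamma> by (simp add: g_def)
    have ge: "cinner e (g j \<gamma>) = 0" for j \<gamma>
    proof -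
      have "cinner (g j \<gamma>) e = 0" by (simp add: g_def cinner_diff_left cinner_scaleC_left ee a_def)
      then show ?thesis by (metis cinner_commute complex_cnj_zero)
    qed
    have g0: "g j0 \<gamma>0 = 0"
      using 0 by (simp add: g_def a_def e_def cinner_scaleR_right cinner_self power2_eq_square)
        (simp add: scaleC_of_real)
    have "card {(j, \<gamma>). j < m \<and> \<gamma> \<in> F \<and> g j \<gamma> \<noteq> 0} < card {(j, \<gamma>). j < m \<and> \<gamma> \<in> F \<and> f j \<gamma> \<noteq> 0}"
    proof (rule psubset_card_mono)
      show "finite {(j, \<gamma>). j < m \<and> \<gamma> \<in> F \<and> f j \<gamma> \<noteq> 0}"
        by (rule finite_subset[of _ "{..<m} \<times> F"]) (use F in auto)
      have "g j \<gamma> = 0" if "f j \<gamma> = 0" for j \<gamma> using that by (simp add: g_def a_def)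
      then show "{(j, \<gamma>). j < m \<and> \<gamma> \<in> F \<and> g j \<gamma> \<noteq> 0} \<subset> {(j, \<gamma>). j < m \<and> \<gamma> \<in> F \<and> f j \<gamma> \<noteq> 0}"
        using 0 g0 by blast
    qed
    note IH = less[OF this]
    \<comment> \<open>The coefficients along e are the scalar vectors to which hypothesis
      \<open>A\<close> applies.\<close>
    define x where "x j = (\<Sum>\<gamma>\<in>F. a j \<gamma> *\<^sub>C ell2_basis \<gamma>)" for j
    have nx: "(norm (x j))\<^sup>2 = (\<Sum>\<gamma>\<in>F. (cmod (a j \<gamma>))\<^sup>2)" for j
      using norm_sum_basis_tensor[OF F, of "a j"] by (simp add: x_def scalar_tensor)
    define u where "u i = (\<Sum>j<m. A i j (x j))" for i
    define W where "W i = (\<Sum>j<m. \<Sum>\<gamma>\<in>F. ell2_tensor (A i j (ell2_basis \<gamma>)) (g j \<gamma>))" for i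
    have split: "(\<Sum>j<m. \<Sum>\<gamma>\<in>F. ell2_tensor (A i j (ell2_basis \<gamma>)) (f j \<gamma>)) = ell2_tensor (u i) e + W i"
      if "i < m" for i
    proof -
      have "ell2_tensor (u i) e = (\<Sum>j<m. \<Sum>\<gamma>\<in>F. ell2_tensor (A i j (ell2_basis \<gamma>)) (a j \<gamma> *\<^sub>C e))"
        unfolding u_def x_def ell2_tensor_sum_left blinfun.sum_right
        by (intro sum.cong refl)
          (use that in \<open>simp add: clinear_opD[OF lin] ell2_tensor_scaleC_left ell2_tensor_scaleC_right\<close>)
      then show ?thesis
        by (simp add: W_def f[symmetric] ell2_tensor_add_right[symmetric] flip: sum.distrib)
    qed
    have orth: "cinner (ell2_tensor (u i) e) (W i) = 0" for i
      unfolding W_def cinner_sum_right by (simp add: cinner_ell2_tensor ge)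
    have "(\<Sum>i<m. (norm (\<Sum>j<m. \<Sum>\<gamma>\<in>F. ell2_tensor (A i j (ell2_basis \<gamma>)) (f j \<gamma>)))\<^sup>2)
        = (\<Sum>i<m. (norm (u i))\<^sup>2) + (\<Sum>i<m. (norm (W i))\<^sup>2)"
      unfolding sum.distrib[symmetric]
      by (intro sum.cong refl) (simp add: split norm_add_orthogonal[OF orth] norm_ell2_tensor e)
    also have "\<dots> \<le> C * (\<Sum>j<m. (norm (x j))\<^sup>2) + C * (\<Sum>j<m. \<Sum>\<gamma>\<in>F. (norm (g j \<gamma>))\<^sup>2)"
      using A[of x] IH unfolding u_def W_def by (rule add_mono)
    also have "\<dots> = C * (\<Sum>j<m. \<Sum>\<gamma>\<in>F. (norm (f j \<gamma>))\<^sup>2)"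
    proof -
      have "(norm (f j \<gamma>))\<^sup>2 = (cmod (a j \<gamma>))\<^sup>2 + (norm (g j \<gamma>))\<^sup>2" for j \<gamma>
        using norm_add_orthogonal[of "a j \<gamma> *\<^sub>C e" "g j \<gamma>"] ge
        by (simp add: f[symmetric] norm_scaleC e cinner_scaleC_left)
      then show ?thesis by (simp add: nx sum.distrib distrib_left)
    qed
    finally show ?thesis .
  qed
qed

text \<open>A scalar vector with the same norms, so that \<open>ell2_product_summable\<close> can
  pair a scalar matrix row with a vector-valued family.\<close>

lift_definition ell2_norms :: "('i, 'h::complex_hilbert) ell2 \<Rightarrow> ('i, complex) ell2"
  is "\<lambda>f i. of_real (norm (f i))" by simp

text \<open>Multiplication by the matrix of A in the standard basis, on the full vector-valued
  space. On \<open>ell2_on\<close> F D it will turn out to be \<open>tensor_id\<close>, without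
  reference to D.\<close>

definition ampliation ::
  "(('i, complex) ell2 \<Rightarrow>\<^sub>L ('i, complex) ell2) \<Rightarrow> ('i, 'h::complex_hilbert) ell2 \<Rightarrow>\<^sub>L ('i, 'h) ell2" where
  "ampliation A = Blinfun (\<lambda>f. Abs_ell2 (\<lambda>i. \<Sum>\<^sub>\<infinity>\<gamma>. ell2_nth (A (ell2_basis \<gamma>)) i *\<^sub>C ell2_nth f \<gamma>))"

text \<open>Row \<open>i\<close> of the matrix of \<open>A\<close> is square-summable, being the conjugate of \<open>A\<^sup>*\<close> applied to a basis vector.\<close>

lemma ampliation_row_summable:
  fixes f :: "('i, 'h::complex_hilbert) ell2"
  assumes "clinear_op A"
  shows "(\<lambda>\<gamma>. ell2_nth (A (ell2_basis \<gamma>)) i *\<^sub>C ell2_nth f \<gamma>) summable_on UNIV"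
proof (rule abs_summable_summable)
  have "ell2_nth (A (ell2_basis \<gamma>)) i = cnj (ell2_nth (cadj A (ell2_basis i)) \<gamma>)" for \<gamma>
    by (simp flip: cinner_ell2_basis_right[of _ i] cinner_ell2_basis_left add: cinner_cadj_right[OF assms])
  then show "(\<lambda>\<gamma>. norm (ell2_nth (A (ell2_basis \<gamma>)) i *\<^sub>C ell2_nth f \<gamma>)) summable_on UNIV"
    using ell2_product_summable[of "cadj A (ell2_basis i)" "ell2_norms f"]
    by (simp add: norm_scaleC ell2_norms.rep_eq)
qed

lemma ampliation_props:
  fixes f :: "('i, 'h::complex_hilbert) ell2"
  assumes A: "clinear_op A"
  shows ell2_nth_ampliation:
      "ell2_nth (ampliation A f) i = (\<Sum>\<^sub>\<infinity>\<gamma>. ell2_nth (A (ell2_basis \<gamma>)) i *\<^sub>C ell2_nth f \<gamma>)"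
    and clinear_ampliation: "clinear_op (ampliation A :: ('i, 'h) ell2 \<Rightarrow>\<^sub>L _)"
proof -
  let ?g = "\<lambda>(f :: ('i, 'h) ell2) i. \<Sum>\<^sub>\<infinity>\<gamma>. ell2_nth (A (ell2_basis \<gamma>)) i *\<^sub>C ell2_nth f \<gamma>"
  note summ = ampliation_row_summable[OF A]
  \<comment> \<open>Two truncations: the output to finitely many entries G, the argument to a finite
    F. Each row converges as F grows, so the bound for finitely supported arguments passes to the
    limit.\<close>
  have bd: "(\<Sum>i\<in>G. (norm (?g f i))\<^sup>2) \<le> (norm A)\<^sup>2 * (norm f)\<^sup>2" if G: "finite G" for f G
  proof (rule tendsto_upperbound)
    show "((\<lambda>F. \<Sum>i\<in>G. (norm (\<Sum>\<gamma>\<in>F. ell2_nth (A (ell2_basis \<gamma>)) i *\<^sub>C ell2_nth f \<gamma>))\<^sup>2)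
        \<longlongrightarrow> (\<Sum>i\<in>G. (norm (?g f i))\<^sup>2)) (finite_subsets_at_top UNIV)"
      by (intro tendsto_intros) (use has_sum_infsum[OF summ] in \<open>simp add: has_sum_def\<close>)
    have "(\<Sum>i\<in>G. (norm (\<Sum>\<gamma>\<in>F. ell2_nth (A (ell2_basis \<gamma>)) i *\<^sub>C ell2_nth f \<gamma>))\<^sup>2)
        \<le> (norm A)\<^sup>2 * (norm f)\<^sup>2" if F: "finite F" for F
    proof -
      have "(\<Sum>i\<in>G. (norm (\<Sum>\<gamma>\<in>F. ell2_nth (A (ell2_basis \<gamma>)) i *\<^sub>C ell2_nth f \<gamma>))\<^sup>2)
        \<le> (norm (\<Sum>\<gamma>\<in>F. ell2_tensor (A (ell2_basis \<gamma>)) (ell2_nth f \<gamma>)))\<^sup>2"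
        using sum_le_norm_ell2[OF G, of "\<Sum>\<gamma>\<in>F. ell2_tensor (A (ell2_basis \<gamma>)) (ell2_nth f \<gamma>)"] by simp
      also have "\<dots> \<le> (norm A)\<^sup>2 * (\<Sum>\<gamma>\<in>F. (norm (ell2_nth f \<gamma>))\<^sup>2)"
        using ampliation_finite_bound[of 1 "\<lambda>_ _. A" "(norm A)\<^sup>2" F "\<lambda>_. ell2_nth f"] F A
        by (simp add: norm_blinfun power_mono flip: power_mult_distrib)
      also have "\<dots> \<le> (norm A)\<^sup>2 * (norm f)\<^sup>2"
        by (intro mult_left_mono sum_le_norm_ell2 F) simp
      finally show ?thesis .
    qed
    then show "\<forall>\<^sub>F F in finite_subsets_at_top UNIV.
        (\<Sum>i\<in>G. (norm (\<Sum>\<gamma>\<in>F. ell2_nth (A (ell2_basis \<gamma>)) i *\<^sub>C ell2_nth f \<gamma>))\<^sup>2) \<le> (norm A)\<^sup>2 * (norm f)\<^sup>2"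
      by (simp add: eventually_finite_subsets_at_top_weakI)
  qed simp
  have nth: "ell2_nth (Abs_ell2 (?g f)) = ?g f" for f by (rule ell2_nth_Abs_bounded(1)[OF bd])
  have nrm: "norm (Abs_ell2 (?g f)) \<le> norm f * norm A" for f
    using ell2_nth_Abs_bounded(2)[OF bd, of f]
    by (simp add: power2_le_iff_abs_le mult.commute flip: power_mult_distrib)
  have scale: "Abs_ell2 (?g (c *\<^sub>C f)) = c *\<^sub>C Abs_ell2 (?g f)" for c f
  proof (rule ell2_eqI)
    fix i
    have "((\<lambda>\<gamma>. c *\<^sub>C (ell2_nth (A (ell2_basis \<gamma>)) i *\<^sub>C ell2_nth f \<gamma>)) has_sum c *\<^sub>C ?g f i) UNIV"
      by (rule has_sum_bounded_linear[OF bounded_linear_scaleC_right has_sum_infsum[OF summ], unfolded o_def])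
    then show "ell2_nth (Abs_ell2 (?g (c *\<^sub>C f))) i = ell2_nth (c *\<^sub>C Abs_ell2 (?g f)) i"
      unfolding nth[of "c *\<^sub>C f"] unfolding scaleC_ell2.rep_eq nth[of f] by (simp add: infsumI scaleC_scaleC mult.commute)
  qed
  have "bounded_linear (\<lambda>f. Abs_ell2 (?g f))"
  proof (rule bounded_linear_intro)
    show "Abs_ell2 (?g (x + y)) = Abs_ell2 (?g x) + Abs_ell2 (?g y)" for x y
    proof (rule ell2_eqI)
      fix i
      show "ell2_nth (Abs_ell2 (?g (x + y))) i = ell2_nth (Abs_ell2 (?g x) + Abs_ell2 (?g y)) i"
        unfolding nth[of "x + y"] unfolding plus_ell2.rep_eq nth[of x] nth[of y]
        by (simp add: scaleC_add_right infsum_add[OF summ summ])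
    qed
    show "Abs_ell2 (?g (r *\<^sub>R x)) = r *\<^sub>R Abs_ell2 (?g x)" for r x
      using scale[of "of_real r" x] by (simp add: scaleC_of_real)
  qed (rule nrm)
  then have S: "blinfun_apply (ampliation A) = (\<lambda>f. Abs_ell2 (?g f))"
    unfolding ampliation_def by (rule bounded_linear_Blinfun_apply)
  show "ell2_nth (ampliation A f) i = ?g f i" by (simp add: S nth)
  show "clinear_op (ampliation A :: ('i, 'h) ell2 \<Rightarrow>\<^sub>L _)"
    unfolding clinear_op_def S using scale by blast
qed

lemma ampliation_tensor:
  assumes A: "clinear_op A"
  shows "ampliation A (ell2_tensor u e) = ell2_tensor (A u) e"
proof (rule ell2_eqI)
  fix i
  have "((\<lambda>\<gamma>. ell2_nth (ell2_nth u \<gamma> *\<^sub>C A (ell2_basis \<gamma>)) i *\<^sub>C e) has_sum ell2_nth (A u) i *\<^sub>C e) UNIV"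
    using has_sum_bounded_linear[OF bounded_linear_compose[OF bounded_linear_scaleC_left bounded_linear_ell2_nth]
        blinfun_ell2_has_sum[OF A, of u]] by (simp add: o_def)
  then show "ell2_nth (ampliation A (ell2_tensor u e)) i = ell2_nth (ell2_tensor (A u) e) i"
    by (simp add: ell2_nth_ampliation[OF A] infsumI scaleC_scaleC scaleC_complex_def mult.commute)
qed

lemma ampliation_has_sum:
  assumes A: "clinear_op A"
  shows "((\<lambda>\<gamma>. ell2_tensor (A (ell2_basis \<gamma>)) (ell2_nth f \<gamma>)) has_sum ampliation A f) UNIV"
  using has_sum_bounded_linear[OF blinfun.bounded_linear_right ell2_has_sum_UNIV[of f], of "ampliation A"]
  by (simp add: o_def ampliation_tensor[OF A])

text \<open>The constant is the one of the scalar matrix. This is the source of complete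
  contractivity, and its 1 by 1 case bounds the operators phi(rT) by A.\<close>

lemma ampliation_matrix_bound:
  fixes A :: "nat \<Rightarrow> nat \<Rightarrow> ('i, complex) ell2 \<Rightarrow>\<^sub>L ('i, complex) ell2"
    and f :: "nat \<Rightarrow> ('i, 'h::complex_hilbert) ell2"
  assumes lin: "\<And>i j. i < m \<Longrightarrow> j < m \<Longrightarrow> clinear_op (A i j)"
    and A: "\<And>x. (\<Sum>i<m. (norm (\<Sum>j<m. A i j (x j)))\<^sup>2) \<le> C * (\<Sum>j<m. (norm (x j))\<^sup>2)"
  shows "(\<Sum>i<m. (norm (\<Sum>j<m. ampliation (A i j) (f j)))\<^sup>2) \<le> C * (\<Sum>j<m. (norm (f j))\<^sup>2)"
proof (rule tendsto_le)
  let ?N = "finite_subsets_at_top UNIV :: 'i set filter"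
  show "((\<lambda>F. \<Sum>i<m. (norm (\<Sum>j<m. \<Sum>\<gamma>\<in>F. ell2_tensor (A i j (ell2_basis \<gamma>)) (ell2_nth (f j) \<gamma>)))\<^sup>2)
      \<longlongrightarrow> (\<Sum>i<m. (norm (\<Sum>j<m. ampliation (A i j) (f j)))\<^sup>2)) ?N"
    by (intro tendsto_intros) (use ampliation_has_sum[OF lin] in \<open>simp add: has_sum_def\<close>)
  show "((\<lambda>F. C * (\<Sum>j<m. \<Sum>\<gamma>\<in>F. (norm (ell2_nth (f j) \<gamma>))\<^sup>2)) \<longlongrightarrow> C * (\<Sum>j<m. (norm (f j))\<^sup>2)) ?N"
    by (intro tendsto_intros)
      (use has_sum_infsum[OF ell2_summable] in \<open>simp add: has_sum_def norm_ell2_sq\<close>)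
  show "\<forall>\<^sub>F F in ?N. (\<Sum>i<m. (norm (\<Sum>j<m. \<Sum>\<gamma>\<in>F. ell2_tensor (A i j (ell2_basis \<gamma>)) (ell2_nth (f j) \<gamma>)))\<^sup>2)
      \<le> C * (\<Sum>j<m. \<Sum>\<gamma>\<in>F. (norm (ell2_nth (f j) \<gamma>))\<^sup>2)"
    by (rule eventually_finite_subsets_at_top_weakI) (rule ampliation_finite_bound[OF lin A])
qed simp

text \<open>The operator described by \<open>THE\<close> is the ampliation after the projection onto
  the subspace. It is the only one: elements of the subspace are sums of basis tensors, and the
  complement is killed.\<close>

lemma tensor_id_apply:
  assumes A: "A \<in> bops (ell2_on F UNIV) (ell2_on F UNIV)" and D: "csubspace D" "closed D"
    and f: "f \<in> ell2_on F D"
  shows "tensor_id F D A f = ampliation A f"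
proof -
  let ?M = "ell2_on F D"
  have lin: "clinear_op A" using A by (simp add: bops_def)
  have M: "csubspace ?M" "closed ?M" using D by (auto intro: csubspace_ell2_on closed_ell2_on)
  obtain P where P: "clinear_op P" "\<And>x. P x \<in> ?M" "\<And>x m. m \<in> ?M \<Longrightarrow> cinner (x - P x) m = 0"
    using orthogonal_projection_exists[OF M] by blast
  have P_id: "P x = x" if "x \<in> ?M" for x
  proof -
    have "x - P x \<in> ?M" using that P(2) by (rule csubspace_diff[OF M(1)])
    then have "cinner (x - P x) (x - P x) = 0" by (rule P(3))
    then show ?thesis by (simp add: cinner_self)
  qed
  \<comment> \<open>Terms outside F vanish because A kills those basis vectors; the others are
    tensors in the closed subspace, which therefore contains the sum.\<close>
  have amp: "ampliation A x \<in> ?M" if x: "x \<in> ?M" for x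
  proof -
    have mem: "ell2_tensor (A (ell2_basis \<gamma>)) (ell2_nth x \<gamma>) \<in> ?M" for \<gamma>
    proof (cases "\<gamma> \<in> F")
      case True
      then have "ell2_nth x \<gamma> \<in> D" using x by (simp add: ell2_on_def)
      moreover have "A (ell2_basis \<gamma>) \<in> ell2_on F UNIV" using A by (simp add: bops_def)
      ultimately show ?thesis by (intro tensor_in_ell2_on D)
    next
      case False
      then have "ell2_tensor (A (ell2_basis \<gamma>)) (ell2_nth x \<gamma>) = 0"
        using bops_ell2_basis_zero[OF A] by (intro ell2_eqI) simp
      then show ?thesis using M(1) by (simp add: csubspace_def)
    qed
    show ?thesis
    proof (rule Lim_in_closed_set[OF M(2)])
      show "((\<lambda>G. \<Sum>\<gamma>\<in>G. ell2_tensor (A (ell2_basis \<gamma>)) (ell2_nth x \<gamma>)) \<longlongrightarrow> ampliation A x)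
          (finite_subsets_at_top UNIV)"
        using ampliation_has_sum[OF lin, of x] by (simp add: has_sum_def)
      show "\<forall>\<^sub>F G in finite_subsets_at_top UNIV. (\<Sum>\<gamma>\<in>G. ell2_tensor (A (ell2_basis \<gamma>)) (ell2_nth x \<gamma>)) \<in> ?M"
        by (intro always_eventually allI subspace_sum csubspace_imp_subspace M mem)
    qed simp
  qed
  have "tensor_id F D A = ampliation A o\<^sub>L P"
    unfolding tensor_id_def
  proof (rule the_equality, intro conjI ballI)
    have "P x = 0" if "\<forall>m\<in>?M. cinner x m = 0" for x
    proof -
      have "cinner x (P x) = 0" "cinner (x - P x) (P x) = 0" using that P by blast+
      then have "cinner (P x) (P x) = 0" by (simp add: cinner_diff_left)
      then show ?thesis by (simp add: cinner_self)
    qed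
    then show "ampliation A o\<^sub>L P \<in> bops ?M ?M"
      using amp P by (auto simp: bops_def intro: clinear_comp clinear_ampliation[OF lin])
    show "(ampliation A o\<^sub>L P) (ell2_tensor u e) = ell2_tensor (A u) e"
      if "u \<in> ell2_on F UNIV" "e \<in> D" for u e
      using tensor_in_ell2_on[OF that(1) D(1) that(2)] by (simp add: P_id ampliation_tensor[OF lin])
    fix X assume X: "X \<in> bops ?M ?M \<and>
      (\<forall>u\<in>ell2_on F UNIV. \<forall>e\<in>D. X (ell2_tensor u e) = ell2_tensor (A u) e)"
    have "X x = (ampliation A o\<^sub>L P) x" if x: "x \<in> ?M" for x
    proof -
      have "((\<lambda>i. X (ell2_tensor (ell2_basis i) (ell2_nth x i))) has_sum X x) F"
        using has_sum_bounded_linear[OF blinfun.bounded_linear_right ell2_has_sum[of F x]] x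
        by (simp add: ell2_on_def o_def)
      moreover have "((\<lambda>i. ampliation A (ell2_tensor (ell2_basis i) (ell2_nth x i))) has_sum ampliation A x) F"
        using has_sum_bounded_linear[OF blinfun.bounded_linear_right ell2_has_sum[of F x]] x
        by (simp add: ell2_on_def o_def)
      moreover have "X (ell2_tensor (ell2_basis i) (ell2_nth x i)) = ampliation A (ell2_tensor (ell2_basis i) (ell2_nth x i))"
        if "i \<in> F" for i
        using X x basis_in_ell2_on[OF that] that by (simp add: ampliation_tensor[OF lin] ell2_on_def)
      ultimately have "X x = ampliation A x" using has_sum_cong has_sum_unique by (metis (mono_tags, lifting))
      then show ?thesis by (simp add: P_id[OF x])
    qed
    moreover have "ampliation A o\<^sub>L P \<in> bops ?M ?M" by fact
    ultimately show "X = ampliation A o\<^sub>L P" using X by (intro bops_eqI[OF M]) auto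
  qed
  then show ?thesis by (simp add: P_id[OF f])
qed

lemma subspace_id_eqI:
  assumes "csubspace M" "closed M" "P \<in> bops M M" "\<And>x. x \<in> M \<Longrightarrow> blinfun_apply P x = x"
  shows "subspace_id M = P"
  unfolding subspace_id_def
  by (rule the_equality) (use assms in \<open>auto intro: bops_eqI\<close>)


section \<open>Words and twisted tuples\<close>

lemma word_op_Nil [simp]: "word_op X [] = id_blinfun"
  and word_op_Cons [simp]: "word_op X (s # \<alpha>) = X s o\<^sub>L word_op X \<alpha>"
  by (simp_all add: word_op_def)

lemma word_op_append: "word_op X (\<alpha> @ \<beta>) = word_op X \<alpha> o\<^sub>L word_op X \<beta>"
  by (induction \<alpha>) (auto intro!: blinfun_eqI)

lemma word_op_scaleR: "word_op (\<lambda>s. r *\<^sub>R X s) \<alpha> = r ^ length \<alpha> *\<^sub>R word_op X \<alpha>"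
  by (induction \<alpha>) (auto intro!: blinfun_eqI simp: blinfun.scaleR_left blinfun.scaleR_right)

lemma clinear_word_op: "(\<And>s. s \<in> set \<alpha> \<Longrightarrow> clinear_op (X s)) \<Longrightarrow> clinear_op (word_op X \<alpha>)"
  by (induction \<alpha>) (auto intro: clinear_comp)

lemma multiword_op_0 [simp]: "multiword_op 0 X \<beta> = id_blinfun"
  by (simp add: multiword_op_def)

lemma multiword_op_Suc:
  "multiword_op (Suc k) X \<beta> = multiword_op k X \<beta> o\<^sub>L word_op (X k) (\<beta> k)"
proof -
  have "foldr (\<lambda>i Y. word_op (X i) (\<beta> i) o\<^sub>L Y) is Z = foldr (\<lambda>i Y. word_op (X i) (\<beta> i) o\<^sub>L Y) is id_blinfun o\<^sub>L Z"
    for "is" Z by (induction "is") (auto intro!: blinfun_eqI)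
  moreover have "word_op (X k) (\<beta> k) o\<^sub>L id_blinfun = word_op (X k) (\<beta> k)" by (rule blinfun_eqI) simp
  ultimately show ?thesis by (simp add: multiword_op_def)
qed

lemma multiword_op_dilate:
  "multiword_op k (dilate r X) \<beta> = r ^ multilength k \<beta> *\<^sub>R multiword_op k X \<beta>"
proof (induction k)
  case (Suc k)
  have "word_op (dilate r X k) (\<beta> k) = r ^ length (\<beta> k) *\<^sub>R word_op (X k) (\<beta> k)"
    unfolding dilate_def by (rule word_op_scaleR)
  then show ?case
    by (intro blinfun_eqI)
      (simp add: multiword_op_Suc Suc multilength_def blinfun.scaleR_left blinfun.scaleR_right power_add mult.commute)
qed (simp add: multilength_def)

text \<open>The vector to which the square root of the defect is applied in coordinate beta of the
  Berezin kernel.\<close>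

definition adj_word :: "nat \<Rightarrow> 'h::complex_hilbert op_tuple \<Rightarrow> multiword \<Rightarrow> 'h \<Rightarrow> 'h" where
  "adj_word k X \<beta> h = fold (\<lambda>i g. cadj (word_op (X i) (\<beta> i)) g) [0..<k] h"

lemma adj_word_0 [simp]: "adj_word 0 X \<beta> h = h"
  and adj_word_Suc: "adj_word (Suc k) X \<beta> h = cadj (word_op (X k) (\<beta> k)) (adj_word k X \<beta> h)"
  by (simp_all add: adj_word_def)

lemma adj_word_cong: "(\<And>i. i < k \<Longrightarrow> \<beta> i = \<gamma> i) \<Longrightarrow> adj_word k X \<beta> h = adj_word k X \<gamma> h"
  by (induction k) (auto simp: adj_word_Suc)

definition cat :: "multiword \<Rightarrow> multiword \<Rightarrow> multiword" where
  "cat \<beta> \<gamma> = (\<lambda>i. \<beta> i @ \<gamma> i)"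

definition word_twist :: "(nat \<Rightarrow> nat \<Rightarrow> complex) \<Rightarrow> nat list \<Rightarrow> nat list \<Rightarrow> complex" where
  "word_twist l \<alpha> \<gamma> = prod_list (map (\<lambda>s. prod_list (map (l s) \<gamma>)) \<alpha>)"

text \<open>The scalar in \<open>\<beta> \<cdot> \<gamma>\<close>: letters of \<open>\<beta> b\<close> move to the right past those of \<open>\<gamma> a\<close>, \<open>a < b\<close>.\<close>

definition twist ::
  "nat \<Rightarrow> (nat \<Rightarrow> nat \<Rightarrow> nat \<Rightarrow> nat \<Rightarrow> complex) \<Rightarrow> multiword \<Rightarrow> multiword \<Rightarrow> complex" where
  "twist k lam \<beta> \<gamma> = (\<Prod>b<k. \<Prod>a<b. word_twist (lam b a) (\<beta> b) (\<gamma> a))"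

lemma word_twist_simps [simp]:
  "word_twist l [] \<gamma> = 1" "word_twist l \<alpha> [] = 1"
  "word_twist l (s # \<alpha>) \<gamma> = prod_list (map (l s) \<gamma>) * word_twist l \<alpha> \<gamma>"
  by (induction \<alpha>) (simp_all add: word_twist_def)

lemma word_twist_append_left: "word_twist l (\<alpha> @ \<alpha>') \<gamma> = word_twist l \<alpha> \<gamma> * word_twist l \<alpha>' \<gamma>"
  by (simp add: word_twist_def)

lemma word_twist_append_right: "word_twist l \<alpha> (\<gamma> @ \<gamma>') = word_twist l \<alpha> \<gamma> * word_twist l \<alpha> \<gamma>'"
  by (induction \<alpha>) simp_all

text \<open>Together with \<open>twist_cat_right\<close> this makes \<open>twist\<close> a
  bicharacter for \<open>cat\<close>, so it satisfies the cocycle identity that underlies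
  \<open>hardy_algebra_mult\<close>.\<close>

lemma twist_cat_left: "twist k lam (cat \<alpha> \<beta>) \<gamma> = twist k lam \<alpha> \<gamma> * twist k lam \<beta> \<gamma>"
  by (simp add: twist_def cat_def word_twist_append_left prod.distrib)

lemma twist_cat_right: "twist k lam \<alpha> (cat \<beta> \<gamma>) = twist k lam \<alpha> \<beta> * twist k lam \<alpha> \<gamma>"
  by (simp add: twist_def cat_def word_twist_append_right prod.distrib)

lemma cmod_prod_list_1: "(\<And>x. x \<in> set xs \<Longrightarrow> cmod (f x) = 1) \<Longrightarrow> cmod (prod_list (map f xs)) = 1"
  by (induction xs) (auto simp: norm_mult)

lemma twist_matrices_cmod:
  "twist_matrices k n lam \<Longrightarrow> i < k \<Longrightarrow> j < k \<Longrightarrow> i \<noteq> j \<Longrightarrow> s < n i \<Longrightarrow> t < n j \<Longrightarrow>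
    cmod (lam i j s t) = 1"
  unfolding twist_matrices_def by blast

lemma cat_in_multiwords: "\<beta> \<in> multiwords k n \<Longrightarrow> \<gamma> \<in> multiwords k n \<Longrightarrow> cat \<beta> \<gamma> \<in> multiwords k n"
  by (auto simp: multiwords_def cat_def)

lemma multilength_cat: "multilength k (cat \<beta> \<gamma>) = multilength k \<beta> + multilength k \<gamma>"
  by (simp add: multilength_def cat_def sum.distrib)

lemma inj_cat_left: "inj (\<lambda>\<beta>. cat \<beta> \<gamma>)"
  by (auto simp: inj_def cat_def fun_eq_iff)

definition empty_word :: multiword where "empty_word = (\<lambda>_. [])"

lemma empty_word_props [simp]:
  "empty_word \<in> multiwords k n" "cat empty_word \<gamma> = \<gamma>" "cat \<gamma> empty_word = \<gamma>"
  "twist k lam empty_word \<gamma> = 1" "twist k lam \<gamma> empty_word = 1" "multilength k empty_word = 0"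
  by (simp_all add: empty_word_def multiwords_def cat_def twist_def multilength_def)

lemma multiword_op_empty [simp]: "multiword_op k X empty_word = id_blinfun"
  by (induction k) (auto simp: multiword_op_Suc empty_word_def intro!: blinfun_eqI)

text \<open>The strict bound matches the geometric sum of Phi_i^l over l < p i. Boxes with equal
  sides exhaust the multiwords through finite sets.\<close>

definition word_box :: "nat \<Rightarrow> (nat \<Rightarrow> nat) \<Rightarrow> (nat \<Rightarrow> nat) \<Rightarrow> multiword set" where
  "word_box k n p = {\<beta> \<in> multiwords k n. \<forall>i<k. length (\<beta> i) < p i}"

lemma word_box_0: "word_box 0 n p = {empty_word}"
  by (auto simp: word_box_def multiwords_def empty_word_def)

lemma word_box_Suc:
  "bij_betw (\<lambda>(\<beta>, \<alpha>). \<beta>(k := \<alpha>)) (word_box k n p \<times> {\<alpha>. set \<alpha> \<subseteq> {..<n k} \<and> length \<alpha> < p k}) (word_box (Suc k) n p)"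
proof (rule bij_betw_byWitness[where f' = "\<lambda>\<beta>. (\<beta>(k := []), \<beta> k)"])
  show "\<forall>a\<in>word_box k n p \<times> {\<alpha>. set \<alpha> \<subseteq> {..<n k} \<and> length \<alpha> < p k}.
      (\<lambda>\<beta>. (\<beta>(k := []), \<beta> k)) (case a of (\<beta>, \<alpha>) \<Rightarrow> \<beta>(k := \<alpha>)) = a"
    by (auto simp: word_box_def multiwords_def)
qed (auto simp: word_box_def multiwords_def less_Suc_eq subset_iff split: if_splits)

lemma finite_word_box: "finite (word_box k n p)"
proof (induction k)
  case (Suc k)
  have "finite {\<alpha>. set \<alpha> \<subseteq> {..<n k} \<and> length \<alpha> < p k}"
    by (rule finite_subset[OF _ finite_lists_length_le[of "{..<n k}" "p k"]]) auto
  then show ?case using Suc bij_betw_finite[OF word_box_Suc] by blast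
qed (simp add: word_box_0)

lemma finite_multiwords_subset_word_box:
  assumes "finite F" "F \<subseteq> multiwords k n"
  shows "\<exists>m. F \<subseteq> word_box k n (\<lambda>_. m)"
proof -
  have le: "length (\<beta> i) \<le> multilength k \<beta>" if "i < k" for \<beta> i
    unfolding multilength_def using that by (intro member_le_sum) auto
  obtain m where m: "\<And>\<beta>. \<beta> \<in> F \<Longrightarrow> multilength k \<beta> < m"
    using finite_nat_set_iff_bounded[of "multilength k ` F"] assms(1) by auto
  have "F \<subseteq> word_box k n (\<lambda>_. m)"
    using assms(2) m le by (fastforce simp: word_box_def intro: le_less_trans)
  then show ?thesis by blast
qed

lemma finite_multilength_eq: "finite {\<beta>. \<beta> \<in> multiwords k n \<and> multilength k \<beta> = p}"
proof (rule finite_subset[OF _ finite_word_box[of k n "\<lambda>_. Suc p"]])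
  have le: "length (\<beta> i) \<le> multilength k \<beta>" if "i < k" for \<beta> i
    unfolding multilength_def using that by (intro member_le_sum) auto
  then show "{\<beta>. \<beta> \<in> multiwords k n \<and> multilength k \<beta> = p} \<subseteq> word_box k n (\<lambda>_. Suc p)"
    by (auto simp: word_box_def less_Suc_eq_le)
qed


subsection \<open>Quadratic forms of the completely positive maps\<close>

text \<open>The maps \<open>\<Phi>\<close> are studied through their action \<open>q \<mapsto> \<Sum>\<^sub>s q (X\<^sub>s\<^sup>* h)\<close> on quadratic forms, which commute for a
  twisted tuple since \<open>q\<close> does not see unimodular factors.\<close>

definition cp_form :: "nat \<Rightarrow> (nat \<Rightarrow> 'h::complex_hilbert \<Rightarrow>\<^sub>L 'h) \<Rightarrow> ('h \<Rightarrow> real) \<Rightarrow> 'h \<Rightarrow> real" where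
  "cp_form m X q = (\<lambda>h. \<Sum>s<m. q (cadj (X s) h))"

definition op_form :: "('h::complex_hilbert \<Rightarrow>\<^sub>L 'h) \<Rightarrow> 'h \<Rightarrow> real" where
  "op_form Y = (\<lambda>h. Re (cinner (Y h) h))"

definition homogeneous2 :: "('h::complex_hilbert \<Rightarrow> real) \<Rightarrow> bool" where
  "homogeneous2 q \<longleftrightarrow> (\<forall>c h. q (c *\<^sub>C h) = (cmod c)\<^sup>2 * q h)"

lemma cp_form_pow_diff:
  "(cp_form m X ^^ l) (\<lambda>h. a h - b h) = (\<lambda>h. (cp_form m X ^^ l) a h - (cp_form m X ^^ l) b h)"
  by (induction l) (simp_all add: cp_form_def sum_subtractf)

lemma cp_form_pow_sum:
  "(cp_form m X ^^ l) (\<lambda>h. \<Sum>x\<in>A. f x h) = (\<lambda>h. \<Sum>x\<in>A. (cp_form m X ^^ l) (f x) h)"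
  by (induction l) (simp_all add: cp_form_def sum.swap[of _ A])

lemma cp_form_pow_mono:
  "(\<And>h. a h \<le> b h) \<Longrightarrow> (cp_form m X ^^ l) a h \<le> (cp_form m X ^^ l) b h"
  by (induction l arbitrary: h) (auto simp: cp_form_def intro!: sum_mono)

lemma cp_form_pow_cmult:
  "(cp_form m X ^^ l) (\<lambda>h. c * a h) = (\<lambda>h. c * (cp_form m X ^^ l) a h)"
  by (induction l) (simp_all add: cp_form_def sum_distrib_left)

lemma homogeneous2_norm: "homogeneous2 (\<lambda>h. (norm h)\<^sup>2)"
  by (simp add: homogeneous2_def norm_scaleC power_mult_distrib)

lemma homogeneous2_diff: "homogeneous2 a \<Longrightarrow> homogeneous2 b \<Longrightarrow> homogeneous2 (\<lambda>h. a h - b h)"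
  by (simp add: homogeneous2_def right_diff_distrib)

lemma homogeneous2_sum: "(\<And>x. x \<in> A \<Longrightarrow> homogeneous2 (f x)) \<Longrightarrow> homogeneous2 (\<lambda>h. \<Sum>x\<in>A. f x h)"
  by (simp add: homogeneous2_def sum_distrib_left)

lemma homogeneous2_cp_form:
  assumes "\<And>s. s < m \<Longrightarrow> clinear_op (X s)" "homogeneous2 q"
  shows "homogeneous2 (cp_form m X q)"
  unfolding cp_form_def
  by (rule homogeneous2_sum) (use assms in \<open>auto simp: homogeneous2_def clinear_opD[OF clinear_cadj]\<close>)

lemma homogeneous2_cp_form_pow:
  assumes "\<And>s. s < m \<Longrightarrow> clinear_op (X s)" "homogeneous2 q"
  shows "homogeneous2 ((cp_form m X ^^ l) q)"
  by (induction l) (simp_all add: assms homogeneous2_cp_form)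

lemma op_form_cp_map:
  assumes "\<And>s. s < m \<Longrightarrow> clinear_op (X s)"
  shows "op_form (cp_map m X Y) = cp_form m X (op_form Y)"
proof
  fix h
  have "cinner (cp_map m X Y h) h = (\<Sum>s<m. cinner (Y (cadj (X s) h)) (cadj (X s) h))"
    unfolding cp_map_def blinfun.sum_left cinner_sum_left
    by (intro sum.cong refl) (use assms in \<open>simp add: cinner_cadj_right\<close>)
  then show "op_form (cp_map m X Y) h = cp_form m X (op_form Y) h"
    by (simp add: op_form_def cp_form_def)
qed

lemma op_form_cp_map_pow:
  assumes "\<And>s. s < m \<Longrightarrow> clinear_op (X s)"
  shows "op_form ((cp_map m X ^^ l) Y) = (cp_form m X ^^ l) (op_form Y)"
  by (induction l) (simp_all add: op_form_cp_map assms)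

lemma cp_form_pow_words:
  assumes "\<And>s. s < m \<Longrightarrow> clinear_op (X s)"
  shows "(cp_form m X ^^ l) q h = (\<Sum>\<alpha> | set \<alpha> \<subseteq> {..<m} \<and> length \<alpha> = l. q (cadj (word_op X \<alpha>) h))"
proof (induction l arbitrary: h)
  case 0
  have "{\<alpha>. set \<alpha> \<subseteq> {..<m} \<and> length \<alpha> = 0} = {[]}" by auto
  then show ?case by simp
next
  case (Suc l)
  have bij: "bij_betw (\<lambda>(s, \<alpha>). s # \<alpha>) ({..<m} \<times> {\<alpha>. set \<alpha> \<subseteq> {..<m} \<and> length \<alpha> = l})
      {\<alpha>. set \<alpha> \<subseteq> {..<m} \<and> length \<alpha> = Suc l}"
    by (rule bij_betw_byWitness[where f' = "\<lambda>\<alpha>. (hd \<alpha>, tl \<alpha>)"])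
      (auto simp: length_Suc_conv)
  have "(cp_form m X ^^ Suc l) q h
      = (\<Sum>s<m. \<Sum>\<alpha> | set \<alpha> \<subseteq> {..<m} \<and> length \<alpha> = l. q (cadj (word_op X \<alpha>) (cadj (X s) h)))"
    by (simp add: cp_form_def[of m X "(cp_form m X ^^ l) q"] Suc)
  also have "\<dots> = (\<Sum>s<m. \<Sum>\<alpha> | set \<alpha> \<subseteq> {..<m} \<and> length \<alpha> = l. q (cadj (word_op X (s # \<alpha>)) h))"
    by (intro sum.cong refl)
      (auto simp: cadj_comp_apply assms clinear_word_op subset_iff)
  also have "\<dots> = (\<Sum>(s, \<alpha>)\<in>{..<m} \<times> {\<alpha>. set \<alpha> \<subseteq> {..<m} \<and> length \<alpha> = l}. q (cadj (word_op X (s # \<alpha>)) h))"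
    by (rule sum.cartesian_product)
  also have "\<dots> = (\<Sum>\<alpha> | set \<alpha> \<subseteq> {..<m} \<and> length \<alpha> = Suc l. q (cadj (word_op X \<alpha>) h))"
    by (subst sum.reindex_bij_betw[OF bij, symmetric]) (simp add: case_prod_beta)
  finally show ?case .
qed

lemma defect_eq_defect_pow: "defect k n X = defect_pow k n (\<lambda>_. 1) X"
  by (simp add: defect_def defect_pow_def)

text \<open>The algebraic part, shared by T and its dilations; contractivity enters in a later
  context.\<close>

locale twisted_tuple =
  fixes k :: nat and n :: "nat \<Rightarrow> nat" and lam :: "nat \<Rightarrow> nat \<Rightarrow> nat \<Rightarrow> nat \<Rightarrow> complex"
    and X :: "'h::complex_hilbert op_tuple"
  assumes unimodular: "twist_matrices k n lam"
    and lin: "\<And>i s. i < k \<Longrightarrow> s < n i \<Longrightarrow> clinear_op (X i s)"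
    and comm: "\<And>i j s t. i < k \<Longrightarrow> j < k \<Longrightarrow> i \<noteq> j \<Longrightarrow> s < n i \<Longrightarrow> t < n j \<Longrightarrow>
      X i s o\<^sub>L X j t = scale_op (lam i j s t) (X j t o\<^sub>L X i s)"
begin

abbreviation "Phi i \<equiv> cp_form (n i) (X i)"

definition defect_form :: "(nat \<Rightarrow> nat) \<Rightarrow> nat \<Rightarrow> ('h \<Rightarrow> real) \<Rightarrow> 'h \<Rightarrow> real" where
  "defect_form p i q = (\<lambda>h. q h - (Phi i ^^ p i) q h)"

definition sum_form :: "(nat \<Rightarrow> nat) \<Rightarrow> nat \<Rightarrow> ('h \<Rightarrow> real) \<Rightarrow> 'h \<Rightarrow> real" where
  "sum_form p i q = (\<lambda>h. \<Sum>l<p i. (Phi i ^^ l) q h)"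

lemma clinear_word: "i < k \<Longrightarrow> set \<alpha> \<subseteq> {..<n i} \<Longrightarrow> clinear_op (word_op (X i) \<alpha>)"
  by (rule clinear_word_op) (auto intro: lin)

lemma clinear_multiword_le: "\<beta> \<in> multiwords k n \<Longrightarrow> j \<le> k \<Longrightarrow> clinear_op (multiword_op j X \<beta>)"
  by (induction j) (auto simp: multiword_op_Suc multiwords_def subset_iff intro!: clinear_comp clinear_word)

lemma clinear_multiword: "\<beta> \<in> multiwords k n \<Longrightarrow> clinear_op (multiword_op k X \<beta>)"
  by (rule clinear_multiword_le) auto

lemma adj_word_eq_cadj_le:
  "\<beta> \<in> multiwords k n \<Longrightarrow> j \<le> k \<Longrightarrow> adj_word j X \<beta> h = cadj (multiword_op j X \<beta>) h"
proof (induction j)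
  case (Suc j)
  have "clinear_op (word_op (X j) (\<beta> j))"
    using Suc.prems by (intro clinear_word) (auto simp: multiwords_def)
  then show ?case
    using Suc by (simp add: adj_word_Suc multiword_op_Suc cadj_comp_apply clinear_multiword_le)
qed simp

lemma adj_word_eq_cadj: "\<beta> \<in> multiwords k n \<Longrightarrow> adj_word k X \<beta> h = cadj (multiword_op k X \<beta>) h"
  by (rule adj_word_eq_cadj_le) auto

lemma Phi_commute:
  assumes ij: "i < k" "j < k" "i \<noteq> j" and q: "homogeneous2 q"
  shows "Phi i (Phi j q) = Phi j (Phi i q)"
proof
  fix h
  have "q (cadj (X j t) (cadj (X i s) h)) = q (cadj (X i s) (cadj (X j t) h))"
    if "s < n i" "t < n j" for s t
  proof -
    note l = lin[OF ij(1) that(1)] lin[OF ij(2) that(2)]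
    have "cadj (X j t) (cadj (X i s) h) = cadj (X i s o\<^sub>L X j t) h"
      by (simp add: cadj_comp_apply l)
    also have "\<dots> = cnj (lam i j s t) *\<^sub>C cadj (X i s) (cadj (X j t) h)"
      by (simp only: comm[OF ij that] cadj_scale_op_apply[OF clinear_comp[OF l(2,1)]]
          cadj_comp_apply[OF l(2,1)])
    finally show ?thesis
      using q twist_matrices_cmod[OF unimodular ij that] by (simp add: homogeneous2_def)
  qed
  then have "(\<Sum>s<n i. \<Sum>t<n j. q (cadj (X j t) (cadj (X i s) h)))
      = (\<Sum>s<n i. \<Sum>t<n j. q (cadj (X i s) (cadj (X j t) h)))"
    by (intro sum.cong refl) auto
  then show "Phi i (Phi j q) h = Phi j (Phi i q) h"
    unfolding cp_form_def by (simp add: sum.swap[of _ "{..<n i}"])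
qed

lemma homogeneous2_Phi_pow: "i < k \<Longrightarrow> homogeneous2 q \<Longrightarrow> homogeneous2 ((Phi i ^^ l) q)"
  by (rule homogeneous2_cp_form_pow) (auto intro: lin)

lemma Phi_pow_commute:
  assumes ij: "i < k" "j < k" "i \<noteq> j" and q: "homogeneous2 q"
  shows "(Phi i ^^ l) ((Phi j ^^ m) q) = (Phi j ^^ m) ((Phi i ^^ l) q)"
proof -
  have 1: "Phi i ((Phi j ^^ m) q) = (Phi j ^^ m) (Phi i q)" if "homogeneous2 q" for q
  proof (induction m)
    case (Suc m)
    then show ?case using Phi_commute[OF ij homogeneous2_Phi_pow[OF ij(2) that]] by simp
  qed simp
  show ?thesis
  proof (induction l)
    case (Suc l)
    then show ?case using 1[OF homogeneous2_Phi_pow[OF ij(1) q]] by simp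
  qed simp
qed

lemma homogeneous2_sum_form: "i < k \<Longrightarrow> homogeneous2 q \<Longrightarrow> homogeneous2 (sum_form p i q)"
  unfolding sum_form_def by (intro homogeneous2_sum homogeneous2_Phi_pow)

lemma homogeneous2_foldr_sum_form:
  "set js \<subseteq> {..<k} \<Longrightarrow> homogeneous2 q \<Longrightarrow> homogeneous2 (foldr (sum_form p) js q)"
  by (induction js) (auto intro: homogeneous2_sum_form)

lemma foldr_sum_form_diff:
  "foldr (sum_form p) js (\<lambda>h. a h - b h) = (\<lambda>h. foldr (sum_form p) js a h - foldr (sum_form p) js b h)"
  by (induction js) (simp_all add: sum_form_def cp_form_pow_diff sum_subtractf)

lemma Phi_pow_foldr_sum_form:
  assumes "j < k" "set js \<subseteq> {..<k} - {j}" "homogeneous2 q"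
  shows "(Phi j ^^ l) (foldr (sum_form p) js q) = foldr (sum_form p) js ((Phi j ^^ l) q)"
  using assms(2)
proof (induction js)
  case (Cons i js)
  then have i: "i < k" "i \<noteq> j" and js: "set js \<subseteq> {..<k}" by auto
  have "(Phi j ^^ l) (sum_form p i (foldr (sum_form p) js q))
      = sum_form p i ((Phi j ^^ l) (foldr (sum_form p) js q))"
    unfolding sum_form_def[of p i] cp_form_pow_sum
    using Phi_pow_commute[OF assms(1) i(1) i(2)[symmetric] homogeneous2_foldr_sum_form[OF js assms(3)]] by simp
  then show ?case using Cons by simp
qed simp

text \<open>Telescoping: (id + Phi + ... + Phi^(p-1)) (id - Phi) = id - Phi^p.\<close>

lemma sum_form_defect_form: "sum_form p i (defect_form (\<lambda>_. 1) i q) = defect_form p i q"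
proof
  fix h
  have "sum_form p i (defect_form (\<lambda>_. 1) i q) h = (\<Sum>l<p i. (Phi i ^^ l) q h - (Phi i ^^ Suc l) q h)"
    unfolding sum_form_def defect_form_def
    by (simp add: cp_form_pow_diff funpow_swap1[of "Phi i"])
  also have "\<dots> = (Phi i ^^ 0) q h - (Phi i ^^ p i) q h"
    by (rule sum_lessThan_telescope')
  finally show "sum_form p i (defect_form (\<lambda>_. 1) i q) h = defect_form p i q h"
    by (simp add: defect_form_def)
qed

text \<open>Each factor id - Phi_j^p splits off its geometric sum. Collecting the sums on the
  outside moves powers of Phi_j past the sums of lower coordinates. Commutation is available for
  homogeneous forms, so homogeneity is carried through.\<close>

lemma fold_defect_form:
  assumes "j \<le> k" "homogeneous2 q"
  shows "homogeneous2 (fold (defect_form p) [0..<j] q) \<and>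
    fold (defect_form p) [0..<j] q = foldr (sum_form p) [0..<j] (fold (defect_form (\<lambda>_. 1)) [0..<j] q)"
  using assms(1)
proof (induction j)
  case (Suc j)
  have hom: "homogeneous2 (fold (defect_form p) [0..<i] q)" if "i \<le> k" for i p
    using that
  proof (induction i)
    case (Suc i)
    then show ?case by (auto simp: defect_form_def[of _ i] intro!: homogeneous2_diff homogeneous2_Phi_pow)
  qed (use assms in simp)
  let ?Q = "fold (defect_form (\<lambda>_. 1)) [0..<j] q"
  have "fold (defect_form p) [0..<Suc j] q = defect_form p j (foldr (sum_form p) [0..<j] ?Q)"
    using Suc by simp
  also have "\<dots> = foldr (sum_form p) [0..<j] (defect_form p j ?Q)"
    unfolding defect_form_def[of p j] foldr_sum_form_diff
    using Phi_pow_foldr_sum_form[of j "[0..<j]" ?Q "p j" p] hom[of j "\<lambda>_. 1"] Suc.prems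
    by (simp add: subset_iff)
  also have "defect_form p j ?Q = sum_form p j (defect_form (\<lambda>_. 1) j ?Q)"
    by (rule sum_form_defect_form[symmetric])
  finally show ?case using hom[OF Suc.prems, of p] by simp
qed (use assms in simp)

lemma op_form_defect_pow:
  "op_form (defect_pow k n p X) = fold (defect_form p) [0..<k] (\<lambda>h. (norm h)\<^sup>2)"
proof -
  have "op_form (fold (\<lambda>i Y. Y - (cp_map (n i) (X i) ^^ p i) Y) js Y) = fold (defect_form p) js (op_form Y)"
    if "set js \<subseteq> {..<k}" for js Y using that
  proof (induction js arbitrary: Y)
    case (Cons i js)
    have "op_form (Y - (cp_map (n i) (X i) ^^ p i) Y) = defect_form p i (op_form Y)"
      using op_form_cp_map_pow[of "n i" "X i" "p i" Y] lin Cons.prems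
      by (auto simp: defect_form_def op_form_def blinfun.diff_left cinner_diff_left fun_eq_iff)
    then show ?case using Cons by simp
  qed simp
  moreover have "op_form id_blinfun = (\<lambda>h::'h. (norm h)\<^sup>2)"
    by (simp add: op_form_def cinner_self)
  ultimately show ?thesis by (simp add: defect_pow_def lessThan_atLeast0)
qed

text \<open>Expands the product of geometric sums into words. The induction generalises
  \<open>q\<close>, because the sum over the last coordinate is absorbed into the form.\<close>

lemma word_box_sum:
  "j \<le> k \<Longrightarrow> (\<Sum>\<beta>\<in>word_box j n p. q (adj_word j X \<beta> h)) = foldr (sum_form p) [0..<j] q h"
proof (induction j arbitrary: q)
  case (Suc j)
  let ?W = "{\<alpha>. set \<alpha> \<subseteq> {..<n j} \<and> length \<alpha> < p j}"
  have W: "(\<Sum>\<alpha>\<in>?W. q (cadj (word_op (X j) \<alpha>) g)) = sum_form p j q g" for g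
  proof -
    have "?W = (\<Union>l\<in>{..<p j}. {\<alpha>. set \<alpha> \<subseteq> {..<n j} \<and> length \<alpha> = l})" by auto
    then have "(\<Sum>\<alpha>\<in>?W. q (cadj (word_op (X j) \<alpha>) g))
        = (\<Sum>l<p j. \<Sum>\<alpha> | set \<alpha> \<subseteq> {..<n j} \<and> length \<alpha> = l. q (cadj (word_op (X j) \<alpha>) g))"
      by (simp only:) (rule sum.UNION_disjoint, auto intro: finite_lists_length_eq)
    also have "\<dots> = sum_form p j q g"
      unfolding sum_form_def using Suc.prems
      by (intro sum.cong refl cp_form_pow_words[symmetric] lin) auto
    finally show ?thesis .
  qed
  have adj: "adj_word (Suc j) X (\<beta>(j := \<alpha>)) h = cadj (word_op (X j) \<alpha>) (adj_word j X \<beta> h)" for \<beta> \<alpha>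
    using adj_word_cong[of j "\<beta>(j := \<alpha>)" \<beta> X h] by (simp add: adj_word_Suc)
  have "(\<Sum>\<beta>\<in>word_box (Suc j) n p. q (adj_word (Suc j) X \<beta> h))
      = (\<Sum>(\<beta>, \<alpha>)\<in>word_box j n p \<times> ?W. q (cadj (word_op (X j) \<alpha>) (adj_word j X \<beta> h)))"
    by (subst sum.reindex_bij_betw[OF word_box_Suc, symmetric]) (simp add: case_prod_beta adj)
  also have "\<dots> = (\<Sum>\<beta>\<in>word_box j n p. sum_form p j q (adj_word j X \<beta> h))"
    by (simp add: W flip: sum.cartesian_product)
  also have "\<dots> = foldr (sum_form p) [0..<Suc j] q h"
    using Suc by simp
  finally show ?case .
qed (simp add: word_box_0)

text \<open>Used twice: with growing boxes it computes the norm of the Berezin kernel of rT, and for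
  each fixed p it shows that a vector orthogonal to the range of \<open>cadj K\<close> annihilates
  the defect form.\<close>

lemma op_form_defect_pow_eq_sum:
  "op_form (defect_pow k n p X) h = (\<Sum>\<beta>\<in>word_box k n p. op_form (defect k n X) (adj_word k X \<beta> h))"
  unfolding word_box_sum[OF order_refl] defect_eq_defect_pow op_form_defect_pow
  using fold_defect_form[OF order_refl homogeneous2_norm] by metis

lemma clinear_defect: "clinear_op (defect k n X)"
proof -
  have "clinear_op (cp_map (n i) (X i) Y)" if "i < k" "clinear_op Y" for i Y
    unfolding cp_map_def using that by (intro clinear_sum clinear_comp clinear_cadj lin) auto
  then have "clinear_op (fold (\<lambda>i Y. Y - cp_map (n i) (X i) Y) js Y)"
    if "set js \<subseteq> {..<k}" "clinear_op Y" for js Y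
    using that by (induction js arbitrary: Y) (auto intro!: clinear_diff)
  then show ?thesis unfolding defect_def by (metis clinear_id lessThan_atLeast0 order_refl set_upt)
qed


subsection \<open>Strict row contractions\<close>

text \<open>Applied to the dilation by r with \<open>\<rho>\<close> = r^2.\<close>

context
  fixes \<rho> :: real
  assumes \<rho>: "0 \<le> \<rho>" "\<rho> < 1"
    and contr: "\<And>i h. i < k \<Longrightarrow> Phi i (\<lambda>h. (norm h)\<^sup>2) h \<le> \<rho> * (norm h)\<^sup>2"
begin

lemma Phi_pow_norm_le: "i < k \<Longrightarrow> (Phi i ^^ l) (\<lambda>h. (norm h)\<^sup>2) h \<le> \<rho> ^ l * (norm h)\<^sup>2"
proof (induction l)
  case (Suc l)
  have "(Phi i ^^ Suc l) (\<lambda>h. (norm h)\<^sup>2) h = (Phi i ^^ l) (Phi i (\<lambda>h. (norm h)\<^sup>2)) h"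
    by (simp add: funpow_swap1)
  also have "\<dots> \<le> (Phi i ^^ l) (\<lambda>h. \<rho> * (norm h)\<^sup>2) h"
    by (intro cp_form_pow_mono contr Suc.prems)
  also have "\<dots> \<le> \<rho> * (\<rho> ^ l * (norm h)\<^sup>2)"
    unfolding cp_form_pow_cmult by (intro mult_left_mono Suc \<rho>)
  finally show ?case by simp
qed simp

lemma Phi_pow_le:
  assumes "i < k" "\<And>h. q h \<le> C * (norm h)\<^sup>2" "0 \<le> C"
  shows "(Phi i ^^ l) q h \<le> C * \<rho> ^ l * (norm h)\<^sup>2"
proof -
  have "(Phi i ^^ l) q h \<le> (Phi i ^^ l) (\<lambda>h. C * (norm h)\<^sup>2) h"
    by (rule cp_form_pow_mono) (rule assms)
  also have "\<dots> \<le> C * (\<rho> ^ l * (norm h)\<^sup>2)"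
    unfolding cp_form_pow_cmult by (intro mult_left_mono Phi_pow_norm_le assms)
  finally show ?thesis by (simp add: mult.assoc)
qed

text \<open>Two-sided, because partial products of the factors id - Phi_i^p are not known here to
  give nonnegative forms.\<close>

lemma Phi_pow_abs_le:
  assumes "i < k" "\<And>h. \<bar>q h\<bar> \<le> C * (norm h)\<^sup>2" "0 \<le> C"
  shows "\<bar>(Phi i ^^ l) q h\<bar> \<le> C * \<rho> ^ l * (norm h)\<^sup>2"
proof -
  have "(Phi i ^^ l) q h \<le> C * \<rho> ^ l * (norm h)\<^sup>2"
    by (rule Phi_pow_le) (use assms abs_le_D1 in blast)+
  moreover have "(Phi i ^^ l) (\<lambda>h. 0 - q h) h \<le> C * \<rho> ^ l * (norm h)\<^sup>2"
    by (rule Phi_pow_le) (use assms abs_le_D2 in auto)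
  then have "- (Phi i ^^ l) q h \<le> C * \<rho> ^ l * (norm h)\<^sup>2"
    using cp_form_pow_cmult[of l "n i" "X i" 0 q] unfolding cp_form_pow_diff by simp
  ultimately show ?thesis by linarith
qed

lemma fold_defect_form_le:
  "j \<le> k \<Longrightarrow> \<bar>fold (defect_form p) [0..<j] (\<lambda>h. (norm h)\<^sup>2) h\<bar> \<le> 2 ^ j * (norm h)\<^sup>2"
proof (induction j arbitrary: h)
  case (Suc j)
  let ?Q = "fold (defect_form p) [0..<j] (\<lambda>h. (norm h)\<^sup>2)"
  have IH: "\<bar>?Q h\<bar> \<le> 2 ^ j * (norm h)\<^sup>2" for h using Suc by simp
  have "\<bar>(Phi j ^^ p j) ?Q h\<bar> \<le> 2 ^ j * \<rho> ^ p j * (norm h)\<^sup>2"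
    by (rule Phi_pow_abs_le) (use IH Suc.prems in auto)
  also have "\<dots> \<le> 2 ^ j * 1 * (norm h)\<^sup>2"
    using \<rho> by (intro mult_right_mono mult_left_mono power_le_one) auto
  finally show ?case using IH[of h] by (simp add: defect_form_def[of p j])
qed simp

text \<open>The form under the m-th power of Phi_j itself changes with m. Each factor at most
  doubles a form, so it is bounded by 2^j uniformly in m, and the decay of \<open>\<rho>\<close>^m
  wins.\<close>

lemma fold_defect_form_tendsto:
  "j \<le> k \<Longrightarrow> (\<lambda>m. fold (defect_form (\<lambda>_. m)) [0..<j] (\<lambda>h. (norm h)\<^sup>2) h) \<longlonglongrightarrow> (norm h)\<^sup>2"
proof (induction j)
  case (Suc j)
  let ?Q = "\<lambda>m. fold (defect_form (\<lambda>_. m)) [0..<j] (\<lambda>h. (norm h)\<^sup>2)"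
  have "(\<lambda>m. (Phi j ^^ m) (?Q m) h) \<longlonglongrightarrow> 0"
  proof (rule Lim_null_comparison)
    show "\<forall>\<^sub>F m in sequentially. norm ((Phi j ^^ m) (?Q m) h) \<le> 2 ^ j * \<rho> ^ m * (norm h)\<^sup>2"
      unfolding real_norm_def using Suc.prems
      by (intro always_eventually allI Phi_pow_abs_le fold_defect_form_le) auto
    show "(\<lambda>m. 2 ^ j * \<rho> ^ m * (norm h)\<^sup>2) \<longlonglongrightarrow> 0"
      using \<rho> by (intro tendsto_mult_left_zero tendsto_mult_right_zero LIMSEQ_realpow_zero)
  qed
  then have "(\<lambda>m. ?Q m h - (Phi j ^^ m) (?Q m) h) \<longlonglongrightarrow> (norm h)\<^sup>2 - 0"
    using Suc by (intro tendsto_diff) auto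
  then show ?case by (simp add: defect_form_def[of _ j])
qed simp

lemma word_box_defect_tendsto:
  "(\<lambda>m. \<Sum>\<beta>\<in>word_box k n (\<lambda>_. m). op_form (defect k n X) (adj_word k X \<beta> h)) \<longlonglongrightarrow> (norm h)\<^sup>2"
  using fold_defect_form_tendsto[of k h] by (simp flip: op_form_defect_pow op_form_defect_pow_eq_sum)

lemma foldr_sum_form_le:
  assumes q: "\<And>h. q h \<le> C * (norm h)\<^sup>2" "0 \<le> C" and js: "set js \<subseteq> {..<k}"
  shows "foldr (sum_form p) js q h \<le> C * (1 / (1 - \<rho>)) ^ length js * (norm h)\<^sup>2"
  using js
proof (induction js arbitrary: h)
  case (Cons i js)
  let ?C = "C * (1 / (1 - \<rho>)) ^ length js"
  have "sum_form p i (foldr (sum_form p) js q) h \<le> (\<Sum>l<p i. ?C * \<rho> ^ l * (norm h)\<^sup>2)"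
    unfolding sum_form_def[of p i] using Cons q \<rho>
    by (intro sum_mono Phi_pow_le) auto
  also have "\<dots> = ?C * (\<Sum>l<p i. \<rho> ^ l) * (norm h)\<^sup>2"
    by (simp add: sum_distrib_left sum_distrib_right mult.assoc)
  also have "\<dots> \<le> ?C * (1 / (1 - \<rho>)) * (norm h)\<^sup>2"
  proof (intro mult_right_mono mult_left_mono)
    have "(\<Sum>l<p i. \<rho> ^ l) \<le> (\<Sum>l. \<rho> ^ l)"
      using \<rho> by (intro sum_le_suminf summable_geometric) auto
    then show "(\<Sum>l<p i. \<rho> ^ l) \<le> 1 / (1 - \<rho>)" using suminf_geometric[of \<rho>] \<rho> by simp
  qed (use q \<rho> in auto)
  finally show ?case by (simp add: mult.commute mult.left_commute)
qed (use q in simp)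

text \<open>Each coordinate contributes a geometric series in \<open>\<rho>\<close>. In dual form,
  the row of all operators X_beta is bounded, which is why square-summable coefficients suffice for
  phi(rT).\<close>

lemma sum_norm_adj_word_le:
  assumes "finite F" "F \<subseteq> multiwords k n"
  shows "(\<Sum>\<beta>\<in>F. (norm (adj_word k X \<beta> h))\<^sup>2) \<le> (1 / (1 - \<rho>)) ^ k * (norm h)\<^sup>2"
proof -
  obtain m where m: "F \<subseteq> word_box k n (\<lambda>_. m)" using finite_multiwords_subset_word_box[OF assms] by blast
  have "(\<Sum>\<beta>\<in>F. (norm (adj_word k X \<beta> h))\<^sup>2) \<le> (\<Sum>\<beta>\<in>word_box k n (\<lambda>_. m). (norm (adj_word k X \<beta> h))\<^sup>2)"
    by (rule sum_mono2[OF finite_word_box m]) simp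
  also have "\<dots> = foldr (sum_form (\<lambda>_. m)) [0..<k] (\<lambda>h. (norm h)\<^sup>2) h"
    by (rule word_box_sum) simp
  also have "\<dots> \<le> 1 * (1 / (1 - \<rho>)) ^ length [0..<k] * (norm h)\<^sup>2"
    by (rule foldr_sum_form_le) auto
  finally show ?thesis by simp
qed

text \<open>The boxes provide a limit along one sequence of finite sets; nonnegative terms turn it
  into an unconditional sum.\<close>

lemma defect_has_sum:
  assumes "nonneg_op (defect k n X)"
  shows "((\<lambda>\<beta>. op_form (defect k n X) (adj_word k X \<beta> h)) has_sum (norm h)\<^sup>2) (multiwords k n)"
proof -
  let ?f = "\<lambda>\<beta>. op_form (defect k n X) (adj_word k X \<beta> h)"
  have nn: "0 \<le> ?f \<beta>" for \<beta> using nonneg_opD(1)[OF assms] by (simp add: op_form_def)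
  have inc: "incseq (\<lambda>m. \<Sum>\<beta>\<in>word_box k n (\<lambda>_. m). ?f \<beta>)"
    by (intro incseq_SucI sum_mono2 finite_word_box) (auto simp: word_box_def nn less_SucI)
  have bd: "sum ?f F \<le> (norm h)\<^sup>2" if F: "finite F" "F \<subseteq> multiwords k n" for F
  proof -
    obtain m where m: "F \<subseteq> word_box k n (\<lambda>_. m)" using finite_multiwords_subset_word_box[OF F] by blast
    have "sum ?f F \<le> sum ?f (word_box k n (\<lambda>_. m))" by (rule sum_mono2[OF finite_word_box m]) (rule nn)
    also have "\<dots> \<le> (norm h)\<^sup>2" by (rule incseq_le[OF inc word_box_defect_tendsto])
    finally show ?thesis .
  qed
  have summ: "?f summable_on multiwords k n"
    by (rule nonneg_bdd_above_summable_on) (use bd nn in \<open>auto intro!: bdd_aboveI2\<close>)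
  have "infsum ?f (multiwords k n) \<le> (norm h)\<^sup>2" by (rule infsum_le_finite_sums[OF summ bd])
  moreover have "(norm h)\<^sup>2 \<le> infsum ?f (multiwords k n)"
  proof (rule LIMSEQ_le_const2[OF word_box_defect_tendsto], intro exI allI impI)
    show "sum ?f (word_box k n (\<lambda>_. m)) \<le> infsum ?f (multiwords k n)" for m
      by (rule finite_sum_le_infsum[OF summ finite_word_box]) (auto simp: nn word_box_def)
  qed
  ultimately show ?thesis using has_sum_infsum[OF summ] by (metis order_antisym)
qed

end


subsection \<open>Products of multiwords\<close>

lemma comm_apply:
  "i < k \<Longrightarrow> j < k \<Longrightarrow> i \<noteq> j \<Longrightarrow> s < n i \<Longrightarrow> t < n j \<Longrightarrow>
    X i s (X j t x) = lam i j s t *\<^sub>C X j t (X i s x)"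
  using arg_cong[OF comm, of i j s t "\<lambda>Z. blinfun_apply Z x"] by simp

lemma letter_word_commute:
  assumes ij: "i < k" "j < k" "i \<noteq> j" "s < n i"
  shows "set \<gamma> \<subseteq> {..<n j} \<Longrightarrow>
    X i s (word_op (X j) \<gamma> x) = prod_list (map (lam i j s) \<gamma>) *\<^sub>C word_op (X j) \<gamma> (X i s x)"
proof (induction \<gamma>)
  case (Cons t \<gamma>)
  then show ?case
    using ij by (simp add: comm_apply clinear_opD[OF lin] scaleC_scaleC mult.commute)
qed simp

lemma word_word_commute:
  assumes ij: "i < k" "j < k" "i \<noteq> j" and \<gamma>: "set \<gamma> \<subseteq> {..<n j}"
  shows "set \<alpha> \<subseteq> {..<n i} \<Longrightarrow>
    word_op (X i) \<alpha> (word_op (X j) \<gamma> x) = word_twist (lam i j) \<alpha> \<gamma> *\<^sub>C word_op (X j) \<gamma> (word_op (X i) \<alpha> x)"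
proof (induction \<alpha>)
  case (Cons s \<alpha>)
  then show ?case
    using ij \<gamma> by (simp add: letter_word_commute clinear_opD[OF lin] scaleC_scaleC mult.commute)
qed simp

lemma word_multiword_commute:
  assumes \<gamma>: "\<gamma> \<in> multiwords k n" and \<alpha>: "set \<alpha> \<subseteq> {..<n b}" and b: "b < k"
  shows "j \<le> b \<Longrightarrow> word_op (X b) \<alpha> (multiword_op j X \<gamma> x)
    = (\<Prod>a<j. word_twist (lam b a) \<alpha> (\<gamma> a)) *\<^sub>C multiword_op j X \<gamma> (word_op (X b) \<alpha> x)"
proof (induction j arbitrary: x)
  case (Suc j)
  have "set (\<gamma> j) \<subseteq> {..<n j}" using \<gamma> b Suc.prems by (auto simp: multiwords_def)
  then show ?case
    using Suc b \<alpha> by (simp add: multiword_op_Suc word_word_commute[of b j]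
        clinear_opD[OF clinear_multiword_le[OF \<gamma>]] scaleC_scaleC)
qed simp

text \<open>Induction on the number of coordinates: the last block of \<open>\<beta>\<close> moves
  right past the blocks of \<open>\<gamma>\<close> in all lower coordinates and then meets the last
  block of \<open>\<gamma>\<close>.\<close>

lemma multiword_op_mult:
  assumes \<beta>: "\<beta> \<in> multiwords k n" and \<gamma>: "\<gamma> \<in> multiwords k n"
  shows "multiword_op k X \<beta> (multiword_op k X \<gamma> x) = twist k lam \<beta> \<gamma> *\<^sub>C multiword_op k X (cat \<beta> \<gamma>) x"
proof -
  have "multiword_op j X \<beta> (multiword_op j X \<gamma> x) = twist j lam \<beta> \<gamma> *\<^sub>C multiword_op j X (cat \<beta> \<gamma>) x"
    if "j \<le> k" for j x using that
  proof (induction j arbitrary: x)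
    case (Suc j)
    have "set (\<beta> j) \<subseteq> {..<n j}" using \<beta> Suc.prems by (auto simp: multiwords_def)
    then show ?case
      using Suc by (simp add: multiword_op_Suc word_multiword_commute[OF \<gamma>]
        clinear_opD[OF clinear_multiword_le[OF \<beta>]] scaleC_scaleC twist_def cat_def word_op_append mult.commute)
  qed (simp add: twist_def)
  then show ?thesis by simp
qed

end


section \<open>The Berezin kernel\<close>

lemma cinner_tensor_basis_right: "cinner f (ell2_tensor (ell2_basis i) e) = cinner (ell2_nth f i) e"
proof -
  have "cinner f (ell2_tensor (ell2_basis i) e) = (\<Sum>\<^sub>\<infinity>j. if j = i then cinner (ell2_nth f i) e else 0)"
    unfolding cinner_ell2_def by (intro infsum_cong) auto
  also have "\<dots> = (\<Sum>\<^sub>\<infinity>j\<in>{i}. cinner (ell2_nth f i) e)"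
    by (rule infsum_cong_neutral) auto
  finally show ?thesis by simp
qed

text \<open>The second assumption is the Bessel inequality that makes the kernel a contraction. It
  holds for rT, with equality in the limit, and passes to T itself as r tends to 1; the isometry
  property does not belong here.\<close>

locale berezin_tuple = twisted_tuple k n lam X
  for k n lam and X :: "'h::complex_hilbert op_tuple" +
  assumes nonneg: "nonneg_op (defect k n X)"
    and defect_sum_le: "\<And>F h. finite F \<Longrightarrow> F \<subseteq> multiwords k n \<Longrightarrow>
      (\<Sum>\<beta>\<in>F. op_form (defect k n X) (adj_word k X \<beta> h)) \<le> (norm h)\<^sup>2"
begin

abbreviation "R \<equiv> op_sqrt (defect k n X)"
abbreviation "K \<equiv> berezin_kernel k n X"

lemma norm_R_sq: "(norm (R h))\<^sup>2 = op_form (defect k n X) h"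
  unfolding op_form_def by (rule cinner_op_sqrt[OF clinear_defect nonneg])

lemma R_self_adjoint: "cinner (R x) y = cinner x (R y)"
  by (rule nonneg_self_adjoint[OF clinear_op_sqrt nonneg_op_sqrt, OF clinear_defect nonneg clinear_defect nonneg])

lemma clinear_R: "clinear_op R"
  by (rule clinear_op_sqrt[OF clinear_defect nonneg])

lemma berezin_kernel_props:
  shows berezin_kernel_nth:
      "ell2_nth (K h) \<beta> = (if \<beta> \<in> multiwords k n then R (adj_word k X \<beta> h) else 0)"
    and norm_berezin_kernel_le: "norm (K h) \<le> norm h"
    and clinear_berezin_kernel: "clinear_op K"
proof -
  define g where "g h \<beta> = (if \<beta> \<in> multiwords k n then R (adj_word k X \<beta> h) else 0)" for h \<beta>
  have bd: "(\<Sum>\<beta>\<in>F. (norm (g h \<beta>))\<^sup>2) \<le> (norm h)\<^sup>2" if "finite F" for F h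
  proof -
    have "(\<Sum>\<beta>\<in>F. (norm (g h \<beta>))\<^sup>2) = (\<Sum>\<beta>\<in>F \<inter> multiwords k n. (norm (g h \<beta>))\<^sup>2)"
      by (rule sum.mono_neutral_right) (use that in \<open>auto simp: g_def\<close>)
    also have "\<dots> = (\<Sum>\<beta>\<in>F \<inter> multiwords k n. op_form (defect k n X) (adj_word k X \<beta> h))"
      by (intro sum.cong refl) (simp add: g_def norm_R_sq)
    also have "\<dots> \<le> (norm h)\<^sup>2" by (rule defect_sum_le) (use that in auto)
    finally show ?thesis .
  qed
  have nth: "ell2_nth (Abs_ell2 (g h)) = g h" for h by (rule ell2_nth_Abs_bounded(1)[OF bd])
  have nrm: "norm (Abs_ell2 (g h)) \<le> norm h" for h
    using ell2_nth_Abs_bounded(2)[OF bd, of h] by (simp add: power2_le_iff_abs_le)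
  \<comment> \<open>The infinite sum in the definition is evaluated pointwise as the expansion of
    \<open>Abs_ell2 (g h)\<close> in basis tensors.\<close>
  have K_def: "K = Blinfun (\<lambda>h. Abs_ell2 (g h))"
    unfolding berezin_kernel_def
  proof (intro arg_cong[where f = Blinfun] ext infsumI)
    fix h
    have "((\<lambda>\<beta>. ell2_tensor (ell2_basis \<beta>) (ell2_nth (Abs_ell2 (g h)) \<beta>)) has_sum Abs_ell2 (g h)) (multiwords k n)"
      by (rule ell2_has_sum) (simp only: nth, simp add: g_def)
    then show "((\<lambda>\<beta>. ell2_tensor (ell2_basis \<beta>) (R (fold (\<lambda>i. blinfun_apply (cadj (word_op (X i) (\<beta> i)))) [0..<k] h)))
        has_sum Abs_ell2 (g h)) (multiwords k n)"
      by (rule iffD1[OF has_sum_cong, rotated]) (simp only: nth, simp add: g_def adj_word_def)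
  qed
  have g_scale: "g (c *\<^sub>C h) \<beta> = c *\<^sub>C g h \<beta>" for c h \<beta>
    by (simp add: g_def adj_word_eq_cadj clinear_opD[OF clinear_cadj[OF clinear_multiword]] clinear_opD[OF clinear_R])
  have scale: "Abs_ell2 (g (c *\<^sub>C h)) = c *\<^sub>C Abs_ell2 (g h)" for c h
    by (rule ell2_eqI) (simp add: nth g_scale)
  have "bounded_linear (\<lambda>h. Abs_ell2 (g h))"
  proof (rule bounded_linear_intro[where K = 1])
    show "Abs_ell2 (g (x + y)) = Abs_ell2 (g x) + Abs_ell2 (g y)" for x y
      by (rule ell2_eqI) (simp add: nth, simp add: g_def adj_word_eq_cadj blinfun.add_right)
    show "Abs_ell2 (g (r *\<^sub>R x)) = r *\<^sub>R Abs_ell2 (g x)" for r x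
      using scale[of "of_real r" x] by (simp add: scaleC_of_real)
  qed (use nrm in auto)
  then have K: "blinfun_apply K = (\<lambda>h. Abs_ell2 (g h))"
    unfolding K_def by (rule bounded_linear_Blinfun_apply)
  show "ell2_nth (K h) \<beta> = (if \<beta> \<in> multiwords k n then R (adj_word k X \<beta> h) else 0)"
    by (simp add: K nth) (simp add: g_def)
  show "norm (K h) \<le> norm h" by (simp add: K nrm)
  show "clinear_op K" by (simp add: clinear_op_def K scale)
qed

lemma norm_cadj_kernel_le: "norm (cadj K f) \<le> norm f"
  using norm_cadj_le[OF clinear_berezin_kernel, of 1 f] norm_berezin_kernel_le by simp

lemma cadj_kernel_tensor:
  assumes "\<beta> \<in> multiwords k n"
  shows "cadj K (ell2_tensor (ell2_basis \<beta>) e) = multiword_op k X \<beta> (R e)"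
proof (rule cadj_eqI[OF clinear_berezin_kernel])
  show "cinner (K h) (ell2_tensor (ell2_basis \<beta>) e) = cinner h (multiword_op k X \<beta> (R e))" for h
    using assms by (simp add: cinner_tensor_basis_right berezin_kernel_nth adj_word_eq_cadj R_self_adjoint
        cinner_cadj_left clinear_multiword)
qed

lemma csubspace_defect_space: "csubspace (defect_space k n X)"
  unfolding defect_space_def by (intro csubspace_closure csubspace_range clinear_defect)

lemma closed_defect_space: "closed (defect_space k n X)"
  by (simp add: defect_space_def)

text \<open>Places \<open>K\<close> h where \<open>tensor_id\<close> acts as the ampliation: values
  of the square root lie in the closed range of the defect.\<close>

lemma kernel_in_ell2_on: "K h \<in> ell2_on (multiwords k n) (defect_space k n X)"
  using op_sqrt_in_closure_range[OF clinear_defect nonneg]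
  by (simp add: ell2_on_def berezin_kernel_nth defect_space_def)

lemma berezin_transform_apply:
  assumes "A \<in> bops (model_space k n) (model_space k n)"
  shows "berezin_transform k n X A h = cadj K (ampliation A (K h))"
  using tensor_id_apply[OF assms[unfolded model_space_def] csubspace_defect_space closed_defect_space kernel_in_ell2_on]
  by (simp add: berezin_transform_def)

text \<open>Expand \<open>K\<close> h in basis tensors; on each of them the two sides agree by
  hypothesis, and both are continuous. For rT, where \<open>cadj K\<close> inverts \<open>K\<close>
  on the left, this evaluates the Berezin transform as Z.\<close>

lemma cadj_kernel_intertwine:
  fixes Z :: "'h \<Rightarrow>\<^sub>L 'h"
  assumes A: "A \<in> bops (model_space k n) (model_space k n)"
    and Z: "\<And>\<gamma> e. \<gamma> \<in> multiwords k n \<Longrightarrow>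
      Z (multiword_op k X \<gamma> (R e)) = cadj K (ell2_tensor (A (ell2_basis \<gamma>)) e)"
  shows "Z (cadj K (K h)) = cadj K (ampliation A (K h))"
proof (rule has_sum_unique)
  let ?f = "\<lambda>\<gamma>. ell2_tensor (ell2_basis \<gamma>) (ell2_nth (K h) \<gamma>)"
  have lin: "clinear_op A" using A by (simp add: bops_def)
  have sum: "(?f has_sum K h) (multiwords k n)"
    by (rule ell2_has_sum) (simp add: berezin_kernel_nth)
  show "((\<lambda>\<gamma>. (Z o\<^sub>L cadj K) (?f \<gamma>)) has_sum Z (cadj K (K h))) (multiwords k n)"
    using has_sum_bounded_linear[OF blinfun.bounded_linear_right sum, of "Z o\<^sub>L cadj K"] by (simp add: o_def)
  have "((\<lambda>\<gamma>. (cadj K o\<^sub>L ampliation A) (?f \<gamma>)) has_sum cadj K (ampliation A (K h))) (multiwords k n)"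
    using has_sum_bounded_linear[OF blinfun.bounded_linear_right sum, of "cadj K o\<^sub>L ampliation A"] by (simp add: o_def)
  then show "((\<lambda>\<gamma>. (Z o\<^sub>L cadj K) (?f \<gamma>)) has_sum cadj K (ampliation A (K h))) (multiwords k n)"
    by (rule iffD1[OF has_sum_cong, rotated]) (simp add: ampliation_tensor[OF lin] cadj_kernel_tensor Z)
qed

end


section \<open>The universal model and the Hardy algebra\<close>

lemma inj_on_letter: "inj_on (\<lambda>\<alpha>::multiword. \<alpha>(i := s # \<alpha> i)) F"
proof (rule inj_onI)
  fix \<alpha> \<beta> :: multiword assume eq: "\<alpha>(i := s # \<alpha> i) = \<beta>(i := s # \<beta> i)"
  show "\<alpha> = \<beta>"
  proof
    fix j show "\<alpha> j = \<beta> j" using fun_cong[OF eq, of j] by (simp split: if_splits)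
  qed
qed

lemma universal_model_props:
  assumes lam: "twist_matrices k n lam" and i: "i < k" "s < n i"
  shows "universal_model k n lam i s \<in> bops (model_space k n) (model_space k n)"
    and "\<alpha> \<in> multiwords k n \<Longrightarrow> universal_model k n lam i s (ell2_basis \<alpha>) =
        (\<Prod>j<i. prod_list (map (lam i j s) (\<alpha> j))) *\<^sub>C ell2_basis (\<alpha>(i := s # \<alpha> i))"
proof -
  let ?w = "\<lambda>\<alpha>. \<Prod>j<i. prod_list (map (lam i j s) (\<alpha> j))"
  let ?P = "\<lambda>S. S \<in> bops (model_space k n) (model_space k n) \<and>
     (\<forall>\<alpha>\<in>multiwords k n. S (ell2_basis \<alpha>) = ?w \<alpha> *\<^sub>C ell2_basis (\<alpha>(i := s # \<alpha> i)))"
  have w: "cmod (?w \<alpha>) \<le> 1" if "\<alpha> \<in> multiwords k n" for \<alpha>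
  proof -
    have "cmod (prod_list (map (lam i j s) (\<alpha> j))) = 1" if "j < i" for j
      using i \<open>\<alpha> \<in> multiwords k n\<close> that
      by (intro cmod_prod_list_1 twist_matrices_cmod[OF lam]) (auto simp: multiwords_def subset_iff)
    then show ?thesis by (simp flip: prod_norm)
  qed
  have "(\<lambda>\<alpha>. \<alpha>(i := s # \<alpha> i)) ` multiwords k n \<subseteq> multiwords k n"
    using i by (auto simp: multiwords_def subset_iff split: if_splits)
  then have "\<exists>S. ?P S"
    using weighted_shift_exists[OF inj_on_letter, of "multiwords k n" ?w i s "multiwords k n"] w
    unfolding model_space_def by blast
  moreover have "S = S'" if "?P S" "?P S'" for S S'
    using that unfolding model_space_def by (intro bops_ell2_eqI[of S "multiwords k n"]) auto
  ultimately have "\<exists>!S. ?P S" by blast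
  then have "?P (universal_model k n lam i s)"
    unfolding universal_model_def by (rule theI')
  then show "universal_model k n lam i s \<in> bops (model_space k n) (model_space k n)"
    "\<alpha> \<in> multiwords k n \<Longrightarrow> universal_model k n lam i s (ell2_basis \<alpha>) = ?w \<alpha> *\<^sub>C ell2_basis (\<alpha>(i := s # \<alpha> i))"
    by blast+
qed

lemma universal_model_word:
  assumes lam: "twist_matrices k n lam" and i: "i < k" and \<alpha>: "\<alpha> \<in> multiwords k n"
  shows "set w \<subseteq> {..<n i} \<Longrightarrow> word_op (universal_model k n lam i) w (ell2_basis \<alpha>)
    = (\<Prod>a<i. word_twist (lam i a) w (\<alpha> a)) *\<^sub>C ell2_basis (\<alpha>(i := w @ \<alpha> i))"
proof (induction w)
  case (Cons s w)
  have s: "s < n i" and w: "set w \<subseteq> {..<n i}" using Cons.prems by auto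
  have "\<alpha>(i := w @ \<alpha> i) \<in> multiwords k n" using \<alpha> w i by (auto simp: multiwords_def)
  moreover have "clinear_op (universal_model k n lam i s)"
    using universal_model_props(1)[OF lam i s] by (simp add: bops_def)
  moreover have "(\<Prod>j<i. prod_list (map (lam i j s) ((\<alpha>(i := w @ \<alpha> i)) j))) = (\<Prod>j<i. prod_list (map (lam i j s) (\<alpha> j)))"
    by (intro prod.cong) auto
  moreover have "(\<alpha>(i := w @ \<alpha> i))(i := s # (\<alpha>(i := w @ \<alpha> i)) i) = \<alpha>(i := (s # w) @ \<alpha> i)" by simp
  ultimately have "universal_model k n lam i s (ell2_basis (\<alpha>(i := w @ \<alpha> i)))
      = (\<Prod>j<i. prod_list (map (lam i j s) (\<alpha> j))) *\<^sub>C ell2_basis (\<alpha>(i := (s # w) @ \<alpha> i))"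
    by (simp only: universal_model_props(2)[OF lam i s])
  then have "universal_model k n lam i s (word_op (universal_model k n lam i) w (ell2_basis \<alpha>))
      = (\<Prod>a<i. word_twist (lam i a) w (\<alpha> a)) *\<^sub>C
        (\<Prod>j<i. prod_list (map (lam i j s) (\<alpha> j))) *\<^sub>C ell2_basis (\<alpha>(i := (s # w) @ \<alpha> i))"
    by (simp only: Cons.IH[OF w] clinear_opD[OF \<open>clinear_op _\<close>])
  then show ?case
    by (simp only: word_op_Cons blinfun_apply_blinfun_compose scaleC_scaleC word_twist_simps prod.distrib mult.commute)
qed simp

lemma universal_model_multiword:
  assumes lam: "twist_matrices k n lam" and \<beta>: "\<beta> \<in> multiwords k n" and \<gamma>: "\<gamma> \<in> multiwords k n"
  shows "multiword_op k (universal_model k n lam) \<beta> (ell2_basis \<gamma>)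
    = twist k lam \<beta> \<gamma> *\<^sub>C ell2_basis (cat \<beta> \<gamma>)"
proof -
  have lin: "clinear_op (multiword_op j (universal_model k n lam) \<beta>)" if "j \<le> k" for j
    using that
  proof (induction j)
    case (Suc j)
    have "clinear_op (universal_model k n lam j s)" if "s \<in> set (\<beta> j)" for s
      using universal_model_props(1)[OF lam, of j s] Suc.prems \<beta> that
      by (auto simp: multiwords_def bops_def subset_iff)
    then show ?case using Suc by (simp add: multiword_op_Suc clinear_comp clinear_word_op)
  qed simp
  have "multiword_op j (universal_model k n lam) \<beta> (ell2_basis \<gamma>)
      = twist j lam \<beta> \<gamma> *\<^sub>C ell2_basis (\<lambda>i. if i < j then \<beta> i @ \<gamma> i else \<gamma> i)"
    if "j \<le> k" "\<gamma> \<in> multiwords k n" for j \<gamma> using that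
  proof (induction j arbitrary: \<gamma>)
    case (Suc j)
    have w: "set (\<beta> j) \<subseteq> {..<n j}" using \<beta> Suc.prems by (auto simp: multiwords_def)
    let ?\<gamma> = "\<gamma>(j := \<beta> j @ \<gamma> j)"
    have g: "?\<gamma> \<in> multiwords k n" using Suc.prems w by (auto simp: multiwords_def)
    \<comment> \<open>The twist over the first j coordinates reads \<open>\<gamma>\<close> only
      below j, so prepending a block at j does not change it.\<close>
    have t: "twist j lam \<beta> ?\<gamma> = twist j lam \<beta> \<gamma>"
      unfolding twist_def by (intro prod.cong refl) auto
    have e: "(\<lambda>i. if i < j then \<beta> i @ ?\<gamma> i else ?\<gamma> i) = (\<lambda>i. if i < Suc j then \<beta> i @ \<gamma> i else \<gamma> i)"
      by (auto simp: fun_eq_iff less_Suc_eq)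
    have "multiword_op (Suc j) (universal_model k n lam) \<beta> (ell2_basis \<gamma>)
        = (\<Prod>a<j. word_twist (lam j a) (\<beta> j) (\<gamma> a)) *\<^sub>C multiword_op j (universal_model k n lam) \<beta> (ell2_basis ?\<gamma>)"
      using universal_model_word[OF lam _ Suc.prems(2) w] Suc.prems(1)
      by (simp add: multiword_op_Suc clinear_opD[OF lin])
    then show ?case
      using Suc.IH[OF _ g] Suc.prems(1) by (simp only: t e) (simp add: scaleC_scaleC twist_def mult.commute)
  qed (simp add: twist_def)
  from this[OF order_refl \<gamma>] show ?thesis
  proof -
    have "(\<lambda>i. if i < k then \<beta> i @ \<gamma> i else \<gamma> i) = cat \<beta> \<gamma>"
      using \<beta> by (auto simp: cat_def multiwords_def fun_eq_iff)
    then show ?thesis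
      using \<open>multiword_op k (universal_model k n lam) \<beta> (ell2_basis \<gamma>) = _\<close> by simp
  qed
qed

section \<open>The Hardy algebra through matrix entries: sums, scalar multiples, products and the
  unit\<close>

context
  fixes k n lam
  assumes lam: "twist_matrices k n lam"
begin

lemma fourier_rep_has_sum:
  assumes "fourier_rep k n lam c A" "\<gamma> \<in> multiwords k n"
  shows "((\<lambda>\<beta>. (c \<beta> * twist k lam \<beta> \<gamma>) *\<^sub>C ell2_basis (cat \<beta> \<gamma>)) has_sum A (ell2_basis \<gamma>)) (multiwords k n)"
proof -
  have "((\<lambda>\<beta>. c \<beta> *\<^sub>C multiword_op k (universal_model k n lam) \<beta> (ell2_basis \<gamma>)) has_sum A (ell2_basis \<gamma>)) (multiwords k n)"
    using assms by (simp add: fourier_rep_def)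
  then show ?thesis
    by (rule iffD1[OF has_sum_cong, rotated])
      (simp add: universal_model_multiword[OF lam _ assms(2)] scaleC_scaleC)
qed

text \<open>Right concatenation with \<open>\<gamma>\<close> is injective, so the terms of the
  series at chi_gamma sit at distinct basis vectors and every entry is a single term or 0.\<close>

lemma fourier_rep_nth:
  assumes "fourier_rep k n lam c A" "\<gamma> \<in> multiwords k n"
  shows "\<beta> \<in> multiwords k n \<Longrightarrow> ell2_nth (A (ell2_basis \<gamma>)) (cat \<beta> \<gamma>) = c \<beta> * twist k lam \<beta> \<gamma>"
    and "\<delta> \<notin> (\<lambda>\<beta>. cat \<beta> \<gamma>) ` multiwords k n \<Longrightarrow> ell2_nth (A (ell2_basis \<gamma>)) \<delta> = 0"
proof -
  have sum: "((\<lambda>\<beta>. (c \<beta> * twist k lam \<beta> \<gamma>) *\<^sub>C (if \<delta> = cat \<beta> \<gamma> then 1 else 0)) has_sum ell2_nth (A (ell2_basis \<gamma>)) \<delta>)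
      (multiwords k n)" for \<delta>
    using has_sum_bounded_linear[OF bounded_linear_ell2_nth fourier_rep_has_sum[OF assms], of \<delta>]
    by (simp add: o_def)
  show "ell2_nth (A (ell2_basis \<gamma>)) (cat \<beta> \<gamma>) = c \<beta> * twist k lam \<beta> \<gamma>" if \<beta>: "\<beta> \<in> multiwords k n"
  proof (rule has_sum_unique[OF sum])
    have "cat \<beta> \<gamma> = cat \<beta>' \<gamma> \<longleftrightarrow> \<beta> = \<beta>'" for \<beta>' using inj_cat_left by (metis injD)
    then show "((\<lambda>\<beta>'. (c \<beta>' * twist k lam \<beta>' \<gamma>) *\<^sub>C (if cat \<beta> \<gamma> = cat \<beta>' \<gamma> then 1 else 0)) has_sum c \<beta> * twist k lam \<beta> \<gamma>)
        (multiwords k n)"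
      using \<beta> by (intro has_sum_finite_neutralI[of "{\<beta>}"]) (auto simp: scaleC_complex_def)
  qed
  show "ell2_nth (A (ell2_basis \<gamma>)) \<delta> = 0" if "\<delta> \<notin> (\<lambda>\<beta>. cat \<beta> \<gamma>) ` multiwords k n"
    by (rule has_sum_unique[OF sum]) (use that in \<open>auto intro!: has_sum_0\<close>)
qed

text \<open>Converse of \<open>fourier_rep_nth\<close>: membership becomes a condition on matrix
  entries. Square-summability of c is read off from the column of the empty word, where the twist is
  1.\<close>

lemma fourier_repI:
  assumes A: "A \<in> bops (model_space k n) (model_space k n)"
    and 1: "\<And>\<beta> \<gamma>. \<beta> \<in> multiwords k n \<Longrightarrow> \<gamma> \<in> multiwords k n \<Longrightarrow>
      ell2_nth (A (ell2_basis \<gamma>)) (cat \<beta> \<gamma>) = c \<beta> * twist k lam \<beta> \<gamma>"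
    and 0: "\<And>\<gamma> \<delta>. \<gamma> \<in> multiwords k n \<Longrightarrow> \<delta> \<notin> (\<lambda>\<beta>. cat \<beta> \<gamma>) ` multiwords k n \<Longrightarrow>
      ell2_nth (A (ell2_basis \<gamma>)) \<delta> = 0"
  shows "fourier_rep k n lam c A"
  unfolding fourier_rep_def
proof (intro conjI ballI)
  have "(\<lambda>\<beta>. (cmod (ell2_nth (A (ell2_basis empty_word)) \<beta>))\<^sup>2) summable_on multiwords k n"
    by (rule summable_on_subset_banach[OF ell2_summable]) simp
  then show "(\<lambda>\<beta>. (cmod (c \<beta>))\<^sup>2) summable_on multiwords k n"
    using 1[of _ empty_word] by (simp cong: summable_on_cong)
  show "((\<lambda>\<beta>. c \<beta> *\<^sub>C multiword_op k (universal_model k n lam) \<beta> (ell2_basis \<gamma>)) has_sum A (ell2_basis \<gamma>)) (multiwords k n)"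
    if \<gamma>: "\<gamma> \<in> multiwords k n" for \<gamma>
  proof -
    have "((\<lambda>\<delta>. ell2_nth (A (ell2_basis \<gamma>)) \<delta> *\<^sub>C ell2_basis \<delta>) has_sum A (ell2_basis \<gamma>))
        ((\<lambda>\<beta>. cat \<beta> \<gamma>) ` multiwords k n)"
      by (rule ell2_scalar_has_sum) (rule 0[OF \<gamma>])
    then have "(((\<lambda>\<delta>. ell2_nth (A (ell2_basis \<gamma>)) \<delta> *\<^sub>C ell2_basis \<delta>) \<circ> (\<lambda>\<beta>. cat \<beta> \<gamma>)) has_sum A (ell2_basis \<gamma>))
        (multiwords k n)"
      by (subst has_sum_reindex[symmetric]) (auto intro: inj_on_subset[OF inj_cat_left])
    then show ?thesis
      by (rule iffD1[OF has_sum_cong, rotated])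
        (simp add: 1 \<gamma> universal_model_multiword[OF lam _ \<gamma>] scaleC_scaleC)
  qed
qed (rule A)

lemma fourier_rep_bops: "fourier_rep k n lam c A \<Longrightarrow> A \<in> bops (model_space k n) (model_space k n)"
  by (simp add: fourier_rep_def)

lemma hardy_algebraI: "fourier_rep k n lam c A \<Longrightarrow> A \<in> hardy_algebra k n lam"
  by (auto simp: hardy_algebra_def)

lemma model_space_csubspace: "csubspace (model_space k n)" and model_space_closed: "closed (model_space k n)"
  by (simp_all add: model_space_def csubspace_ell2_on closed_ell2_on)

lemma bops_add: "A \<in> bops M N \<Longrightarrow> B \<in> bops M N \<Longrightarrow> csubspace N \<Longrightarrow> A + B \<in> bops M N"
  by (auto simp: bops_def csubspace_def blinfun.add_left clinear_add)

lemma bops_scale: "A \<in> bops M N \<Longrightarrow> csubspace N \<Longrightarrow> scale_op a A \<in> bops M N"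
  by (auto simp: bops_def csubspace_def clinear_scale_op)

lemma bops_comp: "A \<in> bops M N \<Longrightarrow> B \<in> bops M' M \<Longrightarrow> A o\<^sub>L B \<in> bops M' N"
  by (auto simp: bops_def clinear_comp)

lemma hardy_algebra_add:
  assumes "A \<in> hardy_algebra k n lam" "B \<in> hardy_algebra k n lam"
  shows "A + B \<in> hardy_algebra k n lam"
proof -
  obtain c d where c: "fourier_rep k n lam c A" and d: "fourier_rep k n lam d B"
    using assms by (auto simp: hardy_algebra_def)
  have "fourier_rep k n lam (\<lambda>\<beta>. c \<beta> + d \<beta>) (A + B)"
    by (rule fourier_repI)
      (auto simp: blinfun.add_left fourier_rep_nth[OF c] fourier_rep_nth[OF d] algebra_simps
        intro!: bops_add fourier_rep_bops[OF c] fourier_rep_bops[OF d] model_space_csubspace)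
  then show ?thesis by (rule hardy_algebraI)
qed

lemma hardy_algebra_scale:
  assumes "A \<in> hardy_algebra k n lam"
  shows "scale_op a A \<in> hardy_algebra k n lam"
proof -
  obtain c where c: "fourier_rep k n lam c A" using assms by (auto simp: hardy_algebra_def)
  have "fourier_rep k n lam (\<lambda>\<beta>. a * c \<beta>) (scale_op a A)"
    by (rule fourier_repI)
      (auto simp: fourier_rep_nth[OF c] scaleC_complex_def
        intro!: bops_scale fourier_rep_bops[OF c] model_space_csubspace)
  then show ?thesis by (rule hardy_algebraI)
qed

lemma cat_assoc: "cat (cat \<alpha> \<beta>) \<gamma> = cat \<alpha> (cat \<beta> \<gamma>)"
  by (simp add: cat_def)

text \<open>The coefficients of the product are the entries of A B at the empty word. The columns at
  other words are compared with this one term by term.\<close>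

lemma hardy_algebra_mult:
  assumes "A \<in> hardy_algebra k n lam" "B \<in> hardy_algebra k n lam"
  shows "A o\<^sub>L B \<in> hardy_algebra k n lam"
proof -
  obtain c d where c: "fourier_rep k n lam c A" and d: "fourier_rep k n lam d B"
    using assms by (auto simp: hardy_algebra_def)
  have lin: "clinear_op A" using fourier_rep_bops[OF c] by (simp add: bops_def)
  let ?M = "multiwords k n"
  have sum: "((\<lambda>\<beta>. d \<beta> * twist k lam \<beta> \<gamma> * ell2_nth (A (ell2_basis (cat \<beta> \<gamma>))) \<delta>)
      has_sum ell2_nth (A (B (ell2_basis \<gamma>))) \<delta>) ?M" if "\<gamma> \<in> ?M" for \<gamma> \<delta>
    using has_sum_bounded_linear[OF bounded_linear_compose[OF bounded_linear_ell2_nth[of \<delta>]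
        blinfun.bounded_linear_right[of A]] fourier_rep_has_sum[OF d that]]
    by (simp add: o_def clinear_opD[OF lin] scaleC_complex_def)
  have "fourier_rep k n lam (ell2_nth (A (B (ell2_basis empty_word)))) (A o\<^sub>L B)"
  proof (rule fourier_repI)
    fix \<epsilon> \<gamma> assume \<epsilon>: "\<epsilon> \<in> ?M" and \<gamma>: "\<gamma> \<in> ?M"
    \<comment> \<open>Right translation by \<open>\<gamma>\<close> takes the entry of A at
      (\<open>\<epsilon>\<close>, \<open>\<beta>\<close>) to the one at the concatenations, with
      twists that match by the bicharacter property. If \<open>\<beta>\<close> is not a right factor
      of \<open>\<epsilon>\<close>, cancellation shows that both entries are 0.\<close>
    have "twist k lam \<beta> \<gamma> * ell2_nth (A (ell2_basis (cat \<beta> \<gamma>))) (cat \<epsilon> \<gamma>)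
        = ell2_nth (A (ell2_basis \<beta>)) \<epsilon> * twist k lam \<epsilon> \<gamma>" if \<beta>: "\<beta> \<in> ?M" for \<beta>
    proof (cases "\<epsilon> \<in> (\<lambda>\<alpha>. cat \<alpha> \<beta>) ` ?M")
      case True
      then obtain \<alpha> where \<alpha>: "\<alpha> \<in> ?M" "\<epsilon> = cat \<alpha> \<beta>" by blast
      then show ?thesis
        using fourier_rep_nth(1)[OF c \<beta> \<alpha>(1)] fourier_rep_nth(1)[OF c cat_in_multiwords[OF \<beta> \<gamma>] \<alpha>(1)]
        by (simp add: cat_assoc twist_cat_left twist_cat_right)
    next
      case False
      have "cat \<epsilon> \<gamma> \<notin> (\<lambda>\<alpha>. cat \<alpha> (cat \<beta> \<gamma>)) ` ?M"
      proof
        assume "cat \<epsilon> \<gamma> \<in> (\<lambda>\<alpha>. cat \<alpha> (cat \<beta> \<gamma>)) ` ?M"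
        then obtain \<alpha> where "\<alpha> \<in> ?M" "cat \<epsilon> \<gamma> = cat (cat \<alpha> \<beta>) \<gamma>" by (auto simp: cat_assoc)
        then show False using False injD[OF inj_cat_left] by blast
      qed
      then show ?thesis
        using fourier_rep_nth(2)[OF c \<beta> False] fourier_rep_nth(2)[OF c cat_in_multiwords[OF \<beta> \<gamma>]] by simp
    qed
    then have "((\<lambda>\<beta>. d \<beta> * ell2_nth (A (ell2_basis \<beta>)) \<epsilon> * twist k lam \<epsilon> \<gamma>)
        has_sum ell2_nth (A (B (ell2_basis \<gamma>))) (cat \<epsilon> \<gamma>)) ?M"
      using sum[OF \<gamma>, of "cat \<epsilon> \<gamma>"] by (simp add: mult.assoc cong: has_sum_cong)
    moreover have "((\<lambda>\<beta>. d \<beta> * ell2_nth (A (ell2_basis \<beta>)) \<epsilon> * twist k lam \<epsilon> \<gamma>)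
        has_sum ell2_nth (A (B (ell2_basis empty_word))) \<epsilon> * twist k lam \<epsilon> \<gamma>) ?M"
      using has_sum_cmult_left[OF sum[of empty_word \<epsilon>]] by simp
    ultimately show "ell2_nth ((A o\<^sub>L B) (ell2_basis \<gamma>)) (cat \<epsilon> \<gamma>)
        = ell2_nth (A (B (ell2_basis empty_word))) \<epsilon> * twist k lam \<epsilon> \<gamma>"
      using has_sum_unique by fastforce
  next
    fix \<gamma> \<delta> assume \<gamma>: "\<gamma> \<in> ?M" and \<delta>: "\<delta> \<notin> (\<lambda>\<beta>. cat \<beta> \<gamma>) ` ?M"
    have "ell2_nth (A (ell2_basis (cat \<beta> \<gamma>))) \<delta> = 0" if \<beta>: "\<beta> \<in> ?M" for \<beta>
      by (rule fourier_rep_nth(2)[OF c cat_in_multiwords[OF \<beta> \<gamma>]])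
        (use \<delta> cat_in_multiwords[OF _ \<beta>] in \<open>auto simp flip: cat_assoc\<close>)
    then have "((\<lambda>\<beta>. 0) has_sum ell2_nth (A (B (ell2_basis \<gamma>))) \<delta>) ?M"
      using sum[OF \<gamma>, of \<delta>] by (simp cong: has_sum_cong)
    then show "ell2_nth ((A o\<^sub>L B) (ell2_basis \<gamma>)) \<delta> = 0"
      using has_sum_unique[OF _ has_sum_0_simp] by simp
  qed (rule bops_comp[OF fourier_rep_bops[OF c] fourier_rep_bops[OF d]])
  then show ?thesis by (rule hardy_algebraI)
qed

text \<open>The index type is larger than the set of multiwords, so the identity of the model space
  is represented by a projection, obtained as the weighted shift along the identity map.\<close>

lemma model_space_projection:
  shows subspace_id_model_bops: "subspace_id (model_space k n) \<in> bops (model_space k n) (model_space k n)"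
    and subspace_id_model_basis: "\<gamma> \<in> multiwords k n \<Longrightarrow> subspace_id (model_space k n) (ell2_basis \<gamma>) = ell2_basis \<gamma>"
proof -
  obtain P where P: "P \<in> bops (model_space k n) (model_space k n)"
    "\<And>i. i \<in> multiwords k n \<Longrightarrow> P (ell2_basis i) = ell2_basis i"
    using weighted_shift_exists[of "\<lambda>\<beta>. \<beta>" "multiwords k n" "\<lambda>_. 1" "multiwords k n"]
    by (auto simp: model_space_def)
  have "P x = x" if x: "x \<in> model_space k n" for x
  proof (rule has_sum_unique)
    have "((\<lambda>i. ell2_nth x i *\<^sub>C ell2_basis i) has_sum x) (multiwords k n)"
      using x by (intro ell2_scalar_has_sum) (simp add: model_space_def ell2_on_def)
    then show "((\<lambda>i. ell2_nth x i *\<^sub>C ell2_basis i) has_sum x) (multiwords k n)" .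
    then have "((\<lambda>i. P (ell2_nth x i *\<^sub>C ell2_basis i)) has_sum P x) (multiwords k n)"
      by (rule has_sum_bounded_linear[OF blinfun.bounded_linear_right[of P], unfolded o_def])
    then show "((\<lambda>i. ell2_nth x i *\<^sub>C ell2_basis i) has_sum P x) (multiwords k n)"
      by (rule iffD1[OF has_sum_cong, rotated]) (use P in \<open>simp add: bops_def clinear_opD\<close>)
  qed
  then have "subspace_id (model_space k n) = P"
    by (rule subspace_id_eqI[OF model_space_csubspace model_space_closed P(1)])
  then show "subspace_id (model_space k n) \<in> bops (model_space k n) (model_space k n)"
    "\<gamma> \<in> multiwords k n \<Longrightarrow> subspace_id (model_space k n) (ell2_basis \<gamma>) = ell2_basis \<gamma>"
    using P by simp_all
qed

lemma subspace_id_in_hardy_algebra: "subspace_id (model_space k n) \<in> hardy_algebra k n lam"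
proof (rule hardy_algebraI, rule fourier_repI)
  show "ell2_nth (subspace_id (model_space k n) (ell2_basis \<gamma>)) (cat \<beta> \<gamma>)
      = (if \<beta> = empty_word then 1 else 0) * twist k lam \<beta> \<gamma>"
    if "\<beta> \<in> multiwords k n" "\<gamma> \<in> multiwords k n" for \<beta> \<gamma>
  proof (cases "\<beta> = empty_word")
    case False
    then have "cat \<beta> \<gamma> \<noteq> cat empty_word \<gamma>" using injD[OF inj_cat_left] by blast
    then show ?thesis using that False by (simp add: subspace_id_model_basis)
  qed (use that in \<open>simp add: subspace_id_model_basis\<close>)
  show "ell2_nth (subspace_id (model_space k n) (ell2_basis \<gamma>)) \<delta> = 0"
    if "\<gamma> \<in> multiwords k n" "\<delta> \<notin> (\<lambda>\<beta>. cat \<beta> \<gamma>) ` multiwords k n" for \<gamma> \<delta>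
  proof -
    have "\<gamma> \<in> (\<lambda>\<beta>. cat \<beta> \<gamma>) ` multiwords k n" by (rule image_eqI[of _ _ empty_word]) auto
    then show ?thesis using that by (auto simp: subspace_id_model_basis)
  qed
qed (rule subspace_id_model_bops)

end

text \<open>On the vectors X_gamma \<open>R\<close> e the series phi(X) converges unconditionally,
  being the image under \<open>cadj K\<close> of the expansion of A chi_gamma tensor e. The twists
  of the model and of the tuple cancel.\<close>

lemma (in berezin_tuple) cadj_kernel_fourier:
  assumes c: "fourier_rep k n lam c A" and \<gamma>: "\<gamma> \<in> multiwords k n"
  shows "((\<lambda>\<beta>. c \<beta> *\<^sub>C multiword_op k X \<beta> (multiword_op k X \<gamma> (R e)))
    has_sum cadj K (ell2_tensor (A (ell2_basis \<gamma>)) e)) (multiwords k n)"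
proof -
  have "((\<lambda>\<beta>. cadj K (ell2_tensor ((c \<beta> * twist k lam \<beta> \<gamma>) *\<^sub>C ell2_basis (cat \<beta> \<gamma>)) e))
      has_sum cadj K (ell2_tensor (A (ell2_basis \<gamma>)) e)) (multiwords k n)"
    using has_sum_bounded_linear[OF bounded_linear_compose[OF blinfun.bounded_linear_right[of "cadj K"]
        bounded_linear_tensor_left[of e]] fourier_rep_has_sum[OF unimodular c \<gamma>]] by (simp only: o_def)
  then show ?thesis
    by (rule iffD1[OF has_sum_cong, rotated])
      (simp add: ell2_tensor_scaleC_left clinear_opD[OF clinear_cadj[OF clinear_berezin_kernel]]
        cadj_kernel_tensor cat_in_multiwords \<gamma> multiword_op_mult scaleC_scaleC)
qed


section \<open>Limits of bounded families of operators\<close>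

lemma closed_null_set:
  fixes F :: "'x \<Rightarrow> 'a::real_normed_vector \<Rightarrow>\<^sub>L 'b::real_normed_vector"
  assumes bd: "\<forall>\<^sub>F r in U. norm (F r) \<le> M"
  shows "closed {x. ((\<lambda>r. F r x) \<longlongrightarrow> 0) U}"
  unfolding closed_sequential_limits
proof (intro allI impI, elim conjE, unfold mem_Collect_eq)
  fix s x assume s: "\<forall>m. ((\<lambda>r. F r (s m)) \<longlongrightarrow> 0) U" "s \<longlonglongrightarrow> x"
  \<comment> \<open>The maximum with 1 makes C positive for the division below.\<close>
  define C where "C = max M 1"
  have C: "C > 0" "M \<le> C" by (auto simp: C_def)
  show "((\<lambda>r. F r x) \<longlongrightarrow> 0) U"
  proof (rule tendstoI)
    fix e :: real assume e: "e > 0"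
    then obtain m where m: "norm (s m - x) < e / (2 * C)"
      using LIMSEQ_D[OF s(2), of "e / (2 * C)"] C by auto
    have "\<forall>\<^sub>F r in U. dist (F r (s m)) 0 < e / 2"
      using s(1) e by (intro tendstoD) auto
    then show "\<forall>\<^sub>F r in U. dist (F r x) 0 < e"
      using bd
    proof eventually_elim
      case (elim r)
      have "norm (F r x) \<le> norm (F r (s m)) + norm (F r (s m - x))"
        using norm_triangle_ineq4[of "F r (s m)" "F r (s m - x)"] by (simp add: blinfun.diff_right)
      also have "norm (F r (s m - x)) \<le> C * norm (s m - x)"
        using elim C by (intro order_trans[OF norm_blinfun] mult_right_mono) auto
      also have "C * norm (s m - x) < e / 2" using m C by (simp add: field_simps)
      finally show ?case using elim by simp
    qed
  qed
qed

text \<open>The family is uniformly Lipschitz, so the limits at s m form a Cauchy sequence; its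
  limit is the limit at x by splitting the error into three parts.\<close>

lemma closed_convergence_set:
  fixes F :: "'x \<Rightarrow> 'a::real_normed_vector \<Rightarrow>\<^sub>L 'b::banach"
  assumes U: "U \<noteq> bot" and bd: "\<forall>\<^sub>F r in U. norm (F r) \<le> M"
  shows "closed {x. \<exists>l. ((\<lambda>r. F r x) \<longlongrightarrow> l) U}"
  unfolding closed_sequential_limits
proof (intro allI impI, elim conjE, unfold mem_Collect_eq)
  fix s x assume "\<forall>m. \<exists>l. ((\<lambda>r. F r (s m)) \<longlongrightarrow> l) U" and sx: "s \<longlonglongrightarrow> x"
  then obtain l where l: "\<And>m. ((\<lambda>r. F r (s m)) \<longlongrightarrow> l m) U" by metis
  define C where "C = max M 1"
  have C: "C > 0" "M \<le> C" by (auto simp: C_def)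
  have le: "norm (F r y) \<le> C * norm y" if "norm (F r) \<le> M" for r y
    using that C by (intro order_trans[OF norm_blinfun] mult_right_mono) auto
  have ll: "norm (l m - l j) \<le> C * norm (s m - s j)" for m j
  proof (rule tendsto_upperbound[OF _ _ U])
    show "((\<lambda>r. norm (F r (s m) - F r (s j))) \<longlongrightarrow> norm (l m - l j)) U" by (intro tendsto_intros l)
    show "\<forall>\<^sub>F r in U. norm (F r (s m) - F r (s j)) \<le> C * norm (s m - s j)"
      using bd by eventually_elim (simp add: le flip: blinfun.diff_right)
  qed
  have "Cauchy l"
  proof (rule metric_CauchyI)
    fix e :: real assume e: "e > 0"
    then obtain N where N: "\<forall>m\<ge>N. \<forall>j\<ge>N. dist (s m) (s j) < e / C"
      using metric_CauchyD[OF LIMSEQ_imp_Cauchy[OF sx], of "e / C"] C by auto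
    have "dist (l m) (l j) < e" if "m \<ge> N" "j \<ge> N" for m j
    proof -
      have "C * norm (s m - s j) < e" using N that C by (auto simp: dist_norm field_simps)
      then show ?thesis using ll[of m j] by (simp add: dist_norm)
    qed
    then show "\<exists>N. \<forall>m\<ge>N. \<forall>j\<ge>N. dist (l m) (l j) < e" by blast
  qed
  then obtain l' where l': "l \<longlonglongrightarrow> l'" using Cauchy_convergent convergent_def by blast
  have "((\<lambda>r. F r x) \<longlongrightarrow> l') U"
  proof (rule tendstoI)
    fix e :: real assume e: "e > 0"
    have "\<forall>\<^sub>F m in sequentially. norm (s m - x) < e / (3 * C) \<and> norm (l m - l') < e / 3"
      using tendstoD[OF sx, of "e / (3 * C)"] tendstoD[OF l', of "e / 3"] e C
      by (auto simp: dist_norm intro: eventually_conj)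
    from eventually_happens'[OF sequentially_bot this]
    obtain m where m: "norm (s m - x) < e / (3 * C)" "norm (l m - l') < e / 3" by blast
    have "\<forall>\<^sub>F r in U. dist (F r (s m)) (l m) < e / 3"
      using l e by (intro tendstoD) auto
    then show "\<forall>\<^sub>F r in U. dist (F r x) l' < e"
      using bd
    proof eventually_elim
      case (elim r)
      have "norm (F r (s m - x)) \<le> C * norm (s m - x)" by (rule le[OF elim(2)])
      also have "\<dots> < e / 3" using m(1) C by (simp add: field_simps)
      finally have "dist (F r (s m)) (F r x) < e / 3" by (simp add: dist_norm blinfun.diff_right)
      moreover have "dist (l m) l' < e / 3" using m(2) by (simp add: dist_norm)
      ultimately show ?case
        using elim dist_triangle[of "F r x" l' "F r (s m)"] dist_triangle[of "F r (s m)" l' "l m"]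
        by (simp add: dist_commute)
    qed
  qed
  then show "\<exists>l. ((\<lambda>r. F r x) \<longlongrightarrow> l) U" by blast
qed

lemma closed_subspace_eq_UNIV:
  assumes "closed S" "subspace S" "G \<subseteq> S" "closure (span G) = UNIV"
  shows "S = UNIV"
proof -
  have "closure (span G) \<subseteq> S" by (rule closure_minimal[OF span_minimal]) (use assms in auto)
  then show ?thesis using assms by blast
qed

text \<open>Convergence on a set with dense span spreads to the whole space under the norm bound,
  and linearity and the bound pass to the limit.\<close>

lemma pointwise_limit_exists:
  fixes F :: "'x \<Rightarrow> 'a::real_normed_vector \<Rightarrow>\<^sub>L 'b::banach"
  assumes U: "U \<noteq> bot" and bd: "\<forall>\<^sub>F r in U. norm (F r) \<le> M"
    and G: "\<And>x. x \<in> G \<Longrightarrow> \<exists>l. ((\<lambda>r. F r x) \<longlongrightarrow> l) U" and dense: "closure (span G) = UNIV"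
  shows "\<exists>L. norm L \<le> M \<and> (\<forall>x. ((\<lambda>r. F r x) \<longlongrightarrow> blinfun_apply L x) U)"
proof -
  have M: "0 \<le> M"
    using eventually_happens'[OF U bd] by (auto intro: order_trans[OF norm_ge_zero])
  have "{x. \<exists>l. ((\<lambda>r. F r x) \<longlongrightarrow> l) U} = UNIV"
  proof (rule closed_subspace_eq_UNIV[OF closed_convergence_set[OF U bd] _ _ dense])
    show "subspace {x. \<exists>l. ((\<lambda>r. F r x) \<longlongrightarrow> l) U}"
      unfolding subspace_def
      by (auto simp: blinfun.add_right blinfun.scaleR_right intro: tendsto_add tendsto_scaleR[OF tendsto_const])
  qed (use G in blast)
  then have "\<forall>x. \<exists>l. ((\<lambda>r. F r x) \<longlongrightarrow> l) U" by blast
  then obtain g where g: "\<And>x. ((\<lambda>r. F r x) \<longlongrightarrow> g x) U" by metis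
  have nrm: "norm (g x) \<le> norm x * M" for x
  proof (rule tendsto_upperbound[OF _ _ U])
    show "((\<lambda>r. norm (F r x)) \<longlongrightarrow> norm (g x)) U" by (intro tendsto_intros g)
    show "\<forall>\<^sub>F r in U. norm (F r x) \<le> norm x * M"
      using bd
    proof eventually_elim
      case (elim r)
      have "norm (F r x) \<le> norm (F r) * norm x" by (rule norm_blinfun)
      also have "\<dots> \<le> M * norm x" using elim by (intro mult_right_mono) auto
      finally show ?case by (simp add: mult.commute)
    qed
  qed
  have "bounded_linear g"
  proof (rule bounded_linear_intro[OF _ _ nrm])
    show "g (x + y) = g x + g y" for x y
      using tendsto_unique[OF U g[of "x + y"]] tendsto_add[OF g[of x] g[of y]] by (simp add: blinfun.add_right)
    show "g (r *\<^sub>R x) = r *\<^sub>R g x" for r x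
      using tendsto_unique[OF U g[of "r *\<^sub>R x"]] tendsto_scaleR[OF tendsto_const g[of x]]
      by (simp add: blinfun.scaleR_right)
  qed
  then have ap: "blinfun_apply (Blinfun g) = g" by (rule bounded_linear_Blinfun_apply)
  have "norm (Blinfun g) \<le> M"
    by (rule norm_blinfun_bound[OF M]) (use nrm in \<open>simp add: ap mult.commute[of M]\<close>)
  then show ?thesis using g by (intro exI[of _ "Blinfun g"]) (simp add: ap)
qed

lemma limitin_strong_operator_topology_iff:
  "limitin strong_operator_topology f L U \<longleftrightarrow> (\<forall>x. ((\<lambda>r. f r x) \<longlongrightarrow> blinfun_apply L x) U)"
proof
  assume lim: "limitin strong_operator_topology f L U"
  show "\<forall>x. ((\<lambda>r. f r x) \<longlongrightarrow> L x) U"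
  proof
    fix x
    have "limitin euclidean ((\<lambda>A. blinfun_apply A x) \<circ> f) (L x) U"
      by (rule continuous_map_limit[OF strong_operator_topology_continuous_evaluation lim])
    then show "((\<lambda>r. f r x) \<longlongrightarrow> L x) U" by (simp add: o_def)
  qed
next
  assume lim: "\<forall>x. ((\<lambda>r. f r x) \<longlongrightarrow> L x) U"
  show "limitin strong_operator_topology f L U"
    unfolding limitin_def strong_operator_topology_topspace
  proof (intro conjI allI impI UNIV_I)
    fix V assume "openin strong_operator_topology V \<and> L \<in> V"
    then obtain W where W: "open W" "V = blinfun_apply -` W" "blinfun_apply L \<in> W"
      by (auto simp: strong_operator_topology_def openin_pullback_topology)
    have "((\<lambda>r. blinfun_apply (f r)) \<longlongrightarrow> blinfun_apply L) U"
      using limitin_componentwise[of "\<lambda>_. euclidean" UNIV "\<lambda>r. blinfun_apply (f r)" "blinfun_apply L" U] lim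
      by (simp add: euclidean_product_topology)
    then show "\<forall>\<^sub>F r in U. f r \<in> V" using topological_tendstoD W by fastforce
  qed
qed


section \<open>Tuples in the polyball\<close>

lemma dilate_1 [simp]: "dilate 1 T = T"
  by (simp add: dilate_def)

locale polyball_tuple =
  fixes k :: nat and n :: "nat \<Rightarrow> nat" and lam :: "nat \<Rightarrow> nat \<Rightarrow> nat \<Rightarrow> nat \<Rightarrow> complex"
    and T :: "'h::complex_hilbert op_tuple"
  assumes unimod: "twist_matrices k n lam" and T: "T \<in> polyball k n lam"
begin

lemma T_lin: "i < k \<Longrightarrow> s < n i \<Longrightarrow> clinear_op (T i s)"
  using T by (simp add: polyball_def)

lemma twisted_dilate: "twisted_tuple k n lam (dilate r T)"
proof
  show "dilate r T i s o\<^sub>L dilate r T j t = scale_op (lam i j s t) (dilate r T j t o\<^sub>L dilate r T i s)"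
    if "i < k" "j < k" "i \<noteq> j" "s < n i" "t < n j" for i j s t
  proof (rule blinfun_eqI)
    fix x
    have "T i s o\<^sub>L T j t = scale_op (lam i j s t) (T j t o\<^sub>L T i s)"
      using T that unfolding polyball_def by blast
    from arg_cong[OF this, of "\<lambda>Z. blinfun_apply Z x"]
    show "(dilate r T i s o\<^sub>L dilate r T j t) x = scale_op (lam i j s t) (dilate r T j t o\<^sub>L dilate r T i s) x"
      by (simp add: dilate_def blinfun.scaleR_left blinfun.scaleR_right scaleC_scaleR_commute)
  qed
qed (auto simp: unimod dilate_def clinear_scaleR T_lin)

sublocale twisted_tuple k n lam T
  using twisted_dilate[of 1] by simp

lemma row_contraction_dilate:
  assumes "i < k"
  shows "cp_form (n i) (dilate r T i) (\<lambda>h. (norm h)\<^sup>2) h \<le> r\<^sup>2 * (norm h)\<^sup>2"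
proof -
  have "nonneg_op (id_blinfun - (\<Sum>s<n i. T i s o\<^sub>L cadj (T i s)))"
    using T assms by (simp add: polyball_def)
  from nonneg_opD(1)[OF this, of h]
  have "Re (\<Sum>s<n i. cinner (T i s (cadj (T i s) h)) h) \<le> (norm h)\<^sup>2"
    by (simp add: blinfun.diff_left blinfun.sum_left cinner_diff_left cinner_sum_left cinner_self)
  also have "(\<Sum>s<n i. cinner (T i s (cadj (T i s) h)) h) = (\<Sum>s<n i. of_real ((norm (cadj (T i s) h))\<^sup>2))"
    using assms by (intro sum.cong refl) (simp add: T_lin cinner_self flip: cinner_cadj_right)
  finally have "(\<Sum>s<n i. (norm (cadj (T i s) h))\<^sup>2) \<le> (norm h)\<^sup>2" by simp
  then have "r\<^sup>2 * (\<Sum>s<n i. (norm (cadj (T i s) h))\<^sup>2) \<le> r\<^sup>2 * (norm h)\<^sup>2" by (rule mult_left_mono) simp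
  then show ?thesis
    using assms by (simp add: cp_form_def dilate_def cadj_scaleR_apply T_lin power_mult_distrib sum_distrib_left)
qed

lemma square_less_1: "0 \<le> r \<Longrightarrow> r < 1 \<Longrightarrow> 0 \<le> r\<^sup>2 \<and> r\<^sup>2 < (1::real)"
  by (simp add: power_less_one_iff)

lemma nonneg_defect_dilate: "0 \<le> r \<Longrightarrow> r < 1 \<Longrightarrow> nonneg_op (defect k n (dilate r T))"
  using T by (simp add: polyball_def)

lemma defect_dilate_has_sum:
  assumes r: "0 \<le> r" "r < 1"
  shows "((\<lambda>\<beta>. op_form (defect k n (dilate r T)) (adj_word k (dilate r T) \<beta> h)) has_sum (norm h)\<^sup>2) (multiwords k n)"
proof -
  interpret X: twisted_tuple k n lam "dilate r T" by (rule twisted_dilate)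
  show ?thesis
    by (rule X.defect_has_sum[of "r\<^sup>2"]) (use square_less_1[OF r] row_contraction_dilate nonneg_defect_dilate[OF r] in auto)
qed

lemma berezin_dilate:
  assumes r: "0 \<le> r" "r < 1"
  shows "berezin_tuple k n lam (dilate r T)"
proof -
  interpret X: twisted_tuple k n lam "dilate r T" by (rule twisted_dilate)
  show ?thesis
  proof
    show "(\<Sum>\<beta>\<in>F. op_form (defect k n (dilate r T)) (adj_word k (dilate r T) \<beta> h)) \<le> (norm h)\<^sup>2"
      if "finite F" "F \<subseteq> multiwords k n" for F h
      by (rule finite_sum_le_has_sum[OF defect_dilate_has_sum[OF r]])
        (use that nonneg_opD(1)[OF nonneg_defect_dilate[OF r]] in \<open>auto simp: op_form_def\<close>)
  qed (rule nonneg_defect_dilate[OF r])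
qed

lemma adj_word_dilate:
  assumes "\<beta> \<in> multiwords k n"
  shows "adj_word k (dilate r T) \<beta> h = r ^ multilength k \<beta> *\<^sub>R adj_word k T \<beta> h"
proof -
  interpret X: twisted_tuple k n lam "dilate r T" by (rule twisted_dilate)
  show ?thesis
    using assms by (simp add: X.adj_word_eq_cadj adj_word_eq_cadj multiword_op_dilate cadj_scaleR_apply clinear_multiword)
qed

text \<open>The polyball condition speaks only about r < 1. Norm continuity of the defect at r = 1
  is what transfers positivity to T.\<close>

lemma defect_dilate_tendsto: "((\<lambda>r. defect k n (dilate r T)) \<longlongrightarrow> defect k n T) (at_left 1)"
proof -
  have r: "((\<lambda>r::real. r) \<longlongrightarrow> 1) (at_left 1)" by (rule tendsto_ident_at)
  have cadj_eq: "cadj (dilate r T i s) = r *\<^sub>R cadj (T i s)" if "i < k" "s < n i" for r i s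
    by (rule blinfun_eqI) (simp add: dilate_def cadj_scaleR_apply T_lin that blinfun.scaleR_left)
  have cp: "((\<lambda>r. cp_map (n i) (dilate r T i) (Y r)) \<longlongrightarrow> cp_map (n i) (T i) Y0) (at_left 1)"
    if i: "i < k" and Y: "(Y \<longlongrightarrow> Y0) (at_left 1)" for i Y Y0
    unfolding cp_map_def
  proof (rule tendsto_sum)
    fix s assume "s \<in> {..<n i}"
    then have s: "s < n i" by simp
    have "((\<lambda>r. (r *\<^sub>R T i s) o\<^sub>L (Y r o\<^sub>L (r *\<^sub>R cadj (T i s)))) \<longlongrightarrow>
        (1 *\<^sub>R T i s) o\<^sub>L (Y0 o\<^sub>L (1 *\<^sub>R cadj (T i s)))) (at_left 1)"
      by (intro bounded_bilinear.tendsto[OF bounded_bilinear_blinfun_compose] tendsto_scaleR r Y tendsto_const)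
    moreover have "(A o\<^sub>L B) o\<^sub>L C = A o\<^sub>L (B o\<^sub>L C)" for A B C :: "'h \<Rightarrow>\<^sub>L 'h"
      by (rule blinfun_eqI) simp
    ultimately show "((\<lambda>r. dilate r T i s o\<^sub>L Y r o\<^sub>L cadj (dilate r T i s)) \<longlongrightarrow> T i s o\<^sub>L Y0 o\<^sub>L cadj (T i s)) (at_left 1)"
      by (simp add: cadj_eq[OF i s]) (simp add: dilate_def)
  qed
  have "((\<lambda>r. fold (\<lambda>i Y. Y - cp_map (n i) (dilate r T i) Y) js (Y r))
      \<longlongrightarrow> fold (\<lambda>i Y. Y - cp_map (n i) (T i) Y) js Y0) (at_left 1)"
    if "set js \<subseteq> {..<k}" "(Y \<longlongrightarrow> Y0) (at_left 1)" for js Y Y0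
    using that by (induction js arbitrary: Y Y0) (auto intro!: tendsto_diff cp)
  from this[of "[0..<k]" "\<lambda>_. id_blinfun" id_blinfun] show ?thesis
    by (simp add: defect_def lessThan_atLeast0)
qed

lemma eventually_at_left_1: "\<forall>\<^sub>F r in at_left (1::real). 0 < r \<and> r < 1"
  unfolding eventually_at_left_field by (intro exI[of _ 0]) auto

text \<open>Both assumptions are limits of those for rT. The Bessel inequality involves only finite
  sums, so the limit can be taken termwise, with r^|beta| tending to 1.\<close>

lemma berezin_self: "berezin_tuple k n lam T"
proof
  have pt: "((\<lambda>r. cinner (defect k n (dilate r T) x) x) \<longlongrightarrow> cinner (defect k n T x) x) (at_left 1)" for x
    by (intro tendsto_cinner blinfun.tendsto defect_dilate_tendsto tendsto_const)
  have nn: "\<forall>\<^sub>F r in at_left 1. nonneg_op (defect k n (dilate r T))"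
    using eventually_at_left_1 by eventually_elim (simp add: nonneg_defect_dilate)
  show "nonneg_op (defect k n T)"
  proof (rule nonneg_opI)
    fix x
    show "0 \<le> Re (cinner (defect k n T x) x)"
      by (rule tendsto_lowerbound[OF tendsto_Re[OF pt]]) (use nn in \<open>auto elim!: eventually_mono dest: nonneg_opD\<close>)
    show "Im (cinner (defect k n T x) x) = 0"
    proof (rule tendsto_unique[OF _ tendsto_Im[OF pt]])
      have "\<forall>\<^sub>F r in at_left 1. 0 = Im (cinner (defect k n (dilate r T) x) x)"
        using nn by eventually_elim (simp add: nonneg_opD)
      then show "((\<lambda>r. Im (cinner (defect k n (dilate r T) x) x)) \<longlongrightarrow> 0) (at_left 1)"
        by (rule tendsto_cong[THEN iffD1, OF _ tendsto_const])
    qed simp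
  qed
  fix F h assume F: "finite F" "F \<subseteq> multiwords k n"
  show "(\<Sum>\<beta>\<in>F. op_form (defect k n T) (adj_word k T \<beta> h)) \<le> (norm h)\<^sup>2"
  proof (rule tendsto_upperbound)
    have "((\<lambda>r. op_form (defect k n (dilate r T)) (r ^ multilength k \<beta> *\<^sub>R adj_word k T \<beta> h))
        \<longlongrightarrow> op_form (defect k n T) (1 ^ multilength k \<beta> *\<^sub>R adj_word k T \<beta> h)) (at_left 1)" for \<beta>
      unfolding op_form_def
      by (intro tendsto_intros tendsto_cinner blinfun.tendsto defect_dilate_tendsto tendsto_ident_at)
    then show "((\<lambda>r. \<Sum>\<beta>\<in>F. op_form (defect k n (dilate r T)) (r ^ multilength k \<beta> *\<^sub>R adj_word k T \<beta> h))
        \<longlongrightarrow> (\<Sum>\<beta>\<in>F. op_form (defect k n T) (adj_word k T \<beta> h))) (at_left 1)"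
      by (intro tendsto_sum) simp
    show "\<forall>\<^sub>F r in at_left 1. (\<Sum>\<beta>\<in>F. op_form (defect k n (dilate r T)) (r ^ multilength k \<beta> *\<^sub>R adj_word k T \<beta> h)) \<le> (norm h)\<^sup>2"
      using eventually_at_left_1
    proof eventually_elim
      case (elim r)
      then interpret X: berezin_tuple k n lam "dilate r T" by (intro berezin_dilate) auto
      show ?case using X.defect_sum_le[OF F, of h] F(2) by (simp add: adj_word_dilate subset_iff)
    qed
  qed simp
qed

sublocale berezin_tuple k n lam T by (rule berezin_self)

text \<open>Dual to \<open>sum_norm_adj_word_le\<close>: for the image z of x, the squared norm of z
  is a sum of inner products of c_beta x with adjoint words applied to z. Cauchy-Schwarz over B
  leaves one squared norm of z on the right, which is cancelled.\<close>

lemma norm_row_combination_le: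
  assumes B: "finite B" "B \<subseteq> multiwords k n" and r: "0 \<le> r" "r < 1"
  shows "norm (\<Sum>\<beta>\<in>B. scale_op (c \<beta>) (multiword_op k (dilate r T) \<beta>))
    \<le> sqrt ((1 / (1 - r\<^sup>2)) ^ k * (\<Sum>\<beta>\<in>B. (cmod (c \<beta>))\<^sup>2))"
proof (rule norm_blinfun_bound)
  interpret X: twisted_tuple k n lam "dilate r T" by (rule twisted_dilate)
  let ?C = "(1 / (1 - r\<^sup>2)) ^ k" and ?Z = "\<Sum>\<beta>\<in>B. scale_op (c \<beta>) (multiword_op k (dilate r T) \<beta>)"
  let ?S = "\<Sum>\<beta>\<in>B. (cmod (c \<beta>))\<^sup>2"
  have C: "0 \<le> ?C" using square_less_1[OF r] by simp
  show "0 \<le> sqrt (?C * ?S)" using C by (simp add: sum_nonneg)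
  fix x
  define z where "z = ?Z x"
  have zz: "inner z z \<le> (\<Sum>\<beta>\<in>B. (cmod (c \<beta>) * norm x) * norm (adj_word k (dilate r T) \<beta> z))"
    unfolding z_def[symmetric]
  proof -
    have "inner z z = (\<Sum>\<beta>\<in>B. inner (multiword_op k (dilate r T) \<beta> (c \<beta> *\<^sub>C x)) z)"
      unfolding z_def blinfun.sum_left inner_sum_left
      using B by (intro sum.cong refl) (auto simp: clinear_opD[OF X.clinear_multiword])
    also have "\<dots> \<le> (\<Sum>\<beta>\<in>B. (cmod (c \<beta>) * norm x) * norm (adj_word k (dilate r T) \<beta> z))"
    proof (rule sum_mono)
      fix \<beta> assume "\<beta> \<in> B"
      then have \<beta>: "\<beta> \<in> multiwords k n" using B by blast
      have "inner (multiword_op k (dilate r T) \<beta> (c \<beta> *\<^sub>C x)) z = inner (c \<beta> *\<^sub>C x) (adj_word k (dilate r T) \<beta> z)"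
        by (simp add: X.adj_word_eq_cadj[OF \<beta>] cinner_cadj_right[OF X.clinear_multiword[OF \<beta>]] flip: Re_cinner)
      also have "\<dots> \<le> norm (c \<beta> *\<^sub>C x) * norm (adj_word k (dilate r T) \<beta> z)" by (rule norm_cauchy_schwarz)
      finally show "inner (multiword_op k (dilate r T) \<beta> (c \<beta> *\<^sub>C x)) z
          \<le> (cmod (c \<beta>) * norm x) * norm (adj_word k (dilate r T) \<beta> z)" by (simp add: norm_scaleC)
    qed
    finally show ?thesis .
  qed
  have "((norm z)\<^sup>2)\<^sup>2 \<le> (\<Sum>\<beta>\<in>B. (cmod (c \<beta>) * norm x) * norm (adj_word k (dilate r T) \<beta> z))\<^sup>2"
    using zz by (intro power_mono) (auto simp: power2_norm_eq_inner)
  also have "\<dots> \<le> (\<Sum>\<beta>\<in>B. (cmod (c \<beta>) * norm x)\<^sup>2) * (\<Sum>\<beta>\<in>B. (norm (adj_word k (dilate r T) \<beta> z))\<^sup>2)"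
    by (rule Cauchy_Schwarz_ineq_sum)
  also have "\<dots> \<le> (\<Sum>\<beta>\<in>B. (cmod (c \<beta>) * norm x)\<^sup>2) * (?C * (norm z)\<^sup>2)"
    by (intro mult_left_mono X.sum_norm_adj_word_le[of "r\<^sup>2"] B)
      (use square_less_1[OF r] row_contraction_dilate in \<open>auto intro: sum_nonneg\<close>)
  also have "\<dots> = (?C * ?S * (norm x)\<^sup>2) * (norm z)\<^sup>2"
    by (simp add: power_mult_distrib sum_distrib_right sum_distrib_left mult_ac)
  finally have "(norm z)\<^sup>2 * (norm z)\<^sup>2 \<le> (?C * ?S * (norm x)\<^sup>2) * (norm z)\<^sup>2"
    unfolding power2_eq_square[of "(norm z)\<^sup>2"] .
  then have "(norm z)\<^sup>2 \<le> ?C * ?S * (norm x)\<^sup>2"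
    using C by (cases "z = 0") (auto simp: sum_nonneg intro: mult_right_le_imp_le[of _ "(norm z)\<^sup>2"])
  then have "norm z \<le> sqrt (?C * ?S * (norm x)\<^sup>2)" by (rule real_le_rsqrt)
  then show "norm (?Z x) \<le> sqrt (?C * ?S) * norm x" by (simp add: z_def real_sqrt_mult)
qed

lemma summable_series:
  assumes c: "(\<lambda>\<beta>. (cmod (c \<beta>))\<^sup>2) summable_on multiwords k n" and r: "0 \<le> r" "r < 1"
  shows "summable (\<lambda>p. \<Sum>\<beta> | \<beta> \<in> multiwords k n \<and> multilength k \<beta> = p.
    scale_op (of_real (r ^ p) * c \<beta>) (multiword_op k T \<beta>))"
proof -
  \<comment> \<open>A radius strictly between r and 1: the p-th term is (r /
    \<open>\<rho>\<close>)^p times a combination of words in the dilation by \<open>\<rho>\<close>,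
    bounded uniformly in p.\<close>
  define \<rho> where "\<rho> = (r + 1) / 2"
  have \<rho>: "0 < \<rho>" "\<rho> < 1" "r < \<rho>" using r by (auto simp: \<rho>_def)
  let ?B = "\<lambda>p. {\<beta>. \<beta> \<in> multiwords k n \<and> multilength k \<beta> = p}"
  let ?M = "sqrt ((1 / (1 - \<rho>\<^sup>2)) ^ k * infsum (\<lambda>\<beta>. (cmod (c \<beta>))\<^sup>2) (multiwords k n))"
  show ?thesis
  proof (rule summable_comparison_test'[where N = 0])
    show "summable (\<lambda>p. (r / \<rho>) ^ p * ?M)"
      using r \<rho> by (intro summable_mult2 summable_geometric) auto
    fix p
    have "(\<Sum>\<beta>\<in>?B p. scale_op (of_real (r ^ p) * c \<beta>) (multiword_op k T \<beta>))
        = (r / \<rho>) ^ p *\<^sub>R (\<Sum>\<beta>\<in>?B p. scale_op (c \<beta>) (multiword_op k (dilate \<rho> T) \<beta>))"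
    proof (rule blinfun_eqI)
      fix x
      have "(of_real (r ^ p) * c \<beta>) *\<^sub>C y = (r / \<rho>) ^ p *\<^sub>R \<rho> ^ p *\<^sub>R c \<beta> *\<^sub>C y" for \<beta> and y :: 'h
        using \<rho> by (simp flip: scaleC_scaleC scaleC_of_real add: power_divide)
          (simp add: scaleC_scaleC flip: of_real_mult of_real_power)
      then show "(\<Sum>\<beta>\<in>?B p. scale_op (of_real (r ^ p) * c \<beta>) (multiword_op k T \<beta>)) x
          = ((r / \<rho>) ^ p *\<^sub>R (\<Sum>\<beta>\<in>?B p. scale_op (c \<beta>) (multiword_op k (dilate \<rho> T) \<beta>))) x"
        by (simp add: blinfun.sum_left blinfun.scaleR_left multiword_op_dilate scaleC_scaleR_commute scaleR_sum_right)
    qed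
    then have "norm (\<Sum>\<beta>\<in>?B p. scale_op (of_real (r ^ p) * c \<beta>) (multiword_op k T \<beta>))
        = (r / \<rho>) ^ p * norm (\<Sum>\<beta>\<in>?B p. scale_op (c \<beta>) (multiword_op k (dilate \<rho> T) \<beta>))"
      using r \<rho> by simp
    also have "\<dots> \<le> (r / \<rho>) ^ p * sqrt ((1 / (1 - \<rho>\<^sup>2)) ^ k * (\<Sum>\<beta>\<in>?B p. (cmod (c \<beta>))\<^sup>2))"
      using r \<rho> finite_multilength_eq by (intro mult_left_mono norm_row_combination_le) auto
    also have "\<dots> \<le> (r / \<rho>) ^ p * ?M"
      using r \<rho> finite_multilength_eq square_less_1[of \<rho>]
      by (intro mult_left_mono real_sqrt_le_mono finite_sum_le_infsum[OF c]) auto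
    finally show "norm (\<Sum>\<beta>\<in>?B p. scale_op (of_real (r ^ p) * c \<beta>) (multiword_op k T \<beta>)) \<le> (r / \<rho>) ^ p * ?M" .
  qed
qed

text \<open>Connects the norm-convergent series grouped by length with an unconditional sum at one
  vector. Pairing with w reduces the regrouping to scalar sums.\<close>

lemma series_at_eqI:
  assumes c: "(\<lambda>\<beta>. (cmod (c \<beta>))\<^sup>2) summable_on multiwords k n" and r: "0 \<le> r" "r < 1"
    and y: "((\<lambda>\<beta>. (of_real (r ^ multilength k \<beta>) * c \<beta>) *\<^sub>C multiword_op k T \<beta> x) has_sum y) (multiwords k n)"
  shows "series_at k n c r T x = y"
proof -
  let ?B = "\<lambda>p. {\<beta>. \<beta> \<in> multiwords k n \<and> multilength k \<beta> = p}"
  let ?f = "\<lambda>\<beta>. (of_real (r ^ multilength k \<beta>) * c \<beta>) *\<^sub>C multiword_op k T \<beta> x"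
  let ?a = "\<lambda>p. \<Sum>\<beta>\<in>?B p. scale_op (of_real (r ^ p) * c \<beta>) (multiword_op k T \<beta>)"
  have "bij_betw snd (Sigma UNIV ?B) (multiwords k n)"
    by (rule bij_betw_byWitness[where f' = "\<lambda>\<beta>. (multilength k \<beta>, \<beta>)"]) auto
  note bij = this
  show ?thesis
  proof (rule cinner_eqI_left)
    fix w
    let ?g = "\<lambda>\<beta>. cinner (?f \<beta>) w"
    have "(?g has_sum cinner y w) (multiwords k n)"
      by (rule has_sum_bounded_linear[OF bounded_linear_cinner_left y, unfolded o_def])
    then have "((\<lambda>z. ?g (snd z)) has_sum cinner y w) (Sigma UNIV ?B)"
      using has_sum_reindex_bij_betw[OF bij, of ?g "cinner y w"] by simp
    then have "((\<lambda>(p, \<beta>). ?g \<beta>) has_sum cinner y w) (Sigma UNIV ?B)" by (simp add: case_prod_unfold)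
    moreover have "((\<lambda>\<beta>. (\<lambda>(p, \<beta>). ?g \<beta>) (p, \<beta>)) has_sum cinner (?a p x) w) (?B p)" for p
      by (rule has_sum_finiteI[OF finite_multilength_eq]) (simp add: blinfun.sum_left cinner_sum_left)
    ultimately have "((\<lambda>p. cinner (?a p x) w) has_sum cinner y w) UNIV"
      by (intro has_sum_Sigma'[where f = "\<lambda>(p, \<beta>). ?g \<beta>" and B = ?B]) auto
    then have "(\<lambda>p. cinner (?a p x) w) sums cinner y w" by (rule has_sum_imp_sums)
    moreover have "(\<lambda>p. cinner (?a p x) w) sums cinner (suminf ?a x) w"
      by (rule bounded_linear.sums[OF bounded_linear_compose[OF bounded_linear_cinner_left blinfun.bounded_linear_left]
            summable_sums[OF summable_series[OF c r]]])
    ultimately show "cinner (series_at k n c r T x) w = cinner y w"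
      unfolding series_at_def by (rule sums_unique2[symmetric])
  qed
qed

text \<open>The defect sum says that the kernel preserves norms; then I minus \<open>cadj\<close> of
  the kernel times the kernel is complex linear with zero form, hence 0.\<close>

lemma isometry_dilate:
  assumes r: "0 \<le> r" "r < 1"
  shows "cadj (berezin_kernel k n (dilate r T)) (berezin_kernel k n (dilate r T) h) = h"
proof -
  interpret X: berezin_tuple k n lam "dilate r T" by (rule berezin_dilate[OF r])
  have nrm: "(norm (X.K h))\<^sup>2 = (norm h)\<^sup>2" for h
  proof -
    have "(norm (X.K h))\<^sup>2 = (\<Sum>\<^sub>\<infinity>\<beta>\<in>multiwords k n. op_form (defect k n (dilate r T)) (adj_word k (dilate r T) \<beta> h))"
      unfolding norm_ell2_sq by (rule infsum_cong_neutral) (auto simp: X.berezin_kernel_nth X.norm_R_sq)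
    also have "\<dots> = (norm h)\<^sup>2" by (rule infsumI[OF defect_dilate_has_sum[OF r]])
    finally show ?thesis .
  qed
  define P where "P = id_blinfun - (cadj X.K o\<^sub>L X.K)"
  have "cinner (P x) x = 0" for x
    using nrm[of x] by (simp add: P_def blinfun.diff_left cinner_diff_left cinner_self
        cinner_cadj_left[OF X.clinear_berezin_kernel] flip: of_real_power)
  moreover have "clinear_op P"
    unfolding P_def by (intro clinear_diff clinear_comp clinear_cadj X.clinear_berezin_kernel clinear_id)
  ultimately have "P h = 0" by (intro nonneg_op_zeroD nonneg_opI) auto
  then show ?thesis by (simp add: P_def blinfun.diff_left)
qed

lemma fourier_rep_summable: "fourier_rep k n lam c A \<Longrightarrow> (\<lambda>\<beta>. (cmod (c \<beta>))\<^sup>2) summable_on multiwords k n"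
  by (simp add: fourier_rep_def)

lemma berezin_transform_dilate:
  assumes c: "fourier_rep k n lam c A" and r: "0 \<le> r" "r < 1"
  shows "berezin_transform k n (dilate r T) A = series_at k n c r T"
proof (rule blinfun_eqI)
  fix h
  interpret X: berezin_tuple k n lam "dilate r T" by (rule berezin_dilate[OF r])
  note A = fourier_rep_bops[OF unimod c]
  have "series_at k n c r T (multiword_op k (dilate r T) \<gamma> (X.R e)) = cadj X.K (ell2_tensor (A (ell2_basis \<gamma>)) e)"
    if \<gamma>: "\<gamma> \<in> multiwords k n" for \<gamma> e
  proof (rule series_at_eqI[OF fourier_rep_summable[OF c] r])
    show "((\<lambda>\<beta>. (of_real (r ^ multilength k \<beta>) * c \<beta>) *\<^sub>C multiword_op k T \<beta> (multiword_op k (dilate r T) \<gamma> (X.R e)))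
        has_sum cadj X.K (ell2_tensor (A (ell2_basis \<gamma>)) e)) (multiwords k n)"
      using X.cadj_kernel_fourier[OF c \<gamma>, of e]
      by (simp add: multiword_op_dilate blinfun.scaleR_left scaleC_scaleC mult.commute flip: scaleC_of_real)
  qed
  from X.cadj_kernel_intertwine[OF A this, of h]
  show "berezin_transform k n (dilate r T) A h = series_at k n c r T h"
    by (simp add: X.berezin_transform_apply[OF A] isometry_dilate[OF r])
qed

end


section \<open>Operator topologies and matrix norms\<close>

lemma weak_operator_topology_evaluation:
  "continuous_map weak_operator_topology euclidean (\<lambda>A. cinner (blinfun_apply A x) y)"
proof -
  have "continuous_map weak_operator_topology euclidean
      ((\<lambda>g. g (x, y)) \<circ> (\<lambda>A (x, y). cinner (blinfun_apply A x) y))"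
    unfolding weak_operator_topology_def
    by (rule continuous_map_pullback) (simp add: continuous_on_product_coordinates)
  then show ?thesis by (simp add: o_def)
qed

lemma continuous_map_weak_operator_topologyI:
  assumes "\<And>x y. continuous_map X euclidean (\<lambda>a. cinner (blinfun_apply (f a) x) y)"
  shows "continuous_map X weak_operator_topology f"
  unfolding weak_operator_topology_def
proof (rule continuous_map_pullback')
  have "continuous_map X (product_topology (\<lambda>_. euclidean) UNIV) (\<lambda>a (x, y). cinner (blinfun_apply (f a) x) y)"
    unfolding continuous_map_componentwise_UNIV using assms by (simp add: split_beta)
  then show "continuous_map X euclidean ((\<lambda>A (x, y). cinner (blinfun_apply A x) y) \<circ> f)"
    by (simp add: o_def euclidean_product_topology)
qed auto

lemma weak_star_topology_evaluation:
  "continuous_map weak_star_topology euclidean (\<lambda>A. cinner (blinfun_apply A x) y)"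
proof -
  define I where "I = {(x :: nat \<Rightarrow> 'a, y :: nat \<Rightarrow> 'b).
    summable (\<lambda>m. (norm (x m))\<^sup>2) \<and> summable (\<lambda>m. (norm (y m))\<^sup>2)}"
  \<comment> \<open>Sequences concentrated at index 0 turn the defining series into the functional
    of a rank-one operator.\<close>
  define xs ys where "xs m = (if m = 0 then x else 0)" and "ys m = (if m = 0 then y else 0)" for m :: nat
  have "summable (\<lambda>m. (norm (xs m))\<^sup>2)" "summable (\<lambda>m. (norm (ys m))\<^sup>2)"
    by (rule summable_finite[of "{0}"]; simp add: xs_def ys_def)+
  then have I: "(xs, ys) \<in> I" by (simp add: I_def)
  have "continuous_map weak_star_topology euclidean
      ((\<lambda>g. g (xs, ys)) \<circ> (\<lambda>A. \<lambda>(x, y)\<in>I. \<Sum>m. cinner (blinfun_apply A (x m)) (y m)))"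
    unfolding weak_star_topology_def Let_def I_def[symmetric]
    by (rule continuous_map_pullback) (rule continuous_map_product_projection[OF I])
  moreover have "(\<Sum>m. cinner (blinfun_apply A (xs m)) (ys m)) = cinner (blinfun_apply A x) y" for A
    by (subst suminf_finite[of "{0}"]) (auto simp: xs_def ys_def)
  ultimately show ?thesis using I by (simp add: o_def)
qed

lemma continuous_map_weak_star_topologyI:
  fixes f :: "'x \<Rightarrow> 'b::complex_hilbert \<Rightarrow>\<^sub>L 'c::complex_hilbert"
  assumes "\<And>x y. summable (\<lambda>m. (norm (x m))\<^sup>2) \<Longrightarrow> summable (\<lambda>m. (norm (y m))\<^sup>2) \<Longrightarrow>
    continuous_map X euclidean (\<lambda>a. \<Sum>m. cinner (blinfun_apply (f a) (x m)) (y m))"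
  shows "continuous_map X weak_star_topology f"
  unfolding weak_star_topology_def Let_def
proof (rule continuous_map_pullback')
  let ?I = "{(x :: nat \<Rightarrow> 'b, y :: nat \<Rightarrow> 'c).
    summable (\<lambda>m. (norm (x m))\<^sup>2) \<and> summable (\<lambda>m. (norm (y m))\<^sup>2)}"
  show "continuous_map X (product_topology (\<lambda>_. euclidean) ?I)
      ((\<lambda>A. \<lambda>(x, y)\<in>?I. \<Sum>m. cinner (blinfun_apply A (x m)) (y m)) \<circ> f)"
    unfolding continuous_map_componentwise using assms by auto
qed auto

text \<open>On a norm-bounded set, the vectors at which evaluation is continuous form a closed subspace.\<close>

lemma continuous_evaluation_dense:
  fixes f :: "'x \<Rightarrow> 'a::real_normed_vector \<Rightarrow>\<^sub>L 'b::real_normed_vector"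
    and g :: "'b \<Rightarrow> 'c::real_normed_vector"
  assumes bd: "\<And>a. a \<in> topspace X \<Longrightarrow> norm (f a) \<le> M" and g: "bounded_linear g"
    and G: "\<And>x. x \<in> G \<Longrightarrow> continuous_map X euclidean (\<lambda>a. g (f a x))"
    and dense: "closure (span G) = UNIV"
  shows "continuous_map X euclidean (\<lambda>a. g (f a x))"
proof -
  interpret g: bounded_linear g by fact
  obtain B where B: "\<And>x. norm (g x) \<le> norm x * B" "0 < B" using g.pos_bounded by blast
  define C where "C = max M 1 * B"
  have C: "0 < C" using B by (simp add: C_def)
  let ?S = "{x. continuous_map X euclidean (\<lambda>a. g (f a x))}"
  have le: "norm (g (f a x)) \<le> C * norm x" if "a \<in> topspace X" for a x
  proof -
    have "norm (f a x) \<le> max M 1 * norm x"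
      using bd[OF that] by (intro order_trans[OF norm_blinfun] mult_right_mono) auto
    then have "norm (f a x) * B \<le> max M 1 * norm x * B" using B by (intro mult_right_mono) auto
    then show ?thesis using B(1)[of "f a x"] by (simp add: C_def mult_ac)
  qed
  have "closed ?S"
    unfolding closed_sequential_limits
  proof (intro allI impI, elim conjE, unfold mem_Collect_eq)
    fix s x assume s: "\<forall>m. continuous_map X euclidean (\<lambda>a. g (f a (s m)))" "s \<longlonglongrightarrow> x"
    have "continuous_map X (Met_TC.mtopology) (\<lambda>a. g (f a x))"
    proof (rule Met_TC.continuous_map_uniform_limit[where F = sequentially and f = "\<lambda>m a. g (f a (s m))"])
      show "\<forall>\<^sub>F m in sequentially. continuous_map X Met_TC.mtopology (\<lambda>a. g (f a (s m)))"
        using s(1) by simp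
      fix e :: real assume e: "0 < e"
      then have "\<forall>\<^sub>F m in sequentially. dist (s m) x < e / C"
        using C by (intro tendstoD s) auto
      then show "\<forall>\<^sub>F m in sequentially. \<forall>a\<in>topspace X. g (f a x) \<in> UNIV \<and> dist (g (f a (s m))) (g (f a x)) < e"
      proof eventually_elim
        case (elim m)
        have "C * norm (s m - x) < e" using elim C by (simp add: dist_norm field_simps)
        then show ?case
          using le[of _ "s m - x"] by (force simp: dist_norm blinfun.diff_right g.diff)
      qed
    qed simp
    then show "continuous_map X euclidean (\<lambda>a. g (f a x))" by simp
  qed
  moreover have "subspace ?S"
  proof (rule subspaceI)
    show "c *\<^sub>R x \<in> ?S" if "x \<in> ?S" for c x
    proof -
      have "continuous_map X euclidean ((\<lambda>z. c *\<^sub>R z) \<circ> (\<lambda>a. g (f a x)))"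
        using that by (intro continuous_map_compose[where X' = euclidean]) (auto intro: continuous_intros)
      then show ?thesis by (simp add: o_def blinfun.scaleR_right g.scaleR)
    qed
  qed (auto simp: g.zero g.add blinfun.add_right intro: continuous_map_add)
  moreover have "G \<subseteq> ?S" using G by blast
  ultimately have "?S = UNIV" by (rule closed_subspace_eq_UNIV[OF _ _ _ dense])
  then show ?thesis by blast
qed

lemma continuous_map_bounded_linear:
  assumes "bounded_linear g" "continuous_map X euclidean f"
  shows "continuous_map X euclidean (\<lambda>a. g (f a))"
  using continuous_map_compose[of X euclidean f euclidean g] assms
  by (simp add: o_def linear_continuous_on)

section \<open>Norms of operator matrices\<close>

lemma op_matrix_norm_le:
  fixes A :: "nat \<Rightarrow> nat \<Rightarrow> 'a::complex_hilbert \<Rightarrow>\<^sub>L 'b::complex_hilbert"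
  assumes "0 \<le> C"
    and "\<And>x. (\<Sum>j<m. (norm (x j))\<^sup>2) \<le> 1 \<Longrightarrow> (\<Sum>i<m. (norm (\<Sum>j<m. blinfun_apply (A i j) (x j)))\<^sup>2) \<le> C\<^sup>2"
  shows "op_matrix_norm m A \<le> C"
  unfolding op_matrix_norm_def
proof (rule cSUP_least)
  show "{x :: nat \<Rightarrow> 'a. (\<Sum>j<m. (norm (x j))\<^sup>2) \<le> 1} \<noteq> {}"
    by (auto intro!: exI[of _ "\<lambda>_. 0"])
  fix x :: "nat \<Rightarrow> 'a" assume "x \<in> {x. (\<Sum>j<m. (norm (x j))\<^sup>2) \<le> 1}"
  then show "sqrt (\<Sum>i<m. (norm (\<Sum>j<m. A i j (x j)))\<^sup>2) \<le> C"
    by (intro real_le_lsqrt assms) auto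
qed

lemma op_matrix_norm_bound:
  fixes A :: "nat \<Rightarrow> nat \<Rightarrow> 'a::complex_hilbert \<Rightarrow>\<^sub>L 'b::complex_hilbert"
  shows "0 \<le> op_matrix_norm m A"
    and "(\<Sum>i<m. (norm (\<Sum>j<m. A i j (x j)))\<^sup>2) \<le> (op_matrix_norm m A)\<^sup>2 * (\<Sum>j<m. (norm (x j))\<^sup>2)"
proof -
  let ?U = "{x :: nat \<Rightarrow> 'a. (\<Sum>j<m. (norm (x j))\<^sup>2) \<le> 1}"
  let ?h = "\<lambda>x. sqrt (\<Sum>i<m. (norm (\<Sum>j<m. A i j (x j)))\<^sup>2)"
  \<comment> \<open>The real supremum in \<open>op_matrix_norm\<close> is an upper bound only once
    the set is known to be bounded above.\<close>
  have "?h x \<le> sqrt (\<Sum>i<m. (\<Sum>j<m. norm (A i j))\<^sup>2)" if x: "x \<in> ?U" for x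
  proof -
    have xj: "norm (x j) \<le> 1" if "j < m" for j
    proof -
      have "(norm (x j))\<^sup>2 \<le> (\<Sum>j<m. (norm (x j))\<^sup>2)" using that by (intro member_le_sum) auto
      then have "(norm (x j))\<^sup>2 \<le> 1" using x by simp
      then show ?thesis by (simp add: power_le_one_iff abs_square_le_1)
    qed
    have "norm (\<Sum>j<m. A i j (x j)) \<le> (\<Sum>j<m. norm (A i j))" for i
    proof (rule sum_norm_le)
      fix j assume "j \<in> {..<m}"
      then have "norm (A i j) * norm (x j) \<le> norm (A i j) * 1" using xj by (intro mult_left_mono) auto
      then show "norm (A i j (x j)) \<le> norm (A i j)" using norm_blinfun[of "A i j" "x j"] by simp
    qed
    then show ?thesis by (intro real_sqrt_le_mono sum_mono power_mono) auto
  qed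
  then have bdd: "bdd_above (?h ` ?U)" by (rule bdd_aboveI2)
  have upper: "?h x \<le> op_matrix_norm m A" if "x \<in> ?U" for x
    unfolding op_matrix_norm_def by (rule cSUP_upper[OF that bdd])
  show N: "0 \<le> op_matrix_norm m A" using upper[of "\<lambda>_. 0"] by simp
  let ?s = "\<Sum>j<m. (norm (x j))\<^sup>2"
  show "(\<Sum>i<m. (norm (\<Sum>j<m. A i j (x j)))\<^sup>2) \<le> (op_matrix_norm m A)\<^sup>2 * ?s"
  proof (cases "?s = 0")
    case True
    then have "x j = 0" if "j < m" for j using that by (simp add: sum_nonneg_eq_0_iff)
    then show ?thesis by simp
  next
    case False
    then have s: "?s > 0" using sum_nonneg[of "{..<m}" "\<lambda>j. (norm (x j))\<^sup>2"] by (simp add: order_less_le)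
    \<comment> \<open>Rescales x to total squared norm 1, where the supremum applies.\<close>
    define c where "c = 1 / sqrt ?s"
    have c: "c\<^sup>2 = 1 / ?s" using s by (simp add: c_def power_divide)
    have "(\<Sum>j<m. (norm (c *\<^sub>R x j))\<^sup>2) = c\<^sup>2 * ?s" by (simp add: power_mult_distrib sum_distrib_left)
    then have "(\<lambda>j. c *\<^sub>R x j) \<in> ?U" using s c by simp
    then have "(?h (\<lambda>j. c *\<^sub>R x j))\<^sup>2 \<le> (op_matrix_norm m A)\<^sup>2"
      by (intro power_mono upper) (auto intro: sum_nonneg)
    moreover have "(?h (\<lambda>j. c *\<^sub>R x j))\<^sup>2 = c\<^sup>2 * (\<Sum>i<m. (norm (\<Sum>j<m. A i j (x j)))\<^sup>2)"
      by (simp add: sum_nonneg blinfun.scaleR_right power_mult_distrib sum_distrib_left flip: scaleR_sum_right)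
    ultimately show ?thesis using s c by (simp add: field_simps)
  qed
qed


section \<open>The functional calculus\<close>

text \<open>The diagonal operator D_r of the model: it carries the powers of r in phi(rT) over to
  the model space.\<close>

lemma multiplier_exists:
  assumes "0 \<le> r" "r \<le> 1"
  shows "\<exists>D. D \<in> bops (model_space k n) (model_space k n) \<and> (\<forall>x. norm (D x) \<le> norm x) \<and>
    (\<forall>\<delta>\<in>multiwords k n. D (ell2_basis \<delta>) = of_real (r ^ multilength k \<delta>) *\<^sub>C ell2_basis \<delta>)"
  unfolding model_space_def
  by (rule weighted_shift_exists) (use assms in \<open>auto simp: norm_power power_le_one\<close>)

definition multiplier ::
  "nat \<Rightarrow> (nat \<Rightarrow> nat) \<Rightarrow> real \<Rightarrow> (multiword, complex) ell2 \<Rightarrow>\<^sub>L (multiword, complex) ell2" where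
  "multiplier k n r = (SOME D. D \<in> bops (model_space k n) (model_space k n) \<and> (\<forall>x. norm (D x) \<le> norm x) \<and>
    (\<forall>\<delta>\<in>multiwords k n. D (ell2_basis \<delta>) = of_real (r ^ multilength k \<delta>) *\<^sub>C ell2_basis \<delta>))"

lemma multiplier_props:
  assumes "0 \<le> r" "r \<le> 1"
  shows clinear_multiplier: "clinear_op (multiplier k n r)"
    and norm_multiplier_le: "norm (multiplier k n r x) \<le> norm x"
    and multiplier_basis: "\<delta> \<in> multiwords k n \<Longrightarrow>
      multiplier k n r (ell2_basis \<delta>) = of_real (r ^ multilength k \<delta>) *\<^sub>C ell2_basis \<delta>"
  using someI_ex[OF multiplier_exists[OF assms, of k n], folded multiplier_def] by (auto simp: bops_def)

context polyball_tuple
begin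

text \<open>Uniform boundedness and convergence on basis vectors. The claim is confined to the model
  space, since D_r vanishes on its complement.\<close>

lemma multiplier_tendsto:
  assumes v: "v \<in> model_space k n"
  shows "((\<lambda>r. multiplier k n r v) \<longlongrightarrow> v) (at_left 1)"
proof -
  define F where "F r = multiplier k n r - id_blinfun" for r
  let ?S = "{x. ((\<lambda>r. F r x) \<longlongrightarrow> 0) (at_left 1)}"
  have "\<forall>\<^sub>F r in at_left 1. norm (F r) \<le> 2"
    using eventually_at_left_1
  proof eventually_elim
    case (elim r)
    have "norm (multiplier k n r) \<le> 1"
      by (rule norm_blinfun_bound) (use elim norm_multiplier_le[of r] in auto)
    then show ?case
      unfolding F_def using norm_triangle_ineq4[of "multiplier k n r" id_blinfun]
        norm_blinfun_id_le[where 'a = "(multiword, complex) ell2"] by linarith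
  qed
  then have closed: "closed ?S" by (rule closed_null_set)
  have sub: "subspace ?S"
    unfolding subspace_def
    by (auto simp: blinfun.add_right blinfun.scaleR_right
        intro: tendsto_add_zero tendsto_mult_right_zero tendsto_eq_intros)
  \<comment> \<open>The set of good vectors is handled as a real subspace, so complex multiples are
    treated here.\<close>
  have basis: "a *\<^sub>C ell2_basis \<delta> \<in> ?S" if \<delta>: "\<delta> \<in> multiwords k n" for a \<delta>
  proof -
    have "((\<lambda>r. a *\<^sub>C (complex_of_real (r ^ multilength k \<delta>) *\<^sub>C ell2_basis \<delta>) - a *\<^sub>C ell2_basis \<delta>)
        \<longlongrightarrow> a *\<^sub>C (complex_of_real (1 ^ multilength k \<delta>) *\<^sub>C ell2_basis \<delta>) - a *\<^sub>C ell2_basis \<delta>) (at_left 1)"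
      by (intro tendsto_diff tendsto_scaleC tendsto_of_real tendsto_power tendsto_ident_at tendsto_const)
    moreover have "\<forall>\<^sub>F r in at_left 1. a *\<^sub>C (complex_of_real (r ^ multilength k \<delta>) *\<^sub>C ell2_basis \<delta>) - a *\<^sub>C ell2_basis \<delta>
        = F r (a *\<^sub>C ell2_basis \<delta>)"
      using eventually_at_left_1
      by eventually_elim (simp add: F_def blinfun.diff_left clinear_opD[OF clinear_multiplier] multiplier_basis[OF _ _ \<delta>])
    ultimately have "((\<lambda>r. F r (a *\<^sub>C ell2_basis \<delta>)) \<longlongrightarrow> 0) (at_left 1)"
      using tendsto_cong by fastforce
    then show ?thesis by simp
  qed
  have "v \<in> ?S"
  proof (rule Lim_in_closed_set[OF closed])
    have "((\<lambda>\<delta>. ell2_nth v \<delta> *\<^sub>C ell2_basis \<delta>) has_sum v) (multiwords k n)"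
      using v by (intro ell2_scalar_has_sum) (simp add: model_space_def ell2_on_def)
    then show "((\<lambda>G. \<Sum>\<delta>\<in>G. ell2_nth v \<delta> *\<^sub>C ell2_basis \<delta>) \<longlongrightarrow> v) (finite_subsets_at_top (multiwords k n))"
      by (simp add: has_sum_def)
    show "\<forall>\<^sub>F G in finite_subsets_at_top (multiwords k n). (\<Sum>\<delta>\<in>G. ell2_nth v \<delta> *\<^sub>C ell2_basis \<delta>) \<in> ?S"
      by (rule eventually_finite_subsets_at_top_weakI) (intro subspace_sum[OF sub] basis, auto)
  qed simp
  then show ?thesis by (simp add: F_def blinfun.diff_left LIM_zero_iff)
qed

text \<open>Lengths add under concatenation, so r^|beta| is the diagonal entry of D_r at the
  concatenation with \<open>\<gamma>\<close>, divided by r^|gamma|; the latter requires r >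
  0.\<close>

lemma series_at_apply_range:
  assumes c: "fourier_rep k n lam c A" and \<gamma>: "\<gamma> \<in> multiwords k n" and r: "0 < r" "r < 1"
  shows "series_at k n c r T (multiword_op k T \<gamma> (R e))
    = (1 / r ^ multilength k \<gamma>) *\<^sub>R cadj K (ell2_tensor (multiplier k n r (A (ell2_basis \<gamma>))) e)"
proof (rule series_at_eqI[OF fourier_rep_summable[OF c]])
  have r': "0 \<le> r" "r \<le> 1" using r by auto
  let ?g = "\<lambda>u. (1 / r ^ multilength k \<gamma>) *\<^sub>R cadj K (ell2_tensor (multiplier k n r u) e)"
  have g: "bounded_linear ?g"
    by (intro bounded_linear_compose[OF bounded_linear_scaleR_right] blinfun.bounded_linear_right
        bounded_linear_compose[OF blinfun.bounded_linear_right[of "cadj K"]]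
        bounded_linear_compose[OF bounded_linear_tensor_left])
  have summand: "?g ((c \<beta> * twist k lam \<beta> \<gamma>) *\<^sub>C ell2_basis (cat \<beta> \<gamma>))
      = (of_real (r ^ multilength k \<beta>) * c \<beta>) *\<^sub>C multiword_op k T \<beta> (multiword_op k T \<gamma> (R e))"
    if \<beta>: "\<beta> \<in> multiwords k n" for \<beta>
  proof -
    have "?g ((c \<beta> * twist k lam \<beta> \<gamma>) *\<^sub>C ell2_basis (cat \<beta> \<gamma>))
        = (of_real (1 / r ^ multilength k \<gamma>) * (c \<beta> * twist k lam \<beta> \<gamma>) * of_real (r ^ multilength k (cat \<beta> \<gamma>)))
          *\<^sub>C multiword_op k T (cat \<beta> \<gamma>) (R e)"
      by (simp add: clinear_opD[OF clinear_multiplier[OF r']] multiplier_basis[OF r'] cat_in_multiwords \<beta> \<gamma>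
          ell2_tensor_scaleC_left clinear_opD[OF clinear_cadj[OF clinear_berezin_kernel]]
          cadj_kernel_tensor scaleC_scaleC mult.assoc flip: scaleC_of_real)
    also have "of_real (1 / r ^ multilength k \<gamma>) * (c \<beta> * twist k lam \<beta> \<gamma>) * of_real (r ^ multilength k (cat \<beta> \<gamma>))
        = of_real (r ^ multilength k \<beta>) * c \<beta> * twist k lam \<beta> \<gamma>"
      using r by (simp add: multilength_cat power_add field_simps)
    finally show ?thesis by (simp add: multiword_op_mult \<beta> \<gamma> scaleC_scaleC)
  qed
  have "((\<lambda>\<beta>. ?g ((c \<beta> * twist k lam \<beta> \<gamma>) *\<^sub>C ell2_basis (cat \<beta> \<gamma>))) has_sum ?g (A (ell2_basis \<gamma>))) (multiwords k n)"
    by (rule has_sum_bounded_linear[OF g fourier_rep_has_sum[OF unimod c \<gamma>], unfolded o_def])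
  then show "((\<lambda>\<beta>. (of_real (r ^ multilength k \<beta>) * c \<beta>) *\<^sub>C multiword_op k T \<beta> (multiword_op k T \<gamma> (R e)))
      has_sum ?g (A (ell2_basis \<gamma>))) (multiwords k n)"
    by (rule iffD1[OF has_sum_cong, rotated]) (rule summand)
qed (use r in auto)

lemma series_at_range_tendsto:
  assumes c: "fourier_rep k n lam c A" and \<gamma>: "\<gamma> \<in> multiwords k n"
  shows "((\<lambda>r. series_at k n c r T (multiword_op k T \<gamma> (R e))) \<longlongrightarrow> cadj K (ell2_tensor (A (ell2_basis \<gamma>)) e)) (at_left 1)"
proof -
  have "A (ell2_basis \<gamma>) \<in> model_space k n" using fourier_rep_bops[OF unimod c] by (simp add: bops_def)
  then have "((\<lambda>r. cadj K (ell2_tensor (multiplier k n r (A (ell2_basis \<gamma>))) e))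
      \<longlongrightarrow> cadj K (ell2_tensor (A (ell2_basis \<gamma>)) e)) (at_left 1)"
    by (intro blinfun.tendsto tendsto_const bounded_linear.tendsto[OF bounded_linear_tensor_left] multiplier_tendsto)
  then have "((\<lambda>r. (1 / r ^ multilength k \<gamma>) *\<^sub>R cadj K (ell2_tensor (multiplier k n r (A (ell2_basis \<gamma>))) e))
      \<longlongrightarrow> (1 / 1 ^ multilength k \<gamma>) *\<^sub>R cadj K (ell2_tensor (A (ell2_basis \<gamma>)) e)) (at_left 1)"
    by (intro tendsto_scaleR tendsto_divide tendsto_power tendsto_ident_at tendsto_const) auto
  moreover have "\<forall>\<^sub>F r in at_left 1. (1 / r ^ multilength k \<gamma>) *\<^sub>R cadj K (ell2_tensor (multiplier k n r (A (ell2_basis \<gamma>))) e)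
      = series_at k n c r T (multiword_op k T \<gamma> (R e))"
    using eventually_at_left_1 by eventually_elim (simp add: series_at_apply_range[OF c \<gamma>])
  ultimately show ?thesis using tendsto_cong by fastforce
qed

text \<open>The kernel and its adjoint are contractions and are applied entrywise, so the ampliation
  bound survives between them.\<close>

lemma berezin_matrix_bound:
  fixes A :: "nat \<Rightarrow> nat \<Rightarrow> (multiword, complex) ell2 \<Rightarrow>\<^sub>L (multiword, complex) ell2"
  assumes r: "0 \<le> r" "r < 1"
    and A: "\<And>i j. i < m \<Longrightarrow> j < m \<Longrightarrow> A i j \<in> bops (model_space k n) (model_space k n)"
    and bd: "\<And>x. (\<Sum>i<m. (norm (\<Sum>j<m. A i j (x j)))\<^sup>2) \<le> C * (\<Sum>j<m. (norm (x j))\<^sup>2)" and C: "0 \<le> C"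
  shows "(\<Sum>i<m. (norm (\<Sum>j<m. berezin_transform k n (dilate r T) (A i j) (x j)))\<^sup>2) \<le> C * (\<Sum>j<m. (norm (x j))\<^sup>2)"
proof -
  interpret X: berezin_tuple k n lam "dilate r T" by (rule berezin_dilate[OF r])
  have "(\<Sum>i<m. (norm (\<Sum>j<m. berezin_transform k n (dilate r T) (A i j) (x j)))\<^sup>2)
      = (\<Sum>i<m. (norm (cadj X.K (\<Sum>j<m. ampliation (A i j) (X.K (x j)))))\<^sup>2)"
    unfolding blinfun.sum_right
    by (intro sum.cong refl arg_cong[where f = "\<lambda>z. (norm z)\<^sup>2"]) (simp add: X.berezin_transform_apply[OF A])
  also have "\<dots> \<le> (\<Sum>i<m. (norm (\<Sum>j<m. ampliation (A i j) (X.K (x j))))\<^sup>2)"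
    by (intro sum_mono power_mono X.norm_cadj_kernel_le) simp
  also have "\<dots> \<le> C * (\<Sum>j<m. (norm (X.K (x j)))\<^sup>2)"
    by (rule ampliation_matrix_bound[OF _ bd]) (use A in \<open>simp add: bops_def\<close>)
  also have "\<dots> \<le> C * (\<Sum>j<m. (norm (x j))\<^sup>2)"
    by (intro mult_left_mono sum_mono power_mono X.norm_berezin_kernel_le C) simp
  finally show ?thesis .
qed

lemma norm_series_at_le:
  assumes c: "fourier_rep k n lam c A" and r: "0 \<le> r" "r < 1"
  shows "norm (series_at k n c r T) \<le> norm A"
proof (rule norm_blinfun_bound)
  fix x
  have "(norm (series_at k n c r T x))\<^sup>2 \<le> (norm A)\<^sup>2 * (norm x)\<^sup>2"
    using berezin_matrix_bound[OF r, of 1 "\<lambda>_ _. A" "(norm A)\<^sup>2" "\<lambda>_. x"]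
    by (simp add: berezin_transform_dilate[OF c r] fourier_rep_bops[OF unimod c] norm_blinfun power_mono
        flip: power_mult_distrib)
  then show "norm (series_at k n c r T x) \<le> norm A * norm x"
    by (simp add: power2_le_iff_abs_le flip: power_mult_distrib)
qed simp

lemma clinear_series_at:
  assumes c: "fourier_rep k n lam c A" and r: "0 \<le> r" "r < 1"
  shows "clinear_op (series_at k n c r T)"
proof -
  interpret X: berezin_tuple k n lam "dilate r T" by (rule berezin_dilate[OF r])
  have A: "A \<in> bops (model_space k n) (model_space k n)" by (rule fourier_rep_bops[OF unimod c])
  then have lin: "clinear_op A" by (simp add: bops_def)
  show ?thesis
    unfolding berezin_transform_dilate[OF c r, symmetric] clinear_op_def X.berezin_transform_apply[OF A]
    by (simp add: clinear_opD[OF X.clinear_berezin_kernel] clinear_opD[OF clinear_ampliation[OF lin]]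
        clinear_opD[OF clinear_cadj[OF X.clinear_berezin_kernel]])
qed

text \<open>The quadratic forms record real parts, whereas \<open>completely_non_coisometric\<close>
  asks for a vanishing complex number.\<close>

lemma Im_defect_pow: "Im (cinner (defect_pow k n p T h) h) = 0"
proof -
  have cp: "Im (cinner (cp_map (n i) (T i) Y h) h) = 0"
    if "i < k" "\<And>h. Im (cinner (blinfun_apply Y h) h) = 0" for i Y h
  proof -
    have "cinner (cp_map (n i) (T i) Y h) h = (\<Sum>s<n i. cinner (Y (cadj (T i s) h)) (cadj (T i s) h))"
      unfolding cp_map_def blinfun.sum_left cinner_sum_left
      by (intro sum.cong refl) (use that(1) in \<open>simp add: cinner_cadj_right T_lin\<close>)
    then show ?thesis by (simp add: that(2))
  qed
  have pow: "Im (cinner ((cp_map (n i) (T i) ^^ l) Y h) h) = 0"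
    if "i < k" "\<And>h. Im (cinner (blinfun_apply Y h) h) = 0" for i l Y h
    using that by (induction l arbitrary: h) (auto intro!: cp)
  have "Im (cinner (fold (\<lambda>i Y. Y - (cp_map (n i) (T i) ^^ p i) Y) js Y h) h) = 0"
    if "set js \<subseteq> {..<k}" "\<And>h. Im (cinner (blinfun_apply Y h) h) = 0" for js Y h
    using that
  proof (induction js arbitrary: Y h)
    case (Cons i js)
    have "Im (cinner ((Y - (cp_map (n i) (T i) ^^ p i) Y) h) h) = 0" for h
      using Cons.prems pow[of i Y "p i" h] by (simp add: blinfun.diff_left cinner_diff_left)
    then show ?case using Cons by simp
  qed simp
  from this[of "[0..<k]" id_blinfun] show ?thesis
    by (simp add: defect_pow_def lessThan_atLeast0 cinner_self)
qed

end

section \<open>The limit for a completely non-coisometric tuple, and its properties\<close>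

locale cnc_polyball_tuple = polyball_tuple +
  assumes cnc: "completely_non_coisometric k n T"
begin

text \<open>By \<open>cadj_kernel_tensor\<close> these are the images of the basis tensors under
  \<open>cadj K\<close>. As e ranges over the whole space, complex scalars are absorbed into e and
  the real span is already complex.\<close>

definition kernel_range :: "'a set" where
  "kernel_range = {multiword_op k T \<gamma> (R e) | \<gamma> e. \<gamma> \<in> multiwords k n}"

text \<open>A vector orthogonal to the range of \<open>K\<^sup>*\<close> is annihilated by all the defect operators.\<close>

lemma kernel_range_dense: "closure (span kernel_range) = UNIV"
proof (rule ccontr)
  let ?V = "closure (span kernel_range)"
  assume "?V \<noteq> UNIV"
  then obtain v where v: "v \<notin> ?V" by blast
  have "subspace ?V" by (intro subspace_closure subspace_span)
  then obtain z where z: "z \<in> ?V" "\<And>m. m \<in> ?V \<Longrightarrow> inner z m = inner v m"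
    using Riesz_on_closed_subspace[of ?V "inner v"] bounded_linear_inner_right by auto
  define w where "w = v - z"
  have "w \<noteq> 0" using v z by (auto simp: w_def)
  have orth: "inner w m = 0" if "m \<in> ?V" for m using z(2)[OF that] by (simp add: w_def inner_diff_left)
  have "op_form (defect k n T) (adj_word k T \<beta> w) = 0" if \<beta>: "\<beta> \<in> multiwords k n" for \<beta>
  proof -
    \<comment> \<open>With this choice of e the inner product with w becomes the squared norm of
      coordinate beta of \<open>K\<close> w.\<close>
    let ?x = "R (adj_word k T \<beta> w)"
    have "multiword_op k T \<beta> (R ?x) \<in> kernel_range" using \<beta> by (auto simp: kernel_range_def)
    then have "multiword_op k T \<beta> (R ?x) \<in> ?V" using span_superset closure_subset by blast
    then have "0 = Re (cinner w (multiword_op k T \<beta> (R ?x)))" by (simp add: Re_cinner orth)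
    also have "\<dots> = (norm ?x)\<^sup>2"
      by (simp add: norm_eq_cinner R_self_adjoint adj_word_eq_cadj[OF \<beta>] cinner_cadj_left[OF clinear_multiword[OF \<beta>]])
    finally show ?thesis by (simp add: norm_R_sq)
  qed
  then have "op_form (defect_pow k n p T) w = 0" for p
    by (simp add: op_form_defect_pow_eq_sum word_box_def)
  then have "cinner (defect_pow k n p T w) w = 0" for p
    by (simp add: op_form_def complex_eq_iff Im_defect_pow)
  then show False using cnc \<open>w \<noteq> 0\<close> by (auto simp: completely_non_coisometric_def)
qed

abbreviation "\<Psi> \<equiv> hardy_calculus k n T"

lemma at_left_1_nontrivial: "at_left (1::real) \<noteq> bot"
  by simp

text \<open>The operators phi(rT) are bounded by norm A and converge on a set with dense span.
  Uniqueness of pointwise limits then identifies the operator chosen by \<open>THE\<close>.\<close>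

lemma hardy_calculus_limits:
  assumes c: "fourier_rep k n lam c A"
  shows hardy_calculus_series: "((\<lambda>r. series_at k n c r T x) \<longlongrightarrow> \<Psi> A x) (at_left 1)"
    and norm_hardy_calculus_le: "norm (\<Psi> A) \<le> norm A"
    and hardy_calculus_berezin:
      "limitin strong_operator_topology (\<lambda>r. berezin_transform k n (dilate r T) A) (\<Psi> A) (at_left 1)"
proof -
  have bd: "\<forall>\<^sub>F r in at_left 1. norm (series_at k n c r T) \<le> norm A"
    using eventually_at_left_1 by eventually_elim (simp add: norm_series_at_le[OF c])
  obtain L where L: "norm L \<le> norm A" "\<And>x. ((\<lambda>r. series_at k n c r T x) \<longlongrightarrow> blinfun_apply L x) (at_left 1)"
    using pointwise_limit_exists[OF at_left_1_nontrivial bd _ kernel_range_dense] series_at_range_tendsto[OF c]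
    unfolding kernel_range_def by blast
  have eq: "\<forall>\<^sub>F r in at_left 1. series_at k n c r T x = berezin_transform k n (dilate r T) A x" for x
    using eventually_at_left_1 by eventually_elim (simp add: berezin_transform_dilate[OF c])
  have lim: "limitin strong_operator_topology (\<lambda>r. berezin_transform k n (dilate r T) A) L (at_left 1)"
    unfolding limitin_strong_operator_topology_iff
    using L(2) tendsto_cong[OF eq] by blast
  have "\<Psi> A = L"
    unfolding hardy_calculus_def
  proof (rule the_equality[where P = "\<lambda>L. limitin strong_operator_topology (\<lambda>r. berezin_transform k n (dilate r T) A) L (at_left 1)", OF lim])
    fix L' assume L': "limitin strong_operator_topology (\<lambda>r. berezin_transform k n (dilate r T) A) L' (at_left 1)"
    show "L' = L"
    proof (rule blinfun_eqI, rule tendsto_unique[OF at_left_1_nontrivial])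
      fix x
      show "((\<lambda>r. berezin_transform k n (dilate r T) A x) \<longlongrightarrow> L' x) (at_left 1)"
        "((\<lambda>r. berezin_transform k n (dilate r T) A x) \<longlongrightarrow> L x) (at_left 1)"
        using L' lim by (simp_all add: limitin_strong_operator_topology_iff)
    qed
  qed
  then show "((\<lambda>r. series_at k n c r T x) \<longlongrightarrow> \<Psi> A x) (at_left 1)" "norm (\<Psi> A) \<le> norm A"
    "limitin strong_operator_topology (\<lambda>r. berezin_transform k n (dilate r T) A) (\<Psi> A) (at_left 1)"
    using L lim by simp_all
qed

lemma hardy_algebra_norm_le: "A \<in> hardy_algebra k n lam \<Longrightarrow> norm (\<Psi> A) \<le> norm A"
  by (auto simp: hardy_algebra_def norm_hardy_calculus_le)

lemma hardy_algebra_bops: "A \<in> hardy_algebra k n lam \<Longrightarrow> A \<in> bops (model_space k n) (model_space k n)"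
  by (auto simp: hardy_algebra_def fourier_rep_def)

lemma hardy_algebra_clinear: "A \<in> hardy_algebra k n lam \<Longrightarrow> clinear_op A"
  using hardy_algebra_bops by (auto simp: bops_def)

lemma hardy_calculus_range:
  assumes A: "A \<in> hardy_algebra k n lam" and \<gamma>: "\<gamma> \<in> multiwords k n"
  shows "\<Psi> A (multiword_op k T \<gamma> (R e)) = cadj K (ell2_tensor (A (ell2_basis \<gamma>)) e)"
proof -
  obtain c where c: "fourier_rep k n lam c A" using A by (auto simp: hardy_algebra_def)
  show ?thesis
    by (rule tendsto_unique[OF at_left_1_nontrivial hardy_calculus_series[OF c] series_at_range_tendsto[OF c \<gamma>]])
qed

text \<open>The algebraic laws below are checked on these vectors, where
  \<open>hardy_calculus_range\<close> evaluates both sides.\<close>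

lemma kernel_range_eqI:
  fixes L L' :: "'a \<Rightarrow>\<^sub>L 'a"
  assumes "\<And>\<gamma> e. \<gamma> \<in> multiwords k n \<Longrightarrow> L (multiword_op k T \<gamma> (R e)) = L' (multiword_op k T \<gamma> (R e))"
  shows "L = L'"
proof -
  have "{x. blinfun_apply L x = L' x} = UNIV"
  proof (rule closed_subspace_eq_UNIV[OF _ _ _ kernel_range_dense])
    show "closed {x. blinfun_apply L x = L' x}"
      by (intro closed_Collect_eq linear_continuous_on blinfun.bounded_linear_right)
    show "subspace {x. blinfun_apply L x = L' x}"
      by (auto simp: subspace_def blinfun.add_right blinfun.scaleR_right)
  qed (use assms in \<open>auto simp: kernel_range_def\<close>)
  then show ?thesis by (intro blinfun_eqI) blast
qed

lemma clinear_hardy_calculus: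
  assumes "A \<in> hardy_algebra k n lam"
  shows "clinear_op (\<Psi> A)"
  unfolding clinear_op_def
proof (intro allI)
  fix a x
  obtain c where c: "fourier_rep k n lam c A" using assms by (auto simp: hardy_algebra_def)
  have "\<forall>\<^sub>F r in at_left 1. series_at k n c r T (a *\<^sub>C x) = a *\<^sub>C series_at k n c r T x"
    using eventually_at_left_1 by eventually_elim (simp add: clinear_opD[OF clinear_series_at[OF c]])
  from tendsto_cong[OF this]
  have "((\<lambda>r. a *\<^sub>C series_at k n c r T x) \<longlongrightarrow> \<Psi> A (a *\<^sub>C x)) (at_left 1)"
    using hardy_calculus_series[OF c, of "a *\<^sub>C x"] by blast
  moreover have "((\<lambda>r. a *\<^sub>C series_at k n c r T x) \<longlongrightarrow> a *\<^sub>C \<Psi> A x) (at_left 1)"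
    by (intro tendsto_scaleC tendsto_const hardy_calculus_series[OF c])
  ultimately show "\<Psi> A (a *\<^sub>C x) = a *\<^sub>C \<Psi> A x"
    by (rule tendsto_unique[OF at_left_1_nontrivial])
qed

lemma hardy_calculus_add:
  assumes A: "A \<in> hardy_algebra k n lam" and B: "B \<in> hardy_algebra k n lam"
  shows "\<Psi> (A + B) = \<Psi> A + \<Psi> B"
  by (rule kernel_range_eqI)
    (simp add: hardy_calculus_range hardy_algebra_add[OF unimod A B] A B blinfun.add_left ell2_tensor_add_left blinfun.add_right)

lemma hardy_calculus_scale:
  assumes A: "A \<in> hardy_algebra k n lam"
  shows "\<Psi> (scale_op a A) = scale_op a (\<Psi> A)"
  by (rule kernel_range_eqI)
    (simp add: hardy_calculus_range hardy_algebra_scale[OF unimod A] A ell2_tensor_scaleC_left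
      clinear_opD[OF clinear_cadj[OF clinear_berezin_kernel]])

lemma hardy_calculus_unit: "\<Psi> (subspace_id (model_space k n)) = id_blinfun"
  by (rule kernel_range_eqI)
    (simp add: hardy_calculus_range subspace_id_in_hardy_algebra[OF unimod] subspace_id_model_basis[OF unimod]
      cadj_kernel_tensor)

text \<open>The intertwining relation for general u. Products need it, since B chi_gamma is no
  longer a basis vector.\<close>

lemma hardy_calculus_cadj_kernel:
  assumes A: "A \<in> hardy_algebra k n lam" and u: "u \<in> model_space k n"
  shows "\<Psi> A (cadj K (ell2_tensor u e)) = cadj K (ell2_tensor (A u) e)"
proof (rule has_sum_unique)
  have u_sum: "((\<lambda>\<delta>. ell2_nth u \<delta> *\<^sub>C ell2_basis \<delta>) has_sum u) (multiwords k n)"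
    using u by (intro ell2_scalar_has_sum) (simp add: model_space_def ell2_on_def)
  have 1: "bounded_linear (\<lambda>u. \<Psi> A (cadj K (ell2_tensor u e)))"
    by (intro bounded_linear_compose[OF blinfun.bounded_linear_right]
        bounded_linear_compose[OF blinfun.bounded_linear_right] bounded_linear_tensor_left)
  have 2: "bounded_linear (\<lambda>u. cadj K (ell2_tensor (A u) e))"
    by (intro bounded_linear_compose[OF blinfun.bounded_linear_right]
        bounded_linear_compose[OF bounded_linear_tensor_left] blinfun.bounded_linear_right)
  \<comment> \<open>The scalar is moved from the basis vector to e, where
    \<open>hardy_calculus_range\<close> allows any vector.\<close>
  have eq: "\<Psi> A (cadj K (ell2_tensor (a *\<^sub>C ell2_basis \<delta>) e)) = cadj K (ell2_tensor (A (a *\<^sub>C ell2_basis \<delta>)) e)"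
    if "\<delta> \<in> multiwords k n" for a \<delta>
    using that hardy_calculus_range[OF A that, of "a *\<^sub>C e"]
    by (simp add: clinear_opD[OF hardy_algebra_clinear[OF A]] ell2_tensor_scaleC_left
        cadj_kernel_tensor flip: ell2_tensor_scaleC_right)
  show "((\<lambda>\<delta>. \<Psi> A (cadj K (ell2_tensor (ell2_nth u \<delta> *\<^sub>C ell2_basis \<delta>) e))) has_sum \<Psi> A (cadj K (ell2_tensor u e))) (multiwords k n)"
    by (rule has_sum_bounded_linear[OF 1 u_sum, unfolded o_def])
  have "((\<lambda>\<delta>. cadj K (ell2_tensor (A (ell2_nth u \<delta> *\<^sub>C ell2_basis \<delta>)) e)) has_sum cadj K (ell2_tensor (A u) e)) (multiwords k n)"
    by (rule has_sum_bounded_linear[OF 2 u_sum, unfolded o_def])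
  then show "((\<lambda>\<delta>. \<Psi> A (cadj K (ell2_tensor (ell2_nth u \<delta> *\<^sub>C ell2_basis \<delta>) e))) has_sum cadj K (ell2_tensor (A u) e)) (multiwords k n)"
    by (rule iffD1[OF has_sum_cong, rotated]) (rule eq[symmetric])
qed

lemma hardy_calculus_mult:
  assumes A: "A \<in> hardy_algebra k n lam" and B: "B \<in> hardy_algebra k n lam"
  shows "\<Psi> (A o\<^sub>L B) = \<Psi> A o\<^sub>L \<Psi> B"
proof (rule kernel_range_eqI)
  fix \<gamma> e assume \<gamma>: "\<gamma> \<in> multiwords k n"
  have "B (ell2_basis \<gamma>) \<in> model_space k n" using hardy_algebra_bops[OF B] by (simp add: bops_def)
  then show "\<Psi> (A o\<^sub>L B) (multiword_op k T \<gamma> (R e)) = (\<Psi> A o\<^sub>L \<Psi> B) (multiword_op k T \<gamma> (R e))"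
    by (simp add: hardy_calculus_range \<gamma> hardy_algebra_mult[OF unimod A B] B hardy_calculus_cadj_kernel[OF A])
qed

lemma hardy_calculus_matrix_bound:
  fixes A :: "nat \<Rightarrow> nat \<Rightarrow> (multiword, complex) ell2 \<Rightarrow>\<^sub>L (multiword, complex) ell2"
  assumes A: "\<And>i j. i < m \<Longrightarrow> j < m \<Longrightarrow> A i j \<in> hardy_algebra k n lam"
  shows "op_matrix_norm m (\<lambda>i j. \<Psi> (A i j)) \<le> op_matrix_norm m A"
proof (rule op_matrix_norm_le[OF op_matrix_norm_bound(1)])
  fix x :: "nat \<Rightarrow> 'a"
  assume x: "(\<Sum>j<m. (norm (x j))\<^sup>2) \<le> 1"
  let ?C = "(op_matrix_norm m A)\<^sup>2"
  have lim: "((\<lambda>r. berezin_transform k n (dilate r T) (A i j) y) \<longlongrightarrow> \<Psi> (A i j) y) (at_left 1)"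
    if "i < m" "j < m" for i j y
    using A[OF that] hardy_calculus_berezin
    by (auto simp: hardy_algebra_def limitin_strong_operator_topology_iff)
  show "(\<Sum>i<m. (norm (\<Sum>j<m. \<Psi> (A i j) (x j)))\<^sup>2) \<le> ?C"
  proof (rule tendsto_upperbound[OF _ _ at_left_1_nontrivial])
    show "((\<lambda>r. \<Sum>i<m. (norm (\<Sum>j<m. berezin_transform k n (dilate r T) (A i j) (x j)))\<^sup>2)
        \<longlongrightarrow> (\<Sum>i<m. (norm (\<Sum>j<m. \<Psi> (A i j) (x j)))\<^sup>2)) (at_left 1)"
      by (intro tendsto_sum tendsto_power tendsto_norm lim) auto
    show "\<forall>\<^sub>F r in at_left 1. (\<Sum>i<m. (norm (\<Sum>j<m. berezin_transform k n (dilate r T) (A i j) (x j)))\<^sup>2) \<le> ?C"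
      using eventually_at_left_1
    proof eventually_elim
      case (elim r)
      have "(\<Sum>i<m. (norm (\<Sum>j<m. berezin_transform k n (dilate r T) (A i j) (x j)))\<^sup>2) \<le> ?C * (\<Sum>j<m. (norm (x j))\<^sup>2)"
        by (rule berezin_matrix_bound) (use elim A hardy_algebra_bops op_matrix_norm_bound(2) in auto)
      also have "\<dots> \<le> ?C * 1" by (intro mult_left_mono x) simp
      finally show ?case by simp
    qed
  qed
qed

text \<open>The topology X is left open so that the same argument serves the weak operator and the
  weak-* topology. On the dense set, matrix coefficients of the image are matrix coefficients of A
  itself.\<close>

lemma hardy_calculus_weak_continuous:
  assumes B: "topspace X \<subseteq> hardy_algebra k n lam" "\<And>A. A \<in> topspace X \<Longrightarrow> norm A \<le> M"
    and ev: "\<And>u w. continuous_map X euclidean (\<lambda>A. cinner (blinfun_apply A u) w)"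
  shows "continuous_map X euclidean (\<lambda>A. cinner (\<Psi> A x) y)"
proof (rule continuous_evaluation_dense[OF _ bounded_linear_cinner_left _ kernel_range_dense])
  show "norm (\<Psi> A) \<le> M" if "A \<in> topspace X" for A
    using hardy_algebra_norm_le[of A] B that by fastforce
  fix z assume "z \<in> kernel_range"
  then obtain \<gamma> e where z: "\<gamma> \<in> multiwords k n" "z = multiword_op k T \<gamma> (R e)"
    by (auto simp: kernel_range_def)
  \<comment> \<open>The adjoint of tensoring with e brings \<open>K\<close> y back to a scalar
    vector independent of A.\<close>
  define S where "S = Blinfun (\<lambda>u::(multiword, complex) ell2. ell2_tensor u e)"
  have S: "S u = ell2_tensor u e" for u
    unfolding S_def by (subst bounded_linear_Blinfun_apply) (rule bounded_linear_tensor_left, rule refl)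
  have S_lin: "clinear_op S" by (simp add: clinear_op_def S ell2_tensor_scaleC_left)
  have "cinner (\<Psi> A z) y = cinner (A (ell2_basis \<gamma>)) (cadj S (K y))" if "A \<in> topspace X" for A
    using B that z by (simp add: hardy_calculus_range subset_iff cinner_cadj_left[OF clinear_berezin_kernel]
        cinner_cadj_right[OF S_lin] S)
  then show "continuous_map X euclidean (\<lambda>A. cinner (\<Psi> A z) y)"
    using continuous_map_eq[OF ev[of "ell2_basis \<gamma>" "cadj S (K y)"]] by simp
qed

lemma hardy_calculus_wot: 
  "continuous_on_bounded_sets (hardy_algebra k n lam) weak_operator_topology weak_operator_topology \<Psi>"
  unfolding continuous_on_bounded_sets_def
proof (intro allI impI)
  fix B assume B: "B \<subseteq> hardy_algebra k n lam" "bounded B"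
  obtain M where M: "\<And>A. A \<in> B \<Longrightarrow> norm A \<le> M" using B(2) by (auto simp: bounded_iff)
  show "continuous_map (subtopology weak_operator_topology B) weak_operator_topology \<Psi>"
    by (rule continuous_map_weak_operator_topologyI, rule hardy_calculus_weak_continuous[where M = M])
      (use B M in \<open>auto intro: continuous_map_from_subtopology weak_operator_topology_evaluation\<close>)
qed

lemma hardy_calculus_sot:
  "continuous_on_bounded_sets (hardy_algebra k n lam) strong_operator_topology strong_operator_topology \<Psi>"
  unfolding continuous_on_bounded_sets_def continuous_on_strong_operator_topo_iff_coordinatewise
proof (intro allI impI)
  fix B x assume B: "B \<subseteq> hardy_algebra k n lam" "bounded B"
  obtain M where M: "\<And>A. A \<in> B \<Longrightarrow> norm A \<le> M" using B(2) by (auto simp: bounded_iff)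
  let ?X = "subtopology strong_operator_topology B"
  show "continuous_map ?X euclidean (\<lambda>A. \<Psi> A x)"
  \<comment> \<open>With the identity in place of a functional, the density argument gives norm
    continuity of the values.\<close>
  proof (rule continuous_evaluation_dense[OF _ bounded_linear_ident _ kernel_range_dense])
    show "norm (\<Psi> A) \<le> M" if "A \<in> topspace ?X" for A
      using hardy_algebra_norm_le[of A] B M that by fastforce
    fix z assume "z \<in> kernel_range"
    then obtain \<gamma> e where z: "\<gamma> \<in> multiwords k n" "z = multiword_op k T \<gamma> (R e)"
      by (auto simp: kernel_range_def)
    have cont: "continuous_map ?X euclidean (\<lambda>A. cadj K (ell2_tensor (blinfun_apply A (ell2_basis \<gamma>)) e))"
      by (intro continuous_map_bounded_linear[OF bounded_linear_compose[OF blinfun.bounded_linear_right bounded_linear_tensor_left]]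
          continuous_map_from_subtopology strong_operator_topology_continuous_evaluation)
    show "continuous_map ?X euclidean (\<lambda>A. \<Psi> A z)"
      by (rule continuous_map_eq[OF cont]) (use B z in \<open>auto simp: hardy_calculus_range subset_iff\<close>)
  qed
qed

text \<open>On a bounded set the series defining a weak-* functional converges uniformly, so its
  continuity follows from that of the single matrix coefficients.\<close>

lemma hardy_calculus_weak_star:
  "continuous_on_bounded_sets (hardy_algebra k n lam) weak_star_topology weak_star_topology \<Psi>"
  unfolding continuous_on_bounded_sets_def
proof (intro allI impI)
  fix B assume B: "B \<subseteq> hardy_algebra k n lam" "bounded B"
  obtain M where M: "\<And>A. A \<in> B \<Longrightarrow> norm A \<le> M" using B(2) by (auto simp: bounded_iff)
  let ?X = "subtopology weak_star_topology B"
  have ev: "continuous_map ?X euclidean (\<lambda>A. cinner (\<Psi> A x) y)" for x y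
    by (rule hardy_calculus_weak_continuous[where M = M])
      (use B M in \<open>auto intro: continuous_map_from_subtopology weak_star_topology_evaluation\<close>)
  show "continuous_map ?X weak_star_topology \<Psi>"
  proof (rule continuous_map_weak_star_topologyI)
    fix x y :: "nat \<Rightarrow> 'a"
    assume xy: "summable (\<lambda>m. (norm (x m))\<^sup>2)" "summable (\<lambda>m. (norm (y m))\<^sup>2)"
    \<comment> \<open>The absolute value covers an empty B, for which M may be negative. The factor
      2 in \<open>norm_cinner_le\<close> is absorbed by 2 a b \<le> a^2 + b^2.\<close>
    have summ: "summable (\<lambda>m. \<bar>M\<bar> * ((norm (x m))\<^sup>2 + (norm (y m))\<^sup>2))"
      by (intro summable_mult summable_add xy)
    have le: "norm (cinner (\<Psi> A (x m)) (y m)) \<le> \<bar>M\<bar> * ((norm (x m))\<^sup>2 + (norm (y m))\<^sup>2)"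
      if "A \<in> topspace ?X" for A m
    proof -
      have A: "norm (\<Psi> A) \<le> \<bar>M\<bar>" using hardy_algebra_norm_le[of A] B M that by fastforce
      have "norm (cinner (\<Psi> A (x m)) (y m)) \<le> 2 * (norm (\<Psi> A (x m)) * norm (y m))" by (rule norm_cinner_le)
      also have "\<dots> \<le> 2 * ((\<bar>M\<bar> * norm (x m)) * norm (y m))"
        by (intro mult_left_mono mult_right_mono order_trans[OF norm_blinfun] A) auto
      also have "\<dots> = \<bar>M\<bar> * (2 * norm (x m) * norm (y m))" by simp
      also have "\<dots> \<le> \<bar>M\<bar> * ((norm (x m))\<^sup>2 + (norm (y m))\<^sup>2)"
        by (intro mult_left_mono sum_squares_bound) simp
      finally show ?thesis .
    qed
    have unif: "uniform_limit (topspace ?X) (\<lambda>N A. \<Sum>m<N. cinner (\<Psi> A (x m)) (y m))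
        (\<lambda>A. \<Sum>m. cinner (\<Psi> A (x m)) (y m)) sequentially"
      by (rule Weierstrass_m_test[OF le summ])
    have "continuous_map ?X Met_TC.mtopology (\<lambda>A. \<Sum>m. cinner (\<Psi> A (x m)) (y m))"
    proof (rule Met_TC.continuous_map_uniform_limit[where F = sequentially
          and f = "\<lambda>N A. \<Sum>m<N. cinner (\<Psi> A (x m)) (y m)"])
      show "\<forall>\<^sub>F N in sequentially. continuous_map ?X Met_TC.mtopology (\<lambda>A. \<Sum>m<N. cinner (\<Psi> A (x m)) (y m))"
        using ev by (auto intro!: always_eventually continuous_map_sum)
    qed (use unif in \<open>auto simp: uniform_limit_iff\<close>)
    then show "continuous_map ?X euclidean (\<lambda>A. \<Sum>m. cinner (\<Psi> A (x m)) (y m))" by simp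
  qed
qed

end

theorem theorem3p3:
  fixes k :: nat and n :: "nat \<Rightarrow> nat"
    and lam :: "nat \<Rightarrow> nat \<Rightarrow> nat \<Rightarrow> nat \<Rightarrow> complex"
    and T :: "'h::complex_hilbert op_tuple"
  assumes "0 < k" and "\<forall>i<k. 0 < n i"
    and "twist_matrices k n lam"
    and "T \<in> polyball k n lam"
    and "completely_non_coisometric k n T"
  shows
    "(\<forall>A\<in>hardy_algebra k n lam.
        limitin strong_operator_topology
          (\<lambda>r. berezin_transform k n (dilate r T) A) (hardy_calculus k n T A) (at_left 1)) \<and>
     hardy_calculus k n T ` hardy_algebra k n lam \<subseteq> bops UNIV UNIV \<and>
     (\<forall>A\<in>hardy_algebra k n lam. \<forall>B\<in>hardy_algebra k n lam.
        hardy_calculus k n T (A + B) = hardy_calculus k n T A + hardy_calculus k n T B) \<and>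
     (\<forall>a. \<forall>A\<in>hardy_algebra k n lam.
        hardy_calculus k n T (scale_op a A) = scale_op a (hardy_calculus k n T A)) \<and>

     (\<forall>A c. A \<in> hardy_algebra k n lam \<and> fourier_rep k n lam c A \<longrightarrow>
        limitin strong_operator_topology
          (\<lambda>r. series_at k n c r T) (hardy_calculus k n T A) (at_left 1)) \<and>

     continuous_on_bounded_sets (hardy_algebra k n lam)
       weak_operator_topology weak_operator_topology (hardy_calculus k n T) \<and>
     continuous_on_bounded_sets (hardy_algebra k n lam)
       strong_operator_topology strong_operator_topology (hardy_calculus k n T) \<and>
     continuous_on_bounded_sets (hardy_algebra k n lam)
       weak_star_topology weak_star_topology (hardy_calculus k n T) \<and>

     hardy_calculus k n T (subspace_id (model_space k n)) = id_blinfun \<and>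
     (\<forall>A\<in>hardy_algebra k n lam. \<forall>B\<in>hardy_algebra k n lam.
        hardy_calculus k n T (A o\<^sub>L B) = hardy_calculus k n T A o\<^sub>L hardy_calculus k n T B) \<and>
     completely_contractive_on (hardy_algebra k n lam) (hardy_calculus k n T)"
proof -
  interpret cnc_polyball_tuple k n lam T
    by unfold_locales (rule assms)+
  \<comment> \<open>This meets the vanishing clause of \<open>bops\<close> for the whole
    space.\<close>
  have zero: "x = 0" if "\<forall>m. cinner x m = 0" for x :: 'h
    by (rule cinner_eqI_left) (simp add: that)
  have bops: "\<Psi> ` hardy_algebra k n lam \<subseteq> bops UNIV UNIV"
    by (auto simp: bops_def clinear_hardy_calculus dest!: zero)
  have berezin: "limitin strong_operator_topology (\<lambda>r. berezin_transform k n (dilate r T) A) (\<Psi> A) (at_left 1)"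
    if "A \<in> hardy_algebra k n lam" for A
    using that hardy_calculus_berezin unfolding hardy_algebra_def by blast
  have series: "limitin strong_operator_topology (\<lambda>r. series_at k n c r T) (\<Psi> A) (at_left 1)"
    if "fourier_rep k n lam c A" for A c
    using hardy_calculus_series[OF that] by (simp add: limitin_strong_operator_topology_iff)
  have cc: "completely_contractive_on (hardy_algebra k n lam) \<Psi>"
    unfolding completely_contractive_on_def using hardy_calculus_matrix_bound by blast
  show ?thesis
    by (intro conjI ballI allI impI)
      (erule conjE | assumption | rule bops berezin series cc hardy_calculus_add hardy_calculus_scale
        hardy_calculus_unit hardy_calculus_mult hardy_calculus_wot hardy_calculus_sot hardy_calculus_weak_star)+
qed

end
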